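(* Let $K$ be a p.c.f. self-similar set generated by an IFS $F_i(x)=\rho(x-b_i)+b_i$, $1\le i\le N$, on $\mathbb R^d$ with $0<\rho<1$. Assume that the asymptotic geometric growth rates $R(p,q)$ $(>1)$ of the traces $R_n(p,q)$ exist for all $p\neq q$ in $V_0$. Let $$R^\#=\min\big\{s:\ \forall\,p\ne q\text{ in }V_0\ \exists\text{ a chain }p=p_1,p_2,\dots,p_m=q\text{ in }V_0\text{ with }R(p_i,p_{i+1})\le s,\ 1\le i\le m-1\big\}.$$ Suppose there is a compatible relation on $V_0$ such that for any small $\varepsilon>0$, $$\lim_{n\to\infty}\frac{(R^\#)^{(1-\varepsilon)n}}{R^\sim_n(J_i,J_j)}=0\qquad\text{for all }J_i\neq J_j\text{ in }V_0^\sim .$$ Then $\sigma^\#=\frac12\Big(\frac{\log R^\#}{-\log\rho}+\alpha\Big)$.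
   Context: **P.c.f. setting.** $K=\bigcup_{i=1}^NF_i(K)$ is the nonempty compact self-similar set, assumed connected. For a word $\omega=\omega_1\cdots\omega_n\in\{1,\dots,N\}^n$, $|\omega|=n$, put $F_\omega=F_{\omega_1}\circ\cdots\circ F_{\omega_n}$, $K_\omega=F_\omega(K)$. Let $\pi:\{1,\dots,N\}^{\infty}\to K$ be $\{\pi(\omega)\}=\bigcap_nK_{\omega_1\cdots\omega_n}$, $\tau$ the left shift, $\mathcal C=\pi^{-1}(\bigcup_{i<j}(K_i\cap K_j))$ and $\mathcal P=\bigcup_{m\ge1}\tau^m(\mathcal C)$. The IFS (and $K$) is p.c.f. (post-critically finite) if $\mathcal P$ is finite. The boundary is $V_0=\pi(\mathcal P)$, assumed to have at least two points; $V_n=\bigcup_iF_i(V_{n-1})$, $V_*=\bigcup_nV_n$, and $V_\omega=F_\omega(V_0)$, $|\omega|=n$, is an $n$-cell. Let $\alpha=\log N/|\log\rho|=\dim_HK$ and let $\mu$ be the self-similar measure $\mu=\frac1N\sum_i\mu\circ F_i^{-1}$ (the normalized $\alpha$-Hausdorff measure, which is $\alpha$-regular). **Besov spaces.** For $\sigma>0$, $[u]^2_{B^\sigma_{2,\infty}}=\sup_{0<r<1}r^{-\alpha-2\sigma}\int_K\int_{B(x,r)}|u(x)-u(y)|^2d\mu(y)d\mu(x)$ and $B^\sigma_{2,\infty}=\{u\in L^2(K,\mu):\|u\|_2+[u]_{B^\sigma_{2,\infty}}<\infty\}$. $\sigma^\#=\sup\{\sigma: B^\sigma_{2,\infty}\text{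 contains non-constant functions}\}$. **Primal energy and traces.** For $u:V_n\to\mathbb R$ the primal energy is $E_n[u]=\sum_{|\omega|=n}\sum_{\{x,y\}\subset V_\omega}|u(x)-u(y)|^2$ (unordered pairs). The trace $R_n(p,q)$, $p\neq q\in V_0$, is defined by: for all $u:V_0\to\mathbb R$, $\min\{E_n[v]: v:V_n\to\mathbb R,\ v|_{V_0}=u\}=\sum_{\{p,q\}\subset V_0}\frac1{R_n(p,q)}|u(p)-u(q)|^2$. An increasing sequence $(R_n)$ of positive reals has asymptotic geometric growth rate $R>1$ if for every $\varepsilon>0$ there is $N(\varepsilon)$ with $R^{(1-\varepsilon)n}\le R_n\le R^{(1+\varepsilon)n}$ for all $n\ge N(\varepsilon)$; $R(p,q)$ denotes the rate of $(R_n(p,q))_n$. **Compatible relations and quotient traces.** Let $\sim\,=\,\sim_0$ be an equivalence relation on $V_0$ with at least two classes. Let $\sim_n$ be the smallest equivalence relation on $V_n$ such that (1) $x\sim_{n-1}y$ in $V_{n-1}$ implies $x\sim_ny$; (2) $x\sim_{n-1}y$ in $V_{n-1}$ implies $F_i(x)\sim_nF_i(y)$ for $1\le i\le N$. The relation $\sim$ is compatible if for all $n\ge0$ and $x,y\in V_n$: $x\sim_ny$ iff $x\sim_{n+1}y$. $V_n^\sim$ denotes the set of $\sim_n$-classes; functions on $V_n^\sim$ are identified with functions on $V_n$ constant on classes. The quotient trace $R_n^\sim(J_i,J_j)\in(0,\infty]$, $J_i\ne J_j\in V_0^\sim$, is defined by: for all $u:V_0^\sim\to\mathbb R$, $\min\{E_n[v]: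 v:V_n^\sim\to\mathbb R,\ v|_{V_0}=u\}=\sum_{\{J_i,J_j\}\subset V_0^\sim}\frac1{R^\sim_n(J_i,J_j)}|u(J_i)-u(J_j)|^2$. *)

theory Defs
  imports "HOL-Probability.Probability"
begin

text \<open>
  Throughout, an iterated function system is given by a number \<open>N\<close> of maps and a family
  \<open>F\<close> of which only \<open>F 1, \<dots>, F N\<close> matter. A finite word \<open>\<omega>\<^sub>1\<cdots>\<omega>\<^sub>n\<close> is a list \<open>w\<close>, and
  \<open>F\<^sub>\<omega> = F\<^bsub>\<omega>\<^sub>1\<^esub> \<circ> \<cdots> \<circ> F\<^bsub>\<omega>\<^sub>n\<^esub>\<close> is \<open>foldr F w\<close>. An infinite word is a function \<open>\<omega>\<close> on
  \<open>nat\<close> whose first letter is \<open>\<omega> 0\<close>.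
\<close>

definition fin_words :: "nat \<Rightarrow> nat \<Rightarrow> nat list set" where
  "fin_words N n = {w. length w = n \<and> set w \<subseteq> {1..N}}"

definition inf_words :: "nat \<Rightarrow> (nat \<Rightarrow> nat) set" where
  "inf_words N = {\<omega>. \<forall>k. \<omega> k \<in> {1..N}}"

definition attractor :: "nat \<Rightarrow> (nat \<Rightarrow> 'a \<Rightarrow> 'a) \<Rightarrow> 'a::topological_space set \<Rightarrow> bool" where
  "attractor N F K \<longleftrightarrow> K \<noteq> {} \<and> compact K \<and> K = (\<Union>i\<in>{1..N}. F i ` K)"

definition coding :: "(nat \<Rightarrow> 'a \<Rightarrow> 'a) \<Rightarrow> 'a set \<Rightarrow> (nat \<Rightarrow> nat) \<Rightarrow> 'a" where
  "coding F K \<omega> = (THE x. x \<in> (\<Inter>n. foldr F (map \<omega> [0..<n]) ` K))"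

definition shift :: "(nat \<Rightarrow> nat) \<Rightarrow> nat \<Rightarrow> nat" where
  "shift \<omega> = (\<lambda>k. \<omega> (Suc k))"

definition critical_set :: "nat \<Rightarrow> (nat \<Rightarrow> 'a \<Rightarrow> 'a) \<Rightarrow> 'a set \<Rightarrow> (nat \<Rightarrow> nat) set" where
  "critical_set N F K =
    {\<omega> \<in> inf_words N. \<exists>i\<in>{1..N}. \<exists>j\<in>{1..N}. i < j \<and> coding F K \<omega> \<in> F i ` K \<inter> F j ` K}"

definition post_critical_set :: "nat \<Rightarrow> (nat \<Rightarrow> 'a \<Rightarrow> 'a) \<Rightarrow> 'a set \<Rightarrow> (nat \<Rightarrow> nat) set" where
  "post_critical_set N F K = (\<Union>m\<in>{1..}. (shift ^^ m) ` critical_set N F K)"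

definition pcf :: "nat \<Rightarrow> (nat \<Rightarrow> 'a \<Rightarrow> 'a) \<Rightarrow> 'a set \<Rightarrow> bool" where
  "pcf N F K \<longleftrightarrow> finite (post_critical_set N F K)"

definition boundary :: "nat \<Rightarrow> (nat \<Rightarrow> 'a \<Rightarrow> 'a) \<Rightarrow> 'a set \<Rightarrow> 'a set" where
  "boundary N F K = coding F K ` post_critical_set N F K"

text \<open>In the following, \<open>V0\<close> stands for the boundary \<open>boundary N F K\<close>.\<close>

primrec vertices :: "nat \<Rightarrow> (nat \<Rightarrow> 'a \<Rightarrow> 'a) \<Rightarrow> 'a set \<Rightarrow> nat \<Rightarrow> 'a set" where
  "vertices N F V0 0 = V0"
| "vertices N F V0 (Suc n) = (\<Union>i\<in>{1..N}. F i ` vertices N F V0 n)"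

definition self_similar_measure ::
    "nat \<Rightarrow> (nat \<Rightarrow> 'a \<Rightarrow> 'a) \<Rightarrow> 'a::topological_space set \<Rightarrow> 'a measure \<Rightarrow> bool" where
  "self_similar_measure N F K \<mu> \<longleftrightarrow>
    prob_space \<mu> \<and> sets \<mu> = sets borel \<and> (AE x in \<mu>. x \<in> K) \<and>
    (\<forall>A\<in>sets borel. measure \<mu> A = (1 / real N) * (\<Sum>i\<in>{1..N}. measure \<mu> (F i -` A)))"

subsection \<open>Besov spaces\<close>

definition besov_seminorm_sq ::
    "'a::metric_space measure \<Rightarrow> 'a set \<Rightarrow> real \<Rightarrow> real \<Rightarrow> ('a \<Rightarrow> real) \<Rightarrow> ennreal" where
  "besov_seminorm_sq \<mu> K \<alpha> \<sigma> u =
    (SUP r\<in>{0<..<1}. ennreal (r powr (- \<alpha> - 2 * \<sigma>)) *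
      (\<integral>\<^sup>+x\<in>K. (\<integral>\<^sup>+y\<in>ball x r \<inter> K. ennreal (\<bar>u x - u y\<bar>\<^sup>2) \<partial>\<mu>) \<partial>\<mu>))"

text \<open>
  Functions on \<open>K\<close> are represented by functions on the ambient space; their values off \<open>K\<close>
  play no role.
\<close>

definition besov_space ::
    "'a::metric_space measure \<Rightarrow> 'a set \<Rightarrow> real \<Rightarrow> real \<Rightarrow> ('a \<Rightarrow> real) set" where
  "besov_space \<mu> K \<alpha> \<sigma> = {u \<in> borel_measurable \<mu>.
    (\<integral>\<^sup>+x\<in>K. ennreal (\<bar>u x\<bar>\<^sup>2) \<partial>\<mu>) < \<infinity> \<and> besov_seminorm_sq \<mu> K \<alpha> \<sigma> u < \<infinity>}"

definition critical_exponent :: "'a::metric_space measure \<Rightarrow> 'a set \<Rightarrow> real \<Rightarrow> ereal" where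
  "critical_exponent \<mu> K \<alpha> =
    (SUP \<sigma>\<in>{\<sigma>. 0 < \<sigma> \<and> (\<exists>u\<in>besov_space \<mu> K \<alpha> \<sigma>. \<not> (\<exists>c. AE x in \<mu>. x \<in> K \<longrightarrow> u x = c))}.
      ereal \<sigma>)"

subsection \<open>Primal energies and traces\<close>

text \<open>
  The sum of a symmetric function \<open>f\<close> over the unordered pairs \<open>{x, y} \<subseteq> A\<close> with \<open>x \<noteq> y\<close>:
  each pair occurs twice in the double sum.
\<close>

definition pair_sum :: "'b set \<Rightarrow> ('b \<Rightarrow> 'b \<Rightarrow> real) \<Rightarrow> real" where
  "pair_sum A f = (\<Sum>x\<in>A. \<Sum>y\<in>A - {x}. f x y) / 2"

definition energy ::
    "nat \<Rightarrow> (nat \<Rightarrow> 'a \<Rightarrow> 'a) \<Rightarrow> 'a set \<Rightarrow> nat \<Rightarrow> ('a \<Rightarrow> real) \<Rightarrow> real" where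
  "energy N F V0 n u =
    (\<Sum>w\<in>fin_words N n. pair_sum (foldr F w ` V0) (\<lambda>x y. \<bar>u x - u y\<bar>\<^sup>2))"

definition is_minimum :: "real set \<Rightarrow> real \<Rightarrow> bool" where
  "is_minimum S m \<longleftrightarrow> m \<in> S \<and> (\<forall>s\<in>S. m \<le> s)"

text \<open>
  \<open>R\<close> is the trace \<open>R\<^sub>n\<close> of the \<open>n\<close>-th energy on \<open>V0\<close>. The energy depends only on the values
  of its argument on the vertices of level \<open>n\<close>, so total functions \<open>v\<close> can be used.
\<close>

definition is_trace ::
    "nat \<Rightarrow> (nat \<Rightarrow> 'a \<Rightarrow> 'a) \<Rightarrow> 'a set \<Rightarrow> nat \<Rightarrow> ('a \<Rightarrow> 'a \<Rightarrow> real) \<Rightarrow> bool" where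
  "is_trace N F V0 n R \<longleftrightarrow>
    (\<forall>p\<in>V0. \<forall>q\<in>V0. p \<noteq> q \<longrightarrow> 0 < R p q \<and> R p q = R q p) \<and>
    (\<forall>u. is_minimum {energy N F V0 n v | v. \<forall>p\<in>V0. v p = u p}
           (pair_sum V0 (\<lambda>p q. 1 / R p q * \<bar>u p - u q\<bar>\<^sup>2)))"

text \<open>
  Monotonicity is required from index 1 on only, since \<open>R\<^sub>0\<close> is identically 1 for the traces.
\<close>

definition has_growth_rate :: "(nat \<Rightarrow> real) \<Rightarrow> real \<Rightarrow> bool" where
  "has_growth_rate r s \<longleftrightarrow> 1 < s \<and> (\<forall>n. 0 < r n) \<and> mono_on {1..} r \<and>
    (\<forall>\<epsilon>>0. \<exists>n0. \<forall>n\<ge>n0. s powr ((1 - \<epsilon>) * real n) \<le> r n \<and> r n \<le> s powr ((1 + \<epsilon>) * real n))"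

definition R_sharp :: "'a set \<Rightarrow> ('a \<Rightarrow> 'a \<Rightarrow> real) \<Rightarrow> real" where
  "R_sharp V0 R = (LEAST s. \<forall>p\<in>V0. \<forall>q\<in>V0. p \<noteq> q \<longrightarrow>
    (\<exists>ps. ps \<noteq> [] \<and> hd ps = p \<and> last ps = q \<and> set ps \<subseteq> V0 \<and>
          successively (\<lambda>x y. x \<noteq> y \<and> R x y \<le> s) ps))"

subsection \<open>Compatible relations and quotient traces\<close>

primrec induced_rel ::
    "nat \<Rightarrow> (nat \<Rightarrow> 'a \<Rightarrow> 'a) \<Rightarrow> 'a set \<Rightarrow> 'a rel \<Rightarrow> nat \<Rightarrow> 'a rel" where
  "induced_rel N F V0 r 0 = r"
| "induced_rel N F V0 r (Suc n) =
    \<Inter>{s. equiv (vertices N F V0 (Suc n)) s \<and> induced_rel N F V0 r n \<subseteq> s \<and>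
        (\<forall>(x, y)\<in>induced_rel N F V0 r n. \<forall>i\<in>{1..N}. (F i x, F i y) \<in> s)}"

definition compatible :: "nat \<Rightarrow> (nat \<Rightarrow> 'a \<Rightarrow> 'a) \<Rightarrow> 'a set \<Rightarrow> 'a rel \<Rightarrow> bool" where
  "compatible N F V0 r \<longleftrightarrow> equiv V0 r \<and> 2 \<le> card (V0 // r) \<and>
    (\<forall>n. \<forall>x\<in>vertices N F V0 n. \<forall>y\<in>vertices N F V0 n.
      (x, y) \<in> induced_rel N F V0 r n \<longleftrightarrow> (x, y) \<in> induced_rel N F V0 r (Suc n))"

text \<open>
  Here \<open>u\<close> is a function on the set \<open>V0 // r\<close> of classes, \<open>v\<close> a function constant on the
  classes of the level \<open>n\<close> relation, and \<open>1 / \<infinity> = 0\<close>.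
\<close>

definition is_quotient_trace ::
    "nat \<Rightarrow> (nat \<Rightarrow> 'a \<Rightarrow> 'a) \<Rightarrow> 'a set \<Rightarrow> 'a rel \<Rightarrow> nat \<Rightarrow> ('a set \<Rightarrow> 'a set \<Rightarrow> ennreal) \<Rightarrow> bool" where
  "is_quotient_trace N F V0 r n R \<longleftrightarrow>
    (\<forall>I\<in>V0 // r. \<forall>J\<in>V0 // r. I \<noteq> J \<longrightarrow> 0 < R I J \<and> R I J = R J I) \<and>
    (\<forall>u. is_minimum
           {energy N F V0 n v | v. (\<forall>(x, y)\<in>induced_rel N F V0 r n. v x = v y) \<and>
                                   (\<forall>p\<in>V0. v p = u (r `` {p}))}
           (pair_sum (V0 // r) (\<lambda>I J. enn2real (1 / R I J) * \<bar>u I - u J\<bar>\<^sup>2)))"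

end

theory Submission
  imports Defs
begin

text \<open>
  Write \<open>\<lambda> = R\<^sup>#\<close> and \<open>\<beta> = \<rho>\<^bsup>2 \<sigma> - \<alpha>\<^esup>\<close>. The claim is that the Besov space of order \<open>\<sigma>\<close>
  contains only constants if \<open>\<lambda> \<beta> < 1\<close>, and contains a non-constant function if
  \<open>1 / \<lambda> < \<beta> < 1\<close>. Since \<open>\<lambda> > 1\<close>, the two ranges of \<open>\<sigma>\<close> meet at the asserted value.

  The link between Besov seminorms and energies is that, up to constants, a double integral over
  \<open>dist x y < \<rho>\<^sup>n\<close> only sees pairs of \<open>n\<close>-cells that meet. All the maps have the same ratio
  and no rotation, so cells that meet are translates of each other by one of finitely many vectors
  (up to the scale \<open>\<rho>\<^sup>n\<close>). Hence a cell has boundedly many neighbours (\<open>card_neighbours_le\<close>) and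
  cells that do not meet are at distance at least \<open>\<delta> \<rho>\<^sup>n\<close> (\<open>separation\<close>). Moreover two cells
  meet only in common vertices (\<open>cell_intersection_boundary\<close>).

  Suppose \<open>\<lambda> \<beta> < 1\<close> and let \<open>u\<close> have finite seminorm. The means of \<open>u\<close> over the \<open>n\<close>-cells form
  a discrete function whose energy is \<open>O(\<beta>\<^sup>n)\<close> (\<open>besov_neighbour_energy\<close>). A function of energy \<open>E\<close>
  on \<open>V\<^sub>n\<close> varies between two points of \<open>V\<^sub>0\<close> by at most \<open>sqrt (E * r)\<close>, where \<open>r\<close> is the
  trace \<open>R\<^sub>n\<close> at these points, and along the chains in the definition of \<open>\<lambda>\<close> the traces are \<open>O(t\<^sup>n)\<close> for every \<open>t > \<lambda>\<close>
  (\<open>boundary_difference_le\<close>); summing over levels gives the same rate for the oscillation over all of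
  \<open>V\<^sub>n\<close> (\<open>oscillation_le_energy\<close>). So the spread of the means tends to \<open>0\<close>, and so does the part
  of the variance of \<open>u\<close> inside the cells: \<open>u\<close> is constant (\<open>besov_function_constant\<close>).

  Suppose \<open>1 / \<lambda> < \<beta> < 1\<close>. By the decay of the quotient conductances there is a level \<open>m\<close> such
  that boundary values constant on the classes of \<open>V\<^sub>0\<close> extend to \<open>V\<^sub>m\<close> with energy multiplied by
  at most \<open>\<beta>\<^sup>m < 1\<close>, the extension being again constant on the classes inside every \<open>m\<close>-cell
  (\<open>decay_extension\<close>). This can be repeated inside the cells for ever. The limit is a continuous function on
  \<open>K\<close> whose squared oscillation over a cell is controlled by the energy of the data on that cell;
  summing over pairs of neighbouring cells puts it into the Besov space
  (\<open>extension_in_besov_space\<close>). It extends the indicator of a class, so it is not constant.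
\<close>

section \<open>Words and cells\<close>

lemma fin_words_0 [simp]: "fin_words N 0 = {[]}"
  by (auto simp: fin_words_def)

lemma Cons_in_fin_words [simp]:
  "i # w \<in> fin_words N (Suc n) \<longleftrightarrow> i \<in> {1..N} \<and> w \<in> fin_words N n"
  by (auto simp: fin_words_def)

lemma fin_words_Suc: "fin_words N (Suc n) = (\<lambda>(i, w). i # w) ` ({1..N} \<times> fin_words N n)"
proof -
  have "\<exists>i v. w = i # v" if "w \<in> fin_words N (Suc n)" for w
    using that by (cases w) (auto simp: fin_words_def)
  then show ?thesis
    by (fastforce simp: image_iff)
qed

lemma take_drop_in_fin_words:
  assumes "w \<in> fin_words N (m + n)"
  shows "take m w \<in> fin_words N m" "drop m w \<in> fin_words N n"
  using assms set_take_subset[of m w] set_drop_subset[of m w] by (auto simp: fin_words_def)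

lemma finite_fin_words [simp]: "finite (fin_words N n)"
  by (induction n) (auto simp: fin_words_Suc)

lemma card_fin_words: "card (fin_words N n) = N ^ n"
proof (induction n)
  case (Suc n)
  have "inj_on (\<lambda>(i, w). i # w) ({1..N} \<times> fin_words N n)"
    by (auto simp: inj_on_def)
  then show ?case
    using Suc by (simp add: fin_words_Suc card_image card_cartesian_product)
qed simp

lemma sum_fin_words_Suc:
  "(\<Sum>w\<in>fin_words N (Suc n). g w) = (\<Sum>i\<in>{1..N}. \<Sum>w\<in>fin_words N n. g (i # w))"
proof -
  have "inj_on (\<lambda>(i, w). i # w) ({1..N} \<times> fin_words N n)"
    by (auto simp: inj_on_def)
  then have "(\<Sum>w\<in>fin_words N (Suc n). g w) = (\<Sum>x\<in>{1..N} \<times> fin_words N n. g (fst x # snd x))"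
    unfolding fin_words_Suc by (subst sum.reindex) (auto simp: case_prod_unfold)
  also have "\<dots> = (\<Sum>i\<in>{1..N}. \<Sum>w\<in>fin_words N n. g (i # w))"
    by (simp add: sum.cartesian_product case_prod_unfold)
  finally show ?thesis .
qed

lemma sum_fin_words_append:
  "(\<Sum>w\<in>fin_words N (m + n). g w) = (\<Sum>v\<in>fin_words N m. \<Sum>w\<in>fin_words N n. g (v @ w))"
  by (induction m arbitrary: g) (simp_all add: sum_fin_words_Suc)

definition prepend :: "nat list \<Rightarrow> (nat \<Rightarrow> nat) \<Rightarrow> nat \<Rightarrow> nat" where
  "prepend w \<eta> k = (if k < length w then w ! k else \<eta> (k - length w))"

lemma prepend_in_inf_words:
  "w \<in> fin_words N n \<Longrightarrow> \<eta> \<in> inf_words N \<Longrightarrow> prepend w \<eta> \<in> inf_words N"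
  using nth_mem by (fastforce simp: prepend_def inf_words_def fin_words_def)

lemma funpow_shift: "(shift ^^ n) \<eta> = (\<lambda>k. \<eta> (n + k))"
  by (induction n) (simp_all add: shift_def)

lemma shift_in_inf_words: "\<eta> \<in> inf_words N \<Longrightarrow> (shift ^^ n) \<eta> \<in> inf_words N"
  by (simp add: funpow_shift inf_words_def)

lemma map_prefix_in_fin_words: "\<eta> \<in> inf_words N \<Longrightarrow> map \<eta> [0..<n] \<in> fin_words N n"
  by (auto simp: inf_words_def fin_words_def)

lemma map_prefix_add: "map \<eta> [0..<m + n] = map \<eta> [0..<m] @ map ((shift ^^ m) \<eta>) [0..<n]"
  by (rule nth_equalityI) (auto simp: nth_append funpow_shift)

lemma map_prepend_prefix: "map (prepend w \<eta>) [0..<length w + n] = w @ map \<eta> [0..<n]"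
  by (rule nth_equalityI) (auto simp: nth_append prepend_def)

lemma shift_prepend: "(shift ^^ length w) (prepend w \<eta>) = \<eta>"
  by (simp add: funpow_shift prepend_def fun_eq_iff)

section \<open>Post-critically finite sets generated by homotheties of equal ratio\<close>

locale pcf_homotheties =
  fixes N :: nat and \<rho> :: real and c :: "nat \<Rightarrow> 'a::euclidean_space"
    and F :: "nat \<Rightarrow> 'a \<Rightarrow> 'a" and K V0 :: "'a set"
  assumes rho_pos: "0 < \<rho>" and rho_less: "\<rho> < 1"
    and F_eq: "i \<in> {1..N} \<Longrightarrow> F i x = \<rho> *\<^sub>R x + c i"
    and attractor: "attractor N F K" and connected_K: "connected K"
    and pcf: "pcf N F K" and V0_eq: "V0 = boundary N F K" and card_V0: "2 \<le> card V0"
begin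

lemma K_nonempty: "K \<noteq> {}" and compact_K: "compact K" and K_eq: "K = (\<Union>i\<in>{1..N}. F i ` K)"
  using attractor by (auto simp: attractor_def)

lemma finite_V0 [simp]: "finite V0"
  using card_V0 by (metis card.infinite not_numeral_le_zero)

lemma V0_nonempty: "V0 \<noteq> {}"
  using card_V0 by auto

lemma N_pos: "0 < N"
  using K_nonempty K_eq by (cases N) auto

lemma cell_map_eq: "w \<in> fin_words N n \<Longrightarrow> foldr F w x = \<rho> ^ n *\<^sub>R x + foldr F w 0"
proof (induction n arbitrary: w)
  case (Suc n)
  from Suc.prems obtain i v where w: "w = i # v" "i \<in> {1..N}" "v \<in> fin_words N n"
    by (auto simp: fin_words_Suc)
  have "foldr F w x = \<rho> *\<^sub>R (\<rho> ^ n *\<^sub>R x + foldr F v 0) + c i"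
    using Suc.IH[OF w(3)] w F_eq by simp
  also have "\<dots> = \<rho> ^ Suc n *\<^sub>R x + foldr F w 0"
    using w F_eq by (simp add: scaleR_add_right)
  finally show ?case .
qed simp

lemma dist_cell_map: "w \<in> fin_words N n \<Longrightarrow> dist (foldr F w x) (foldr F w y) = \<rho> ^ n * dist x y"
proof -
  assume w: "w \<in> fin_words N n"
  have "dist (foldr F w x) (foldr F w y) = norm (\<rho> ^ n *\<^sub>R (x - y))"
    using cell_map_eq[OF w, of x] cell_map_eq[OF w, of y]
    by (simp add: dist_norm scaleR_diff_right)
  then show ?thesis
    using rho_pos by (simp add: dist_norm)
qed

lemma inj_cell_map: "w \<in> fin_words N n \<Longrightarrow> inj (foldr F w)"
  using dist_cell_map[of w n] rho_pos by (metis dist_eq_0_iff injI mult_eq_0_iff power_eq_0_iff less_irrefl)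

lemma cell_map_eq_iff: "w \<in> fin_words N n \<Longrightarrow> foldr F w x = foldr F w y \<longleftrightarrow> x = y"
  using inj_cell_map by (auto dest: injD)

lemma continuous_cell_map: "w \<in> fin_words N n \<Longrightarrow> continuous_on A (foldr F w)"
proof -
  assume w: "w \<in> fin_words N n"
  have "continuous_on A (\<lambda>x. \<rho> ^ n *\<^sub>R x + foldr F w 0)"
    by (intro continuous_intros)
  then show ?thesis
    using cell_map_eq[OF w] by (metis (mono_tags, lifting) continuous_on_cong)
qed

lemma compact_cell: "w \<in> fin_words N n \<Longrightarrow> compact (foldr F w ` K)"
  by (intro compact_continuous_image continuous_cell_map compact_K)

lemma K_eq_cells: "K = (\<Union>w\<in>fin_words N n. foldr F w ` K)"
proof (induction n)
  case (Suc n)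
  have "K = (\<Union>i\<in>{1..N}. F i ` (\<Union>w\<in>fin_words N n. foldr F w ` K))"
    using K_eq Suc by simp
  also have "\<dots> = (\<Union>w\<in>fin_words N (Suc n). foldr F w ` K)"
    by (fastforce simp: fin_words_Suc)
  finally show ?case .
qed simp

lemma cell_subset: "w \<in> fin_words N n \<Longrightarrow> foldr F w ` K \<subseteq> K"
  using K_eq_cells[of n] by blast

lemma cell_map_in_K: "w \<in> fin_words N n \<Longrightarrow> x \<in> K \<Longrightarrow> foldr F w x \<in> K"
  using cell_subset by blast

lemma in_cellE:
  assumes "x \<in> K"
  obtains w y where "w \<in> fin_words N n" "y \<in> K" "x = foldr F w y"
  using assms K_eq_cells[of n] by blast

lemma dist_in_K_le: "x \<in> K \<Longrightarrow> y \<in> K \<Longrightarrow> dist x y \<le> diameter K"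
  using compact_K compact_imp_bounded diameter_bounded_bound by blast

lemma dist_in_cell_le:
  "w \<in> fin_words N n \<Longrightarrow> x \<in> foldr F w ` K \<Longrightarrow> y \<in> foldr F w ` K \<Longrightarrow> dist x y \<le> \<rho> ^ n * diameter K"
  using dist_in_K_le rho_pos by (auto simp: dist_cell_map intro!: mult_left_mono)

lemma rho_power_tendsto: "(\<lambda>n. \<rho> ^ n * D) \<longlonglongrightarrow> 0"
  using rho_pos rho_less by (auto intro!: tendsto_mult_left_zero LIMSEQ_realpow_zero)

subsection \<open>The coding map\<close>

text \<open>
  The cells along an infinite word are nested compact sets with diameters tending to \<open>0\<close>.
\<close>

lemma coding_ex1:
  assumes "\<eta> \<in> inf_words N"
  shows "\<exists>!x. x \<in> (\<Inter>n. foldr F (map \<eta> [0..<n]) ` K)"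
proof -
  let ?C = "\<lambda>n. foldr F (map \<eta> [0..<n]) ` K"
  have w: "map \<eta> [0..<n] \<in> fin_words N n" for n
    using assms by (rule map_prefix_in_fin_words)
  have "(\<Inter>n. ?C n) \<noteq> {}"
  proof (rule compact_nest)
    show "compact (?C n)" "?C n \<noteq> {}" for n
      using compact_cell[OF w[of n]] K_nonempty by auto
    show "?C n \<subseteq> ?C m" if mn: "m \<le> n" for m n
    proof -
      obtain k where n: "n = m + k"
        using mn le_Suc_ex by blast
      have "map ((shift ^^ m) \<eta>) [0..<k] \<in> fin_words N k"
        by (rule map_prefix_in_fin_words[OF shift_in_inf_words[OF assms]])
      then have "foldr F (map ((shift ^^ m) \<eta>) [0..<k]) ` K \<subseteq> K"
        by (rule cell_subset)
      then show ?thesis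
        unfolding n map_prefix_add by (auto simp: foldr_append)
    qed
  qed
  moreover have "x = y" if "x \<in> (\<Inter>n. ?C n)" "y \<in> (\<Inter>n. ?C n)" for x y
  proof -
    have "dist x y \<le> \<rho> ^ n * diameter K" for n
      using that by (intro dist_in_cell_le[OF w[of n]]) auto
    then have "dist x y \<le> 0"
      by (intro LIMSEQ_le_const[OF rho_power_tendsto[of "diameter K"]]) auto
    then show ?thesis by simp
  qed
  ultimately show ?thesis by blast
qed

lemma coding_in_cell:
  assumes "\<eta> \<in> inf_words N" shows "coding F K \<eta> \<in> foldr F (map \<eta> [0..<n]) ` K"
  using theI'[OF coding_ex1[OF assms]] unfolding coding_def by blast

lemma coding_eqI:
  assumes "\<eta> \<in> inf_words N" "\<And>n. x \<in> foldr F (map \<eta> [0..<n]) ` K"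
  shows "coding F K \<eta> = x"
  unfolding coding_def using coding_ex1[OF assms(1)] assms(2) by (intro the1_equality) auto

lemma coding_in_K: "\<eta> \<in> inf_words N \<Longrightarrow> coding F K \<eta> \<in> K"
  using coding_in_cell[of \<eta> 0] by simp

lemma coding_prepend:
  assumes w: "w \<in> fin_words N n" and \<eta>: "\<eta> \<in> inf_words N"
  shows "coding F K (prepend w \<eta>) = foldr F w (coding F K \<eta>)"
proof (rule coding_eqI)
  show in_words: "prepend w \<eta> \<in> inf_words N"
    using w \<eta> by (rule prepend_in_inf_words)
  fix k
  have lw: "length w = n"
    using w by (simp add: fin_words_def)
  have "foldr F w (coding F K \<eta>) \<in> foldr F (map (prepend w \<eta>) [0..<k + n]) ` K"
    using coding_in_cell[OF \<eta>, of k] map_prepend_prefix[of w \<eta> k] by (auto simp: lw add.commute)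
  moreover have "map ((shift ^^ k) (prepend w \<eta>)) [0..<n] \<in> fin_words N n"
    by (rule map_prefix_in_fin_words[OF shift_in_inf_words[OF in_words]])
  then have "foldr F (map ((shift ^^ k) (prepend w \<eta>)) [0..<n]) ` K \<subseteq> K"
    by (rule cell_subset)
  ultimately show "foldr F w (coding F K \<eta>) \<in> foldr F (map (prepend w \<eta>) [0..<k]) ` K"
    unfolding map_prefix_add by auto
qed

lemma coding_shift:
  assumes "\<eta> \<in> inf_words N"
  shows "coding F K \<eta> = foldr F (map \<eta> [0..<n]) (coding F K ((shift ^^ n) \<eta>))"
proof -
  have "\<eta> = prepend (map \<eta> [0..<n]) ((shift ^^ n) \<eta>)"
    by (auto simp: prepend_def funpow_shift)
  then show ?thesis
    using coding_prepend[OF map_prefix_in_fin_words shift_in_inf_words] assms by metis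
qed

lemma coding_surj:
  assumes "x \<in> K"
  obtains \<eta> where "\<eta> \<in> inf_words N" "coding F K \<eta> = x"
proof -
  have step: "\<exists>p. fst p \<in> {1..N} \<and> snd p \<in> K \<and> y = F (fst p) (snd p)" if y: "y \<in> K" for y
  proof -
    have "y \<in> (\<Union>i\<in>{1..N}. F i ` K)"
      using y K_eq by blast
    then show ?thesis by auto
  qed
  define nxt where "nxt y = (SOME p. fst p \<in> {1..N} \<and> snd p \<in> K \<and> y = F (fst p) (snd p))" for y
  have nxt: "fst (nxt y) \<in> {1..N}" "snd (nxt y) \<in> K" "y = F (fst (nxt y)) (snd (nxt y))"
    if "y \<in> K" for y
    using someI_ex[OF step[OF that]] unfolding nxt_def by auto
  define y where "y n = ((snd \<circ> nxt) ^^ n) x" for n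
  define \<eta> where "\<eta> n = fst (nxt (y n))" for n
  have y: "y n \<in> K" for n
    using assms nxt(2) by (induction n) (simp_all add: y_def)
  have \<eta>: "\<eta> \<in> inf_words N"
    using nxt(1) y by (auto simp: inf_words_def \<eta>_def)
  have "x = foldr F (map \<eta> [0..<n]) (y n)" for n
  proof (induction n)
    case (Suc n)
    have "y n = F (\<eta> n) (y (Suc n))"
      using nxt(3)[OF y[of n]] by (simp add: \<eta>_def y_def)
    then show ?case using Suc by simp
  qed (simp add: y_def)
  then have "coding F K \<eta> = x"
    using y by (intro coding_eqI[OF \<eta>]) blast
  then show ?thesis
    using that \<eta> by blast
qed

subsection \<open>Cells meet only at boundary points\<close>

lemma post_critical_in_inf_words: "\<eta> \<in> post_critical_set N F K \<Longrightarrow> \<eta> \<in> inf_words N"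
  by (auto simp: post_critical_set_def critical_set_def shift_in_inf_words)

lemma V0_subset_K: "V0 \<subseteq> K"
  using coding_in_K post_critical_in_inf_words by (auto simp: V0_eq boundary_def)

lemma V0_in_K: "p \<in> V0 \<Longrightarrow> p \<in> K"
  using V0_subset_K by blast

lemma shift_post_critical:
  assumes "\<eta> \<in> post_critical_set N F K" shows "(shift ^^ n) \<eta> \<in> post_critical_set N F K"
proof -
  obtain m \<xi> where "1 \<le> m" "\<xi> \<in> critical_set N F K" "\<eta> = (shift ^^ m) \<xi>"
    using assms by (auto simp: post_critical_set_def)
  moreover have "(shift ^^ n) ((shift ^^ m) \<xi>) = (shift ^^ (n + m)) \<xi>"
    by (simp add: funpow_add)
  ultimately show ?thesis
    unfolding post_critical_set_def by (intro UN_I[of "n + m"]) auto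
qed

lemma V0_codingE:
  assumes "p \<in> V0"
  obtains \<eta> where "\<eta> \<in> inf_words N" "coding F K \<eta> = p"
    "\<And>n. coding F K ((shift ^^ n) \<eta>) \<in> V0"
    "\<And>n. p = foldr F (map \<eta> [0..<n]) (coding F K ((shift ^^ n) \<eta>))"
proof -
  obtain \<eta> where "\<eta> \<in> post_critical_set N F K" "p = coding F K \<eta>"
    using assms by (auto simp: V0_eq boundary_def)
  then show ?thesis
    using that shift_post_critical post_critical_in_inf_words coding_shift
    unfolding V0_eq boundary_def by (metis imageI)
qed

lemma V0_in_cellE:
  assumes "p \<in> V0"
  obtains w q where "w \<in> fin_words N n" "q \<in> V0" "p = foldr F w q"
  using V0_codingE[OF assms] map_prefix_in_fin_words by metis

text \<open>
  At the first letter where two words of equal length differ, a common point of their cells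
  becomes a common point of two first-level cells; all its codings are then critical, so cutting
  off the remaining letters leaves a post-critical word.
\<close>

lemma cell_intersection_boundary:
  assumes "w \<in> fin_words N n" "w' \<in> fin_words N n" "w \<noteq> w'"
    and "x \<in> foldr F w ` K" "x \<in> foldr F w' ` K"
  shows "x \<in> foldr F w ` V0"
  using assms
proof (induction n arbitrary: w w' x)
  case (Suc n)
  obtain i v j v' where w: "w = i # v" "i \<in> {1..N}" "v \<in> fin_words N n"
    and w': "w' = j # v'" "j \<in> {1..N}" "v' \<in> fin_words N n"
    using Suc.prems(1,2) by (auto simp: fin_words_Suc)
  obtain y y' where y: "y \<in> K" "x = F i (foldr F v y)" and y': "y' \<in> K" "x = F j (foldr F v' y')"
    using Suc.prems w w' by auto
  show ?case
  proof (cases "i = j")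
    case True
    have "foldr F v y = foldr F v' y'"
      using y y' True F_eq[OF w(2)] rho_pos by simp
    then have "foldr F v y \<in> foldr F v ` V0"
      using Suc.IH[OF w(3) w'(3)] Suc.prems(3) w w' True y(1) y'(1) by (metis imageI)
    then show ?thesis
      using y(2) w(1) by auto
  next
    case False
    obtain \<eta> where \<eta>: "\<eta> \<in> inf_words N" "coding F K \<eta> = y"
      using coding_surj[OF y(1)] by blast
    have w_in: "w \<in> fin_words N (Suc n)" and lw: "length w = Suc n"
      using Suc.prems(1) by (auto simp: fin_words_def)
    have "coding F K (prepend w \<eta>) = x"
      using coding_prepend[OF w_in \<eta>(1)] y \<eta> w(1) by simp
    moreover have "x \<in> F i ` K" "x \<in> F j ` K"
      using y(2) y'(2) cell_map_in_K[OF w(3) y(1)] cell_map_in_K[OF w'(3) y'(1)] by blast+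
    then have "\<exists>k\<in>{1..N}. \<exists>l\<in>{1..N}. k < l \<and> x \<in> F k ` K \<inter> F l ` K"
      using w(2) w'(2) False by (meson IntI linorder_neqE_nat)
    ultimately have "prepend w \<eta> \<in> critical_set N F K"
      using prepend_in_inf_words[OF w_in \<eta>(1)] unfolding critical_set_def by blast
    then have "(shift ^^ length w) (prepend w \<eta>) \<in> post_critical_set N F K"
      unfolding post_critical_set_def using lw by (intro UN_I[of "length w"]) auto
    then have "y \<in> V0"
      using \<eta> by (auto simp: shift_prepend V0_eq boundary_def)
    then show ?thesis
      using y(2) w(1) by auto
  qed
qed simp

lemma meeting_cells_vertexE:
  assumes "w \<in> fin_words N n" "w' \<in> fin_words N n"
    and "x \<in> foldr F w ` K" "x \<in> foldr F w' ` K" and "w \<noteq> w'"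
  obtains p q where "p \<in> V0" "q \<in> V0" "x = foldr F w p" "x = foldr F w' q"
  using cell_intersection_boundary[OF assms(1,2,5,3,4)]
    cell_intersection_boundary[OF assms(2,1) assms(5)[symmetric] assms(4,3)] that by blast

lemma infinite_K: "infinite K"
proof
  assume "finite K"
  then obtain x where "K \<subseteq> {x}"
    using connected_K connected_finite_iff_sing by blast
  then have "V0 \<subseteq> {x}"
    using V0_subset_K by blast
  then show False
    using card_V0 card_mono[of "{x}" V0] by simp
qed

text \<open>
  Equal offsets mean equal cells; but distinct words give cells that share only finitely many points,
  and \<open>K\<close> is infinite.
\<close>

lemma offset_inj:
  assumes w: "w \<in> fin_words N n" "w' \<in> fin_words N n" and eq: "foldr F w 0 = foldr F w' 0"
  shows "w = w'"
proof (rule ccontr)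
  assume "w \<noteq> w'"
  have "foldr F w x = foldr F w' x" for x
    using cell_map_eq[OF w(1), of x] cell_map_eq[OF w(2), of x] eq by simp
  then have "foldr F w ` K \<subseteq> foldr F w ` V0"
    using cell_intersection_boundary[OF w \<open>w \<noteq> w'\<close>] by (metis image_cong subsetI)
  then have "finite (foldr F w ` K)"
    by (meson finite_V0 finite_imageI finite_subset)
  then show False
    using infinite_K inj_cell_map[OF w(1)] finite_imageD inj_on_subset by blast
qed

definition meets :: "nat list \<Rightarrow> nat list \<Rightarrow> bool" where
  "meets w w' \<longleftrightarrow> foldr F w ` K \<inter> foldr F w' ` K \<noteq> {}"

lemma meets_sym: "meets w w' \<longleftrightarrow> meets w' w"
  by (auto simp: meets_def)

lemma meets_refl [simp]: "meets w w"
  using K_nonempty by (simp add: meets_def)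

lemma meets_offset:
  assumes w: "w \<in> fin_words N n" "w' \<in> fin_words N n" and "meets w w'"
  obtains p q where "p \<in> V0" "q \<in> V0" "foldr F w' 0 = foldr F w 0 + \<rho> ^ n *\<^sub>R (p - q)"
proof -
  obtain p0 where p0: "p0 \<in> V0"
    using V0_nonempty by blast
  obtain x where x: "x \<in> foldr F w ` K" "x \<in> foldr F w' ` K"
    using assms(3) by (auto simp: meets_def)
  show ?thesis
  proof (cases "w = w'")
    case True
    then show ?thesis using that[OF p0 p0] by simp
  next
    case False
    then obtain p q where pq: "p \<in> V0" "q \<in> V0" "foldr F w p = foldr F w' q"
      using meeting_cells_vertexE[OF w x False] by metis
    have "\<rho> ^ n *\<^sub>R p + foldr F w 0 = \<rho> ^ n *\<^sub>R q + foldr F w' 0"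
      using pq(3) cell_map_eq[OF w(1), of p] cell_map_eq[OF w(2), of q] by simp
    then have "foldr F w' 0 = foldr F w 0 + \<rho> ^ n *\<^sub>R (p - q)"
      by (simp add: scaleR_diff_right algebra_simps)
    then show ?thesis using that pq by blast
  qed
qed

text \<open>
  A cell is determined by its level and its offset, and the offsets of the neighbours of a given
  cell differ from its own by one of finitely many vectors.
\<close>

lemma card_neighbours_le:
  assumes w: "w \<in> fin_words N n"
  shows "card {w' \<in> fin_words N n. meets w w'} \<le> card V0 ^ 2"
proof -
  let ?S = "{w' \<in> fin_words N n. meets w w'}"
  let ?T = "(\<lambda>(p, q). foldr F w 0 + \<rho> ^ n *\<^sub>R (p - q)) ` (V0 \<times> V0)"
  have "inj_on (\<lambda>w'. foldr F w' 0) ?S"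
    using offset_inj by (auto simp: inj_on_def)
  moreover have "(\<lambda>w'. foldr F w' 0) ` ?S \<subseteq> ?T"
  proof safe
    fix w' assume "w' \<in> fin_words N n" "meets w w'"
    then show "foldr F w' 0 \<in> ?T"
      using meets_offset[OF w] by (metis (mono_tags, lifting) SigmaI case_prod_conv image_eqI)
  qed
  ultimately have "card ?S \<le> card ?T"
    by (intro card_inj_on_le[where f = "\<lambda>w'. foldr F w' 0"]) auto
  also have "\<dots> \<le> card (V0 \<times> V0)"
    by (intro card_image_le) simp
  finally show ?thesis
    by (simp add: power2_eq_square)
qed

text \<open>
  Cells that do not meet are separated by a fixed multiple of their size. Consider the first level
  at which their ancestors fall apart: one level up the ancestors still meet, so by
  \<open>meets_offset\<close> the pair of children is, up to a similarity of ratio \<open>\<rho>\<^sup>n\<close>, one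
  of finitely many pairs of disjoint compact sets.
\<close>

lemma separation:
  obtains \<delta> where "0 < \<delta>"
    "\<And>n w w' x y. w \<in> fin_words N n \<Longrightarrow> w' \<in> fin_words N n \<Longrightarrow> x \<in> foldr F w ` K \<Longrightarrow>
       y \<in> foldr F w' ` K \<Longrightarrow> dist x y < \<delta> * \<rho> ^ n \<Longrightarrow> meets w w'"
proof -
  define T where "T = (\<lambda>(p, q). p - q) ` (V0 \<times> V0)"
  have fT: "finite T"
    by (simp add: T_def)
  let ?far = "\<lambda>i j t d. \<forall>x\<in>F i ` K. \<forall>y\<in>F j ` K. d \<le> dist x (y + t)"
  have "\<exists>d>0. F i ` K \<inter> (\<lambda>y. y + t) ` F j ` K = {} \<longrightarrow> ?far i j t d"
    if ij: "i \<in> {1..N}" "j \<in> {1..N}" for i j t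
  proof (cases "F i ` K \<inter> (\<lambda>y. y + t) ` F j ` K = {}")
    case True
    have comp: "compact (F k ` K)" if "k \<in> {1..N}" for k
      using compact_cell[of "[k]" 1] that by simp
    have "compact ((\<lambda>y. y + t) ` F j ` K)"
      by (intro compact_continuous_image comp ij continuous_intros)
    then obtain d where "d > 0" "\<forall>x\<in>F i ` K. \<forall>y\<in>(\<lambda>y. y + t) ` F j ` K. d \<le> dist x y"
      using separate_compact_closed[OF comp[OF ij(1)]] True compact_imp_closed by metis
    then show ?thesis by auto
  qed (auto intro: zero_less_one)
  then obtain d where d: "\<And>i j t. i \<in> {1..N} \<Longrightarrow> j \<in> {1..N} \<Longrightarrow> d i j t > 0 \<and>
      (F i ` K \<inter> (\<lambda>y. y + t) ` F j ` K = {} \<longrightarrow> ?far i j t (d i j t))"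
    by metis
  define D where "D = insert 1 ((\<lambda>(i, j, t). d i j t) ` ({1..N} \<times> {1..N} \<times> T))"
  have D: "finite D" "D \<noteq> {}"
    by (auto simp: D_def fT)
  define \<delta> where "\<delta> = Min D"
  have pos: "0 < \<delta>"
    unfolding \<delta>_def using D d by (subst Min_gr_iff) (auto simp: D_def)
  have le: "\<delta> \<le> d i j t" if "i \<in> {1..N}" "j \<in> {1..N}" "t \<in> T" for i j t
    unfolding \<delta>_def using D that by (intro Min_le) (force simp: D_def)+
  have main: "\<delta> * \<rho> ^ n \<le> dist x y"
    if "w \<in> fin_words N n" "w' \<in> fin_words N n" "x \<in> foldr F w ` K" "y \<in> foldr F w' ` K"
      "\<not> meets w w'" for n w w' x y
    using that
  proof (induction n arbitrary: w w')
    case 0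
    then show ?case by simp
  next
    case (Suc n)
    define v i where "v = take n w" and "i = drop n w ! 0"
    define v' j where "v' = take n w'" and "j = drop n w' ! 0"
    have split: "u = take n u @ [drop n u ! 0] \<and> take n u \<in> fin_words N n \<and> drop n u ! 0 \<in> {1..N}"
      if "u \<in> fin_words N (Suc n)" for u
    proof -
      have u: "u \<in> fin_words N (n + 1)" using that by simp
      obtain k where "drop n u = [k]" "k \<in> {1..N}"
        using take_drop_in_fin_words(2)[OF u] by (auto simp: fin_words_Suc)
      then show ?thesis
        using take_drop_in_fin_words(1)[OF u] append_take_drop_id[of n u] by simp
    qed
    have w: "w = v @ [i]" "v \<in> fin_words N n" "i \<in> {1..N}"
      using split[OF Suc.prems(1)] by (auto simp: v_def i_def)
    have w': "w' = v' @ [j]" "v' \<in> fin_words N n" "j \<in> {1..N}"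
      using split[OF Suc.prems(2)] by (auto simp: v'_def j_def)
    obtain a where a: "a \<in> K" "x = foldr F v (F i a)"
      using Suc.prems(3) w by auto
    obtain b where b: "b \<in> K" "y = foldr F v' (F j b)"
      using Suc.prems(4) w' by auto
    show ?case
    proof (cases "meets v v'")
      case True
      then obtain p q where pq: "p \<in> V0" "q \<in> V0"
        "foldr F v' 0 = foldr F v 0 + \<rho> ^ n *\<^sub>R (p - q)"
        using meets_offset[OF w(2) w'(2)] by metis
      define t where "t = p - q"
      have t: "t \<in> T"
        using pq by (auto simp: T_def t_def)
      have shiftt: "foldr F v' z = foldr F v (z + t)" for z
        using cell_map_eq[OF w(2), of "z + t"] cell_map_eq[OF w'(2), of z] pq(3)
        by (simp add: t_def scaleR_add_right)
      have "F i ` K \<inter> (\<lambda>y. y + t) ` F j ` K = {}"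
      proof (rule ccontr)
        assume "F i ` K \<inter> (\<lambda>y. y + t) ` F j ` K \<noteq> {}"
        then obtain a' b' where "a' \<in> K" "b' \<in> K" "F i a' = F j b' + t"
          by auto
        then have "foldr F w a' = foldr F w' b'" "a' \<in> K" "b' \<in> K"
          using shiftt w(1) w'(1) by auto
        then show False
          using Suc.prems(5) unfolding meets_def by (metis IntI empty_iff imageI)
      qed
      then have "\<delta> \<le> dist (F i a) (F j b + t)"
        using d[OF w(3) w'(3), of t] le[OF w(3) w'(3) t] a(1) b(1) by force
      then have "\<delta> * \<rho> ^ n \<le> dist x y"
        using dist_cell_map[OF w(2)] a(2) b(2) shiftt rho_pos by (simp add: mult.commute)
      moreover have "\<delta> * \<rho> ^ Suc n \<le> \<delta> * \<rho> ^ n"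
        using pos rho_pos rho_less by (intro mult_left_mono) (auto simp: mult_le_cancel_right1)
      ultimately show ?thesis by linarith
    next
      case False
      have Fa: "F i a \<in> K" "F j b \<in> K"
        using a(1) b(1) cell_map_in_K[of "[i]" 1] cell_map_in_K[of "[j]" 1] w(3) w'(3) by auto
      then have "\<delta> * \<rho> ^ n \<le> dist x y"
        using Suc.IH[OF w(2) w'(2)] a b False by blast
      moreover have "\<delta> * \<rho> ^ Suc n \<le> \<delta> * \<rho> ^ n"
        using pos rho_pos rho_less by (intro mult_left_mono) (auto simp: mult_le_cancel_right1)
      ultimately show ?thesis by linarith
    qed
  qed
  show ?thesis
    using that[OF pos] main by (metis linorder_not_le)
qed

end

section \<open>Sums over pairs\<close>

lemma pair_sum_image:
  assumes "inj_on g A"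
  shows "pair_sum (g ` A) f = pair_sum A (\<lambda>x y. f (g x) (g y))"
proof -
  have "(\<Sum>y\<in>g ` A - {g x}. f (g x) y) = (\<Sum>y\<in>A - {x}. f (g x) (g y))" if "x \<in> A" for x
  proof -
    have "g ` A - {g x} = g ` (A - {x})"
      using assms that by (auto simp: inj_on_def)
    then show ?thesis
      using inj_on_subset[OF assms] by (simp add: sum.reindex)
  qed
  then show ?thesis
    using assms by (simp add: pair_sum_def sum.reindex)
qed

lemma pair_sum_nonneg: "(\<And>x y. 0 \<le> f x y) \<Longrightarrow> 0 \<le> pair_sum A f"
  by (simp add: pair_sum_def sum_nonneg)

lemma pair_sum_le:
  assumes "finite A" "\<And>x y. x \<in> A \<Longrightarrow> y \<in> A \<Longrightarrow> x \<noteq> y \<Longrightarrow> f x y \<le> M" "0 \<le> M"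
  shows "pair_sum A f \<le> real (card A) ^ 2 * M"
proof -
  have "(\<Sum>y\<in>A - {x}. f x y) \<le> real (card A) * M" if "x \<in> A" for x
  proof -
    have "(\<Sum>y\<in>A - {x}. f x y) \<le> real (card (A - {x})) * M"
      using assms that by (intro sum_bounded_above) auto
    also have "\<dots> \<le> real (card A) * M"
      using assms by (intro mult_right_mono) (auto intro: card_mono)
    finally show ?thesis .
  qed
  then have "(\<Sum>x\<in>A. \<Sum>y\<in>A - {x}. f x y) \<le> real (card A) * (real (card A) * M)"
    by (intro sum_bounded_above) auto
  moreover have "0 \<le> real (card A) * (real (card A) * M)"
    using assms by simp
  ultimately show ?thesis
    by (simp add: pair_sum_def power2_eq_square)
qed

lemma le_pair_sum:
  assumes "finite A" "x \<in> A" "y \<in> A" "x \<noteq> y"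
    and nonneg: "\<And>x y. x \<in> A \<Longrightarrow> y \<in> A \<Longrightarrow> x \<noteq> y \<Longrightarrow> 0 \<le> f x y" and sym: "f x y = f y x"
  shows "f x y \<le> pair_sum A f"
proof -
  let ?s = "\<lambda>x. \<Sum>y\<in>A - {x}. f x y"
  have "f x y \<le> ?s x" "f y x \<le> ?s y"
    using member_le_sum[of y "A - {x}" "f x"] member_le_sum[of x "A - {y}" "f y"] assms(1-5)
    by auto
  moreover have "?s x + ?s y \<le> (\<Sum>x\<in>A. ?s x)"
  proof -
    have "(\<Sum>x\<in>{x, y}. ?s x) \<le> (\<Sum>x\<in>A. ?s x)"
      using assms by (intro sum_mono2) (auto intro!: sum_nonneg)
    then show ?thesis using assms(4) by simp
  qed
  ultimately show ?thesis
    using sym by (simp add: pair_sum_def)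
qed

section \<open>The exponent \<open>R\<^sup>#\<close>\<close>

text \<open>
  The least element in the definition of \<open>R\<^sup>#\<close> exists: on a finite vertex set the chain condition only
  changes at the finitely many values \<open>R x y\<close>.
\<close>

lemma R_sharp_chain:
  assumes fin: "finite V" and pq: "p \<in> V" "q \<in> V" "p \<noteq> q"
  shows "\<exists>ps. ps \<noteq> [] \<and> hd ps = p \<and> last ps = q \<and> set ps \<subseteq> V \<and>
    successively (\<lambda>x y. x \<noteq> y \<and> R x y \<le> R_sharp V R) ps"
proof -
  define P where "P s \<longleftrightarrow> (\<forall>p\<in>V. \<forall>q\<in>V. p \<noteq> q \<longrightarrow>
    (\<exists>ps. ps \<noteq> [] \<and> hd ps = p \<and> last ps = q \<and> set ps \<subseteq> V \<and>
          successively (\<lambda>x y. x \<noteq> y \<and> R x y \<le> s) ps))" for s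
  define S where "S = {R x y | x y. x \<in> V \<and> y \<in> V \<and> x \<noteq> y}"
  have S_eq: "S \<subseteq> (\<lambda>(x, y). R x y) ` (V \<times> V)"
    by (auto simp: S_def)
  then have fS: "finite S"
    using fin finite_subset by fastforce
  have S_ne: "S \<noteq> {}"
    using pq by (auto simp: S_def)
  have P_Max: "P (Max S)"
    unfolding P_def
  proof (intro ballI impI)
    fix p q assume "p \<in> V" "q \<in> V" "p \<noteq> q"
    then have "R p q \<in> S"
      by (auto simp: S_def)
    then show "\<exists>ps. ps \<noteq> [] \<and> hd ps = p \<and> last ps = q \<and> set ps \<subseteq> V \<and>
        successively (\<lambda>x y. x \<noteq> y \<and> R x y \<le> Max S) ps"
      using \<open>p \<in> V\<close> \<open>q \<in> V\<close> \<open>p \<noteq> q\<close> fS by (intro exI[of _ "[p, q]"]) auto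
  qed
  have P_attained: "\<exists>v\<in>S. v \<le> s \<and> P v" if Ps: "P s" for s
  proof -
    have succ_cong: "successively (\<lambda>x y. x \<noteq> y \<and> R x y \<le> s) ps \<Longrightarrow> set ps \<subseteq> V \<Longrightarrow>
        successively (\<lambda>x y. x \<noteq> y \<and> R x y \<le> Max {v \<in> S. v \<le> s}) ps" for ps
    proof (induction ps rule: induct_list012)
      case (3 x y zs)
      then have "R x y \<in> {v \<in> S. v \<le> s}"
        by (auto simp: S_def)
      then have "R x y \<le> Max {v \<in> S. v \<le> s}"
        using fS by (intro Max_ge) auto
      then show ?case using 3 by simp
    qed auto
    obtain ps where ps: "ps \<noteq> []" "hd ps = p" "last ps = q" "set ps \<subseteq> V"
      "successively (\<lambda>x y. x \<noteq> y \<and> R x y \<le> s) ps"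
      using Ps pq unfolding P_def by blast
    have "\<exists>x y zs. ps = x # y # zs"
      using ps(1-3) pq(3) by (cases ps; cases "tl ps") auto
    then obtain x y zs where "ps = x # y # zs"
      by blast
    then have "R x y \<in> {v \<in> S. v \<le> s}"
      using ps by (auto simp: S_def)
    then have "Max {v \<in> S. v \<le> s} \<in> {v \<in> S. v \<le> s}"
      using fS by (intro Max_in) auto
    moreover have "P (Max {v \<in> S. v \<le> s})"
      unfolding P_def
    proof (intro ballI impI)
      fix p q assume "p \<in> V" "q \<in> V" "p \<noteq> q"
      then obtain ps where "ps \<noteq> []" "hd ps = p" "last ps = q" "set ps \<subseteq> V"
          "successively (\<lambda>x y. x \<noteq> y \<and> R x y \<le> s) ps"
        using Ps unfolding P_def by blast
      then show "\<exists>ps. ps \<noteq> [] \<and> hd ps = p \<and> last ps = q \<and> set ps \<subseteq> V \<and>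
          successively (\<lambda>x y. x \<noteq> y \<and> R x y \<le> Max {v \<in> S. v \<le> s}) ps"
        using succ_cong by blast
    qed
    ultimately show ?thesis by blast
  qed
  define s0 where "s0 = Min {v \<in> S. P v}"
  have ne: "{v \<in> S. P v} \<noteq> {}"
    using P_Max fS S_ne Max_in by blast
  have "P s0"
    using Min_in[of "{v \<in> S. P v}"] fS ne unfolding s0_def by auto
  moreover have "s0 \<le> s" if "P s" for s
  proof -
    obtain v where "v \<in> S" "v \<le> s" "P v"
      using P_attained \<open>P s\<close> by blast
    then have "s0 \<le> v"
      unfolding s0_def using fS by (intro Min_le) auto
    then show ?thesis using \<open>v \<le> s\<close> by simp
  qed
  ultimately have "(LEAST s. P s) = s0"
    by (intro Least_equality)
  then have "P (R_sharp V R)"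
    using \<open>P s0\<close> by (simp add: R_sharp_def P_def)
  then show ?thesis
    using pq by (auto simp: P_def)
qed

lemma R_sharp_greater:
  assumes fin: "finite V" and card: "2 \<le> card V"
    and R: "\<And>x y. x \<in> V \<Longrightarrow> y \<in> V \<Longrightarrow> x \<noteq> y \<Longrightarrow> a < R x y"
  shows "a < R_sharp V R"
proof -
  obtain p q where pq: "p \<in> V" "q \<in> V" "p \<noteq> q"
    using card card_le_Suc0_iff_eq[OF fin] by fastforce
  obtain ps where ps: "ps \<noteq> []" "hd ps = p" "last ps = q" "set ps \<subseteq> V"
      "successively (\<lambda>x y. x \<noteq> y \<and> R x y \<le> R_sharp V R) ps"
    using R_sharp_chain[OF fin pq] by blast
  have "\<exists>x y zs. ps = x # y # zs"
    using ps(1-3) pq(3) by (cases ps; cases "tl ps") auto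
  then show ?thesis
    using ps R by fastforce
qed

context pcf_homotheties
begin

section \<open>Energies and oscillations\<close>

definition edge_energy :: "('a \<Rightarrow> real) \<Rightarrow> real" where
  "edge_energy f = pair_sum V0 (\<lambda>p q. \<bar>f p - f q\<bar>\<^sup>2)"

lemma edge_energy_nonneg: "0 \<le> edge_energy f"
  by (simp add: edge_energy_def pair_sum_nonneg)

lemma diff_le_edge_energy:
  assumes "p \<in> V0" "q \<in> V0"
  shows "\<bar>f p - f q\<bar>\<^sup>2 \<le> edge_energy f"
proof (cases "p = q")
  case False
  then show ?thesis
    unfolding edge_energy_def using assms
    by (intro le_pair_sum) (simp_all add: power2_commute)
qed (simp add: edge_energy_nonneg)

lemma edge_energy_le:
  assumes "\<And>p q. p \<in> V0 \<Longrightarrow> q \<in> V0 \<Longrightarrow> \<bar>f p - f q\<bar>\<^sup>2 \<le> M"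
  shows "edge_energy f \<le> real (card V0) ^ 2 * M"
proof -
  obtain p where "p \<in> V0"
    using V0_nonempty by blast
  then have "0 \<le> M"
    using assms[of p p] by simp
  then show ?thesis
    unfolding edge_energy_def using assms by (intro pair_sum_le) auto
qed

lemma energy_eq: "energy N F V0 n f = (\<Sum>w\<in>fin_words N n. edge_energy (\<lambda>x. f (foldr F w x)))"
  unfolding energy_def
proof (rule sum.cong)
  fix w assume "w \<in> fin_words N n"
  then have "inj_on (foldr F w) V0"
    using inj_cell_map inj_on_subset by blast
  then show "pair_sum (foldr F w ` V0) (\<lambda>x y. \<bar>f x - f y\<bar>\<^sup>2) = edge_energy (\<lambda>x. f (foldr F w x))"
    by (simp add: pair_sum_image edge_energy_def)
qed simp

lemma energy_nonneg: "0 \<le> energy N F V0 n f"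
  by (simp add: energy_eq sum_nonneg edge_energy_nonneg)

lemma energy_Suc: "energy N F V0 (Suc n) f = (\<Sum>i\<in>{1..N}. energy N F V0 n (\<lambda>x. f (F i x)))"
  by (simp add: energy_eq sum_fin_words_Suc)

lemma energy_cell_le:
  "i \<in> {1..N} \<Longrightarrow> energy N F V0 n (\<lambda>x. f (F i x)) \<le> energy N F V0 (Suc n) f"
  unfolding energy_Suc by (rule member_le_sum) (auto simp: energy_nonneg)

lemma edge_energy_cell_le:
  "w \<in> fin_words N n \<Longrightarrow> edge_energy (\<lambda>x. f (foldr F w x)) \<le> energy N F V0 n f"
  unfolding energy_eq by (rule member_le_sum) (auto simp: edge_energy_nonneg)

lemma vertices_eq: "vertices N F V0 n = (\<Union>w\<in>fin_words N n. foldr F w ` V0)"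
proof (induction n)
  case (Suc n)
  then have "vertices N F V0 (Suc n) = (\<Union>i\<in>{1..N}. F i ` (\<Union>w\<in>fin_words N n. foldr F w ` V0))"
    by simp
  also have "\<dots> = (\<Union>w\<in>fin_words N (Suc n). foldr F w ` V0)"
    by (fastforce simp: fin_words_Suc)
  finally show ?case .
qed simp

lemma V0_subset_vertices: "p \<in> V0 \<Longrightarrow> p \<in> vertices N F V0 n"
  using V0_in_cellE[of p n] unfolding vertices_eq by blast

text \<open>
  Since \<open>K\<close> is connected, its first-level cells form a connected graph, and two cells that
  meet share a vertex. Hence oscillations inside the cells control the oscillation over all
  vertices, up to the diameter of that graph.
\<close>

lemma first_level_oscillation:
  obtains L :: real where "0 \<le> L"
    "\<And>(f :: 'a \<Rightarrow> real) M i j p q. (\<And>k p q. k \<in> {1..N} \<Longrightarrow> p \<in> V0 \<Longrightarrow> q \<in> V0 \<Longrightarrow> \<bar>f (F k p) - f (F k q)\<bar> \<le> M) \<Longrightarrow>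
      i \<in> {1..N} \<Longrightarrow> j \<in> {1..N} \<Longrightarrow> p \<in> V0 \<Longrightarrow> q \<in> V0 \<Longrightarrow> \<bar>f (F i p) - f (F j q)\<bar> \<le> L * M"
proof -
  define adj where "adj = {(i, j). i \<in> {1..N} \<and> j \<in> {1..N} \<and> F i ` K \<inter> F j ` K \<noteq> {}}"
  have adj_vertex: "\<exists>p\<in>V0. \<exists>q\<in>V0. F i p = F j q" if ij_adj: "(i, j) \<in> adj" for i j
  proof (cases "i = j")
    case True
    then show ?thesis using V0_nonempty by blast
  next
    case False
    have ij: "[i] \<in> fin_words N 1" "[j] \<in> fin_words N 1"
      using ij_adj by (auto simp: adj_def)
    obtain x where "x \<in> F i ` K" "x \<in> F j ` K"
      using ij_adj by (auto simp: adj_def)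
    then obtain p q where "p \<in> V0" "q \<in> V0" "x = F i p" "x = F j q"
      using meeting_cells_vertexE[OF ij, of x] False by auto
    then show ?thesis by metis
  qed
  have closed: "closed (\<Union>k\<in>A. F k ` K)" if "A \<subseteq> {1..N}" for A
  proof (rule closed_UN)
    show "finite A" using that finite_subset by blast
    show "\<forall>k\<in>A. closed (F k ` K)"
    proof
      fix k assume "k \<in> A"
      then have "k \<in> {1..N}"
        using that by blast
      then show "closed (F k ` K)"
        using compact_cell[of "[k]" 1] by (auto intro: compact_imp_closed)
    qed
  qed
  have conn: "(i, j) \<in> adj\<^sup>*" if ij: "i \<in> {1..N}" "j \<in> {1..N}" for i j
  proof (rule ccontr)
    assume nij: "(i, j) \<notin> adj\<^sup>*"
    define A where "A = {k \<in> {1..N}. (i, k) \<in> adj\<^sup>*}"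
    define X Y where "X = (\<Union>k\<in>A. F k ` K)" and "Y = (\<Union>k\<in>{1..N} - A. F k ` K)"
    obtain z where z: "z \<in> K"
      using K_nonempty by blast
    have "F k ` K \<inter> F l ` K = {}" if "k \<in> A" "l \<in> {1..N} - A" for k l
    proof (rule ccontr)
      assume "F k ` K \<inter> F l ` K \<noteq> {}"
      then have "(k, l) \<in> adj"
        using that by (auto simp: adj_def A_def)
      then show False
        using that by (auto simp: A_def intro: rtrancl_into_rtrancl)
    qed
    then have disj: "X \<inter> Y \<inter> K = {}"
      unfolding X_def Y_def by blast
    have XY: "X \<union> Y = (\<Union>k\<in>{1..N}. F k ` K)"
      unfolding X_def Y_def A_def by blast
    have union: "K = X \<union> Y"
      unfolding XY by (rule K_eq)
    have "i \<in> A" "j \<in> {1..N} - A"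
      using ij nij by (auto simp: A_def)
    then have mem: "F i z \<in> X" "F j z \<in> Y"
      using z unfolding X_def Y_def by blast+
    have "closed X" "closed Y"
      unfolding X_def Y_def by (intro closed; force simp: A_def)+
    then have "X \<inter> K = {} \<or> Y \<inter> K = {}"
      using connected_closedD[OF connected_K disj] union by simp
    then show False
      using mem union by blast
  qed
  have "\<forall>i j. \<exists>n. i \<in> {1..N} \<longrightarrow> j \<in> {1..N} \<longrightarrow> (i, j) \<in> adj ^^ n"
    using conn rtrancl_imp_relpow by metis
  then obtain d where d: "\<And>i j. i \<in> {1..N} \<Longrightarrow> j \<in> {1..N} \<Longrightarrow> (i, j) \<in> adj ^^ d i j"
    by metis
  define L where "L = Max ((\<lambda>(i, j). d i j) ` ({1..N} \<times> {1..N}))"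
  have dL: "d i j \<le> L" if "i \<in> {1..N}" "j \<in> {1..N}" for i j
    unfolding L_def using that by (intro Max_ge) force+
  have chain: "\<bar>f (F i p) - f (F j q)\<bar> \<le> (real n + 1) * M"
    if M: "\<And>k p q. k \<in> {1..N} \<Longrightarrow> p \<in> V0 \<Longrightarrow> q \<in> V0 \<Longrightarrow> \<bar>f (F k p) - f (F k q)\<bar> \<le> M"
      and "i \<in> {1..N}" "j \<in> {1..N}" "p \<in> V0" "q \<in> V0" "(i, j) \<in> adj ^^ n"
    for f :: "'a \<Rightarrow> real" and M i j p q n
    using that(2-)
  proof (induction n arbitrary: j q)
    case 0
    then show ?case using M by auto
  next
    case (Suc n)
    then obtain k where k: "(i, k) \<in> adj ^^ n" "(k, j) \<in> adj"
      by auto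
    obtain a b where ab: "a \<in> V0" "b \<in> V0" "F k a = F j b"
      using adj_vertex[OF k(2)] by blast
    have "k \<in> {1..N}"
      using k by (auto simp: adj_def)
    then have "\<bar>f (F i p) - f (F k a)\<bar> \<le> (real n + 1) * M"
      by (intro Suc.IH) (use Suc.prems k(1) ab(1) in auto)
    moreover have "\<bar>f (F j b) - f (F j q)\<bar> \<le> M"
      using M Suc.prems ab by auto
    ultimately show ?case
      using ab(3) by (simp add: algebra_simps)
  qed
  show ?thesis
  proof (rule that[of "real L + 1"])
    fix f :: "'a \<Rightarrow> real" and M i j p q
    assume M: "\<And>k p q. k \<in> {1..N} \<Longrightarrow> p \<in> V0 \<Longrightarrow> q \<in> V0 \<Longrightarrow> \<bar>f (F k p) - f (F k q)\<bar> \<le> M"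
      and ij: "i \<in> {1..N}" "j \<in> {1..N}" "p \<in> V0" "q \<in> V0"
    have "\<bar>f (F i p) - f (F j q)\<bar> \<le> (real (d i j) + 1) * M"
      by (rule chain[of f M, OF M ij d[OF ij(1,2)]])
    also have "\<dots> \<le> (real L + 1) * M"
      using dL[OF ij(1,2)] M[OF ij(1,3,3)] by (intro mult_right_mono) auto
    finally show "\<bar>f (F i p) - f (F j q)\<bar> \<le> (real L + 1) * M" .
  qed simp
qed

lemma vertices_oscillation:
  obtains L :: real where "0 \<le> L"
    "\<And>(f :: 'a \<Rightarrow> real) M x y. (\<And>w p q. w \<in> fin_words N n \<Longrightarrow> p \<in> V0 \<Longrightarrow> q \<in> V0 \<Longrightarrow>
        \<bar>f (foldr F w p) - f (foldr F w q)\<bar> \<le> M) \<Longrightarrow>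
      x \<in> vertices N F V0 n \<Longrightarrow> y \<in> vertices N F V0 n \<Longrightarrow> \<bar>f x - f y\<bar> \<le> L * M"
proof -
  have "\<exists>L::real\<ge>0. \<forall>(f :: 'a \<Rightarrow> real) M. (\<forall>w\<in>fin_words N n. \<forall>p\<in>V0. \<forall>q\<in>V0.
        \<bar>f (foldr F w p) - f (foldr F w q)\<bar> \<le> M) \<longrightarrow>
      (\<forall>x\<in>vertices N F V0 n. \<forall>y\<in>vertices N F V0 n. \<bar>f x - f y\<bar> \<le> L * M)"
  proof (induction n)
    case 0
    then show ?case by (intro exI[of _ 1]) auto
  next
    case (Suc n)
    then obtain L where L: "0 \<le> L" "\<And>(f :: 'a \<Rightarrow> real) M x y. (\<And>w p q. w \<in> fin_words N n \<Longrightarrow> p \<in> V0 \<Longrightarrow> q \<in> V0 \<Longrightarrow>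
        \<bar>f (foldr F w p) - f (foldr F w q)\<bar> \<le> M) \<Longrightarrow>
      x \<in> vertices N F V0 n \<Longrightarrow> y \<in> vertices N F V0 n \<Longrightarrow> \<bar>f x - f y\<bar> \<le> L * M"
      by metis
    obtain L1 where L1: "0 \<le> L1" "\<And>(f :: 'a \<Rightarrow> real) M i j p q. (\<And>k p q. k \<in> {1..N} \<Longrightarrow> p \<in> V0 \<Longrightarrow> q \<in> V0 \<Longrightarrow>
        \<bar>f (F k p) - f (F k q)\<bar> \<le> M) \<Longrightarrow>
      i \<in> {1..N} \<Longrightarrow> j \<in> {1..N} \<Longrightarrow> p \<in> V0 \<Longrightarrow> q \<in> V0 \<Longrightarrow> \<bar>f (F i p) - f (F j q)\<bar> \<le> L1 * M"
      using first_level_oscillation by metis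
    obtain p0 where p0: "p0 \<in> V0"
      using V0_nonempty by blast
    show ?case
    proof (intro exI[of _ "2 * L + L1 * L"] conjI allI impI ballI)
      fix f :: "'a \<Rightarrow> real" and M x y
      assume M: "\<forall>w\<in>fin_words N (Suc n). \<forall>p\<in>V0. \<forall>q\<in>V0.
          \<bar>f (foldr F w p) - f (foldr F w q)\<bar> \<le> M"
        and xy: "x \<in> vertices N F V0 (Suc n)" "y \<in> vertices N F V0 (Suc n)"
      have inner: "\<bar>f (F k a) - f (F k b)\<bar> \<le> L * M"
        if k: "k \<in> {1..N}" "a \<in> vertices N F V0 n" "b \<in> vertices N F V0 n" for k a b
      proof (rule L(2)[of "\<lambda>x. f (F k x)"])
        fix w p q assume "w \<in> fin_words N n" "p \<in> V0" "q \<in> V0"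
        then show "\<bar>f (F k (foldr F w p)) - f (F k (foldr F w q))\<bar> \<le> M"
          using M[rule_format, of "k # w" p q] k(1) by simp
      qed (use k in auto)
      have outer: "\<bar>f (F i p0) - f (F j p0)\<bar> \<le> L1 * (L * M)" if "i \<in> {1..N}" "j \<in> {1..N}" for i j
        using inner V0_subset_vertices p0 that by (intro L1(2)) auto
      obtain i a where x: "i \<in> {1..N}" "a \<in> vertices N F V0 n" "x = F i a"
        using xy(1) by auto
      obtain j b where y: "j \<in> {1..N}" "b \<in> vertices N F V0 n" "y = F j b"
        using xy(2) by auto
      show "\<bar>f x - f y\<bar> \<le> (2 * L + L1 * L) * M"
        using inner[OF x(1,2) V0_subset_vertices[OF p0]] inner[OF y(1,2) V0_subset_vertices[OF p0]]
          outer[OF x(1) y(1)] x(3) y(3) by (simp add: algebra_simps)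
    qed (use L(1) L1(1) in auto)
  qed
  then show ?thesis
    using that by metis
qed

text \<open>
  A growth rate for the resistances between boundary points is a growth rate for the oscillation
  over all vertices of level \<open>n\<close>: walking down from \<open>V\<^sub>0\<close> into smaller and smaller cells, the
  contribution of the cells of level \<open>k\<close> is governed by the resistance of level \<open>n - k\<close>, and
  these form a geometric series.
\<close>

lemma oscillation_le_energy:
  assumes t: "1 < t" and C: "0 \<le> C"
    and bound: "\<And>n f p q. p \<in> V0 \<Longrightarrow> q \<in> V0 \<Longrightarrow> \<bar>f p - f q\<bar> \<le> C * t ^ n * sqrt (energy N F V0 n f)"
  obtains A where "0 \<le> A" "\<And>n f x p. x \<in> vertices N F V0 n \<Longrightarrow> p \<in> V0 \<Longrightarrow>
    \<bar>f x - f p\<bar> \<le> A * t ^ n * sqrt (energy N F V0 n f)"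
proof -
  obtain L where L: "0 \<le> L" "\<And>(f :: 'a \<Rightarrow> real) M i j p q. (\<And>k p q. k \<in> {1..N} \<Longrightarrow> p \<in> V0 \<Longrightarrow> q \<in> V0 \<Longrightarrow>
        \<bar>f (F k p) - f (F k q)\<bar> \<le> M) \<Longrightarrow>
      i \<in> {1..N} \<Longrightarrow> j \<in> {1..N} \<Longrightarrow> p \<in> V0 \<Longrightarrow> q \<in> V0 \<Longrightarrow> \<bar>f (F i p) - f (F j q)\<bar> \<le> L * M"
    using first_level_oscillation by metis
  \<comment> \<open>Chosen so that \<open>A + L * C \<le> A * t\<close>, which closes the induction below.\<close>
  define e where "e = L * C / (t - 1)"
  define A where "A = C + e"
  have A: "0 \<le> A" "C \<le> A" "A + L * C \<le> A * t"
  proof -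
    show "0 \<le> A" "C \<le> A"
      using L C t by (auto simp: A_def e_def)
    have "e * (t - 1) = L * C" "0 \<le> C * (t - 1)"
      using t C by (auto simp: e_def)
    then show "A + L * C \<le> A * t"
      unfolding A_def by (simp add: algebra_simps)
  qed
  have main: "\<bar>f x - f p\<bar> \<le> A * t ^ n * sqrt (energy N F V0 n f)"
    if "x \<in> vertices N F V0 n" "p \<in> V0" for n f x p
    using that
  proof (induction n arbitrary: f x p)
    case 0
    then have "\<bar>f x - f p\<bar> \<le> C * sqrt (energy N F V0 0 f)"
      using bound[of x p f 0] by simp
    also have "\<dots> \<le> A * sqrt (energy N F V0 0 f)"
      using A energy_nonneg by (intro mult_right_mono) auto
    finally show ?case by simp
  next
    case (Suc n)
    let ?e = "sqrt (energy N F V0 (Suc n) f)"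
    have mono: "B * t ^ n * sqrt (energy N F V0 n (\<lambda>x. f (F k x))) \<le> B * t ^ n * ?e"
      if "0 \<le> B" "k \<in> {1..N}" for B k
      using energy_cell_le[OF that(2)] that(1) t by (intro mult_left_mono real_sqrt_le_mono) auto
    obtain i a where x: "i \<in> {1..N}" "a \<in> vertices N F V0 n" "x = F i a"
      using Suc.prems by auto
    have "p \<in> vertices N F V0 (Suc 0)"
      by (rule V0_subset_vertices[OF Suc.prems(2)])
    then obtain j q where q: "j \<in> {1..N}" "q \<in> V0" "p = F j q"
      by auto
    have "\<bar>f (F k a) - f (F k b)\<bar> \<le> C * t ^ n * ?e"
      if "k \<in> {1..N}" "a \<in> V0" "b \<in> V0" for k a b
      using bound[OF that(2,3), of "\<lambda>x. f (F k x)" n] mono[OF C that(1)] by linarith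
    then have "\<bar>f (F i q) - f (F j q)\<bar> \<le> L * (C * t ^ n * ?e)"
      using x q by (intro L(2)) auto
    moreover have "\<bar>f (F i a) - f (F i q)\<bar> \<le> A * t ^ n * ?e"
      using Suc.IH[OF x(2) q(2), of "\<lambda>x. f (F i x)"] mono[OF A(1) x(1)] by linarith
    ultimately have "\<bar>f x - f p\<bar> \<le> (A + L * C) * (t ^ n * ?e)"
      using x q by (simp add: algebra_simps)
    also have "\<dots> \<le> A * t * (t ^ n * ?e)"
      using A(3) t energy_nonneg by (intro mult_right_mono) auto
    finally show ?case by (simp add: algebra_simps)
  qed
  show ?thesis
    using that[OF A(1)] main by blast
qed

lemma trace_le_energy:
  assumes "is_trace N F V0 n Rn" "p \<in> V0" "q \<in> V0" "p \<noteq> q"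
  shows "\<bar>f p - f q\<bar>\<^sup>2 \<le> Rn p q * energy N F V0 n f"
proof -
  let ?g = "\<lambda>p q. 1 / Rn p q * \<bar>f p - f q\<bar>\<^sup>2"
  have R: "0 < Rn p q \<and> Rn p q = Rn q p" if "p \<in> V0" "q \<in> V0" "p \<noteq> q" for p q
    using assms(1) that unfolding is_trace_def by blast
  have "pair_sum V0 ?g \<le> energy N F V0 n f"
    using assms(1) unfolding is_trace_def is_minimum_def by blast
  moreover have "?g p q \<le> pair_sum V0 ?g"
    using assms R R[OF assms(2-4)]
    by (intro le_pair_sum) (auto simp: abs_minus_commute less_imp_le)
  ultimately have "1 / Rn p q * \<bar>f p - f q\<bar>\<^sup>2 \<le> energy N F V0 n f"
    by linarith
  then show ?thesis
    using R[OF assms(2-4)] by (simp add: field_simps)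
qed

text \<open>
  Along a chain of pairs whose rates are at most \<open>R\<^sup>#\<close>, differences add up; so every pair of
  boundary points behaves as if its own rate were at most \<open>R\<^sup>#\<close>.
\<close>

lemma boundary_difference_le:
  assumes trace: "\<And>n. is_trace N F V0 n (Rn n)"
    and rates: "\<And>p q. p \<in> V0 \<Longrightarrow> q \<in> V0 \<Longrightarrow> p \<noteq> q \<Longrightarrow> has_growth_rate (\<lambda>n. Rn n p q) (R p q)"
    and t: "0 < t" "R_sharp V0 R < t\<^sup>2"
  obtains C where "0 \<le> C"
    "\<And>n f p q. p \<in> V0 \<Longrightarrow> q \<in> V0 \<Longrightarrow> \<bar>f p - f q\<bar> \<le> C * t ^ n * sqrt (energy N F V0 n f)"
proof -
  define good where "good p q \<longleftrightarrow>
    (\<exists>C\<ge>0. \<forall>n f. \<bar>f p - f q\<bar> \<le> C * t ^ n * sqrt (energy N F V0 n f))" for p q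
  have refl: "good p p" for p
    unfolding good_def using energy_nonneg t by (intro exI[of _ 0]) auto
  have trans: "good p s" if pq: "good p q" and qs: "good q s" for p q s
  proof -
    obtain C D where CD: "0 \<le> C" "\<And>n f. \<bar>f p - f q\<bar> \<le> C * t ^ n * sqrt (energy N F V0 n f)"
      "0 \<le> D" "\<And>n f. \<bar>f q - f s\<bar> \<le> D * t ^ n * sqrt (energy N F V0 n f)"
      using pq qs unfolding good_def by metis
    have "\<bar>f p - f s\<bar> \<le> (C + D) * t ^ n * sqrt (energy N F V0 n f)" for n f
      using CD(2)[of f n] CD(4)[of f n] by (simp add: algebra_simps)
    then show ?thesis
      unfolding good_def using CD by (intro exI[of _ "C + D"]) auto
  qed
  have step: "good p q"
    if pq: "p \<in> V0" "q \<in> V0" "p \<noteq> q" and le: "R p q \<le> R_sharp V0 R" for p q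
  proof -
    have rate: "has_growth_rate (\<lambda>n. Rn n p q) (R p q)"
      by (rule rates[OF pq])
    then have s: "1 < R p q"
      by (simp add: has_growth_rate_def)
    have "\<exists>\<epsilon>>0. R p q powr (1 + \<epsilon>) \<le> t\<^sup>2"
    proof -
      have "((\<lambda>\<epsilon>. R p q powr (1 + \<epsilon>)) \<longlongrightarrow> R p q powr (1 + 0)) (at_right 0)"
        using s by (intro tendsto_intros) auto
      then have "\<forall>\<^sub>F \<epsilon> in at_right 0. R p q powr (1 + \<epsilon>) < t\<^sup>2"
        using s le t by (intro order_tendstoD(2)[where y = "R p q powr (1 + 0)"]) auto
      moreover have "\<forall>\<^sub>F \<epsilon> in at_right (0::real). 0 < \<epsilon>"
        by (simp add: eventually_at_right_less)
      ultimately have "\<forall>\<^sub>F \<epsilon> in at_right 0. 0 < \<epsilon> \<and> R p q powr (1 + \<epsilon>) < t\<^sup>2"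
        by eventually_elim auto
      then show ?thesis
        using eventually_happens[of _ "at_right (0::real)"] by (auto intro: less_imp_le)
    qed
    then obtain \<epsilon> where \<epsilon>: "0 < \<epsilon>" "R p q powr (1 + \<epsilon>) \<le> t\<^sup>2"
      by blast
    obtain n0 where n0: "\<And>n. n0 \<le> n \<Longrightarrow> Rn n p q \<le> R p q powr ((1 + \<epsilon>) * real n)"
      using rate \<epsilon>(1) unfolding has_growth_rate_def by blast
    define B where "B = Max (insert 1 ((\<lambda>n. Rn n p q / (t\<^sup>2) ^ n) ` {..<n0}))"
    have B: "1 \<le> B" "\<And>n. n < n0 \<Longrightarrow> Rn n p q / (t\<^sup>2) ^ n \<le> B"
      unfolding B_def by (auto intro!: Max_ge)
    have Rn_le: "Rn n p q \<le> B * (t\<^sup>2) ^ n" for n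
    proof (cases "n < n0")
      case True
      then show ?thesis
        using B(2)[OF True] t by (simp add: field_simps)
    next
      case False
      have "R p q powr ((1 + \<epsilon>) * real n) = (R p q powr (1 + \<epsilon>)) ^ n"
        using s by (simp add: powr_powr[symmetric] powr_realpow)
      also have "\<dots> \<le> (t\<^sup>2) ^ n"
        using \<epsilon> by (intro power_mono) auto
      also have "\<dots> \<le> B * (t\<^sup>2) ^ n"
        using B(1) t by (simp add: mult_le_cancel_right1)
      finally show ?thesis
        using n0[of n] False by linarith
    qed
    show ?thesis
      unfolding good_def
    proof (intro exI[of _ "sqrt B"] conjI allI)
      fix n and f :: "'a \<Rightarrow> real"
      have "\<bar>f p - f q\<bar>\<^sup>2 \<le> B * (t\<^sup>2) ^ n * energy N F V0 n f"
        using trace_le_energy[OF trace pq, of f n] mult_right_mono[OF Rn_le energy_nonneg, of n n f]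
        by linarith
      then have "\<bar>f p - f q\<bar> \<le> sqrt (B * (t\<^sup>2) ^ n * energy N F V0 n f)"
        by (intro real_le_rsqrt)
      also have "(t\<^sup>2) ^ n = (t ^ n)\<^sup>2"
        by (simp add: power_mult[symmetric] mult.commute)
      also have "sqrt (B * (t ^ n)\<^sup>2 * energy N F V0 n f) = sqrt B * t ^ n * sqrt (energy N F V0 n f)"
        using t by (simp add: real_sqrt_mult)
      finally show "\<bar>f p - f q\<bar> \<le> sqrt B * t ^ n * sqrt (energy N F V0 n f)" .
    qed (use B(1) in auto)
  qed
  have chain: "good (hd ps) (last ps)"
    if "successively (\<lambda>x y. x \<noteq> y \<and> R x y \<le> R_sharp V0 R) ps" "set ps \<subseteq> V0" "ps \<noteq> []" for ps
    using that
  proof (induction ps rule: induct_list012)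
    case (3 x y zs)
    then have "good x y" "good y (last (y # zs))"
      using step by auto
    then show ?case
      using trans[of x y "last (y # zs)"] by simp
  qed (auto simp: refl)
  have "good p q" if pq: "p \<in> V0" "q \<in> V0" for p q
  proof (cases "p = q")
    case False
    obtain ps where "ps \<noteq> []" "hd ps = p" "last ps = q" "set ps \<subseteq> V0"
        "successively (\<lambda>x y. x \<noteq> y \<and> R x y \<le> R_sharp V0 R) ps"
      using R_sharp_chain[OF finite_V0 pq False, of R] by blast
    then show ?thesis
      using chain by blast
  qed (simp add: refl)
  then obtain C where C: "\<And>p q. p \<in> V0 \<Longrightarrow> q \<in> V0 \<Longrightarrow> 0 \<le> C p q"
    "\<And>p q n f. p \<in> V0 \<Longrightarrow> q \<in> V0 \<Longrightarrow> \<bar>f p - f q\<bar> \<le> C p q * t ^ n * sqrt (energy N F V0 n f)"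
    unfolding good_def by metis
  define D where "D = (\<Sum>p\<in>V0. \<Sum>q\<in>V0. C p q)"
  have CD: "C p q \<le> D" if "p \<in> V0" "q \<in> V0" for p q
  proof -
    have "C p q \<le> (\<Sum>q\<in>V0. C p q)"
      using that C(1) by (intro member_le_sum) auto
    also have "\<dots> \<le> D"
      unfolding D_def using that C(1) by (intro member_le_sum) (auto intro: sum_nonneg)
    finally show ?thesis .
  qed
  have "\<bar>f p - f q\<bar> \<le> D * t ^ n * sqrt (energy N F V0 n f)" if "p \<in> V0" "q \<in> V0" for p q n f
    using C(2)[OF that, of f n] CD[OF that] t energy_nonneg
    by (meson mult_right_mono order_trans real_sqrt_ge_zero zero_le_power less_imp_le)
  moreover have "0 \<le> D"
    unfolding D_def using C(1) by (intro sum_nonneg) auto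
  ultimately show ?thesis
    using that by blast
qed

end

section \<open>Square integrable functions on a probability space\<close>

context prob_space
begin

lemma expectation_diff_square:
  fixes f :: "'a \<Rightarrow> real"
  assumes f: "f \<in> borel_measurable M" "integrable M (\<lambda>x. (f x)\<^sup>2)"
  shows "integrable M (\<lambda>x. (f x - a)\<^sup>2)"
    and "expectation (\<lambda>x. (f x - a)\<^sup>2) = (expectation f - a)\<^sup>2 + variance f"
proof -
  have int: "integrable M f"
    using f by (rule square_integrable_imp_integrable)
  have eq: "(f x - a)\<^sup>2 = (f x)\<^sup>2 + (a\<^sup>2 - 2 * a * f x)" for x
    by (simp add: power2_eq_square algebra_simps)
  show "integrable M (\<lambda>x. (f x - a)\<^sup>2)"
    unfolding eq using int f by simp
  have "expectation (\<lambda>x. (f x - a)\<^sup>2) = expectation (\<lambda>x. (f x)\<^sup>2) + (a\<^sup>2 - 2 * a * expectation f)"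
    unfolding eq using int f by (simp add: prob_space)
  then show "expectation (\<lambda>x. (f x - a)\<^sup>2) = (expectation f - a)\<^sup>2 + variance f"
    unfolding variance_eq[OF int f(2)] by (simp add: power2_eq_square algebra_simps)
qed

lemma nn_integral_diff_square:
  fixes f :: "'a \<Rightarrow> real"
  assumes "f \<in> borel_measurable M" "integrable M (\<lambda>x. (f x)\<^sup>2)"
  shows "(\<integral>\<^sup>+x. ennreal ((f x - a)\<^sup>2) \<partial>M) = ennreal ((expectation f - a)\<^sup>2 + variance f)"
  using expectation_diff_square[OF assms, of a] by (subst nn_integral_eq_integral) auto

text \<open>
  The right-hand side shows at once that the double integral dominates the squared difference of the means
  and both variances.
\<close>

lemma nn_integral_nn_integral_diff_square:
  fixes f g :: "'a \<Rightarrow> real"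
  assumes f: "f \<in> borel_measurable M" "integrable M (\<lambda>x. (f x)\<^sup>2)"
    and g: "g \<in> borel_measurable M" "integrable M (\<lambda>x. (g x)\<^sup>2)"
  shows "(\<integral>\<^sup>+x. \<integral>\<^sup>+y. ennreal ((f x - g y)\<^sup>2) \<partial>M \<partial>M)
    = ennreal ((expectation f - expectation g)\<^sup>2 + variance f + variance g)"
proof -
  have "(\<integral>\<^sup>+y. ennreal ((f x - g y)\<^sup>2) \<partial>M)
      = ennreal ((f x - expectation g)\<^sup>2) + ennreal (variance g)" for x
    using nn_integral_diff_square[OF g, of "f x"] variance_positive[of g]
    by (simp add: power2_commute ennreal_plus)
  then have "(\<integral>\<^sup>+x. \<integral>\<^sup>+y. ennreal ((f x - g y)\<^sup>2) \<partial>M \<partial>M)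
      = (\<integral>\<^sup>+x. ennreal ((f x - expectation g)\<^sup>2) \<partial>M) + ennreal (variance g)"
    using f by (simp add: nn_integral_add emeasure_space_1)
  then show ?thesis
    using nn_integral_diff_square[OF f, of "expectation g"] variance_positive[of g]
      variance_positive[of f]
    by (simp add: ennreal_plus[symmetric] del: ennreal_plus)
qed

lemma AE_eq_expectation:
  fixes f :: "'a \<Rightarrow> real"
  assumes "f \<in> borel_measurable M" "integrable M (\<lambda>x. (f x)\<^sup>2)" "variance f = 0"
  shows "AE x in M. f x = expectation f"
proof -
  have "AE x in M. (f x - expectation f)\<^sup>2 = 0"
    using expectation_diff_square(1)[OF assms(1,2)] assms(3)
    by (subst integral_nonneg_eq_0_iff_AE[symmetric]) auto
  then show ?thesis by simp
qed

end

section \<open>The self-similar measure\<close>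

locale pcf_homotheties_measure = pcf_homotheties +
  fixes \<mu> :: "'a measure" and \<alpha> :: real
  assumes self_similar: "self_similar_measure N F K \<mu>" and N_eq: "real N = \<rho> powr (- \<alpha>)"
begin

sublocale prob_space \<mu>
  using self_similar by (simp add: self_similar_measure_def)

lemma sets_mu [simp, measurable_cong]: "sets \<mu> = sets borel"
  using self_similar by (simp add: self_similar_measure_def)

lemma space_mu [simp]: "space \<mu> = UNIV"
  using sets_eq_imp_space_eq[OF sets_mu] by simp

lemma AE_in_K: "AE x in \<mu>. x \<in> K"
  using self_similar by (simp add: self_similar_measure_def)

lemma K_borel [measurable]: "K \<in> sets borel"
  using compact_K by (simp add: borel_closed compact_imp_closed)

lemma cell_map_borel [measurable]:
  "w \<in> fin_words N n \<Longrightarrow> foldr F w \<in> borel \<rightarrow>\<^sub>M borel"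
  by (intro borel_measurable_continuous_onI continuous_cell_map)

lemma F_borel [measurable]: "i \<in> {1..N} \<Longrightarrow> F i \<in> borel \<rightarrow>\<^sub>M borel"
  using cell_map_borel[of "[i]" 1] by simp

lemma sum_emeasure_vimage:
  assumes A: "A \<in> sets borel"
  shows "(\<Sum>i\<in>{1..N}. emeasure \<mu> (F i -` A)) = of_nat N * emeasure \<mu> A"
proof -
  have "measure \<mu> A = (1 / real N) * (\<Sum>i\<in>{1..N}. measure \<mu> (F i -` A))"
    using self_similar A by (simp add: self_similar_measure_def)
  then have "real N * measure \<mu> A = (\<Sum>i\<in>{1..N}. measure \<mu> (F i -` A))"
    using N_pos by simp
  then have "ennreal (real N * measure \<mu> A) = ennreal (\<Sum>i\<in>{1..N}. measure \<mu> (F i -` A))"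
    by simp
  then show ?thesis
    by (simp add: emeasure_eq_measure ennreal_mult ennreal_of_nat_eq_real_of_nat sum_nonneg)
qed

lemma nn_integral_first_level:
  assumes "f \<in> borel_measurable borel"
  shows "(\<Sum>i\<in>{1..N}. \<integral>\<^sup>+x. f (F i x) \<partial>\<mu>) = of_nat N * (\<integral>\<^sup>+x. f x \<partial>\<mu>)"
  using assms
proof (induction f rule: borel_measurable_induct)
  case (cong f g)
  then show ?case by simp
next
  case (set A)
  have "(\<integral>\<^sup>+x. indicator A (F i x) \<partial>\<mu>) = emeasure \<mu> (F i -` A)" if "i \<in> {1..N}" for i
  proof -
    have "F i -` A \<in> sets \<mu>"
      using measurable_sets[OF F_borel[OF that] set] by simp
    moreover have "indicator A (F i x) = (indicator (F i -` A) x :: ennreal)" for x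
      by (simp add: indicator_def)
    ultimately show ?thesis by simp
  qed
  then show ?case
    using sum_emeasure_vimage[OF set] set by simp
next
  case (mult u c)
  have "(\<Sum>i\<in>{1..N}. \<integral>\<^sup>+x. c * u (F i x) \<partial>\<mu>) = c * (\<Sum>i\<in>{1..N}. \<integral>\<^sup>+x. u (F i x) \<partial>\<mu>)"
    using mult(2) by (simp add: nn_integral_cmult sum_distrib_left)
  then show ?case
    using mult by (simp add: nn_integral_cmult mult.left_commute)
next
  case (add u v)
  have "(\<Sum>i\<in>{1..N}. \<integral>\<^sup>+x. v (F i x) + u (F i x) \<partial>\<mu>)
      = (\<Sum>i\<in>{1..N}. \<integral>\<^sup>+x. v (F i x) \<partial>\<mu>) + (\<Sum>i\<in>{1..N}. \<integral>\<^sup>+x. u (F i x) \<partial>\<mu>)"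
    using add(1,3) by (simp add: nn_integral_add sum.distrib)
  then show ?case
    using add by (simp add: nn_integral_add distrib_left)
next
  case (seq U)
  have [measurable]: "U k \<in> borel_measurable borel" for k
    by (rule seq(1))
  have inc: "incseq (\<lambda>k. U k (g x))" for g :: "'a \<Rightarrow> 'a" and x
    using \<open>incseq U\<close> by (auto simp: incseq_def le_fun_def)
  have "(\<integral>\<^sup>+x. (SUP k. U k) (F i x) \<partial>\<mu>) = (SUP k. \<integral>\<^sup>+x. U k (F i x) \<partial>\<mu>)" if "i \<in> {1..N}" for i
    unfolding SUP_apply using inc that
    by (intro nn_integral_monotone_convergence_SUP) (auto simp: incseq_def le_fun_def)
  then have "(\<Sum>i\<in>{1..N}. \<integral>\<^sup>+x. (SUP k. U k) (F i x) \<partial>\<mu>)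
      = (\<Sum>i\<in>{1..N}. SUP k. \<integral>\<^sup>+x. U k (F i x) \<partial>\<mu>)"
    by simp
  also have "\<dots> = (SUP k. \<Sum>i\<in>{1..N}. \<integral>\<^sup>+x. U k (F i x) \<partial>\<mu>)"
    using inc by (intro ennreal_SUP_sum[symmetric]) (auto simp: incseq_def intro!: nn_integral_mono)
  also have "\<dots> = of_nat N * (SUP k. \<integral>\<^sup>+x. U k x \<partial>\<mu>)"
    using seq.IH by (simp add: SUP_mult_left_ennreal)
  also have "(SUP k. \<integral>\<^sup>+x. U k x \<partial>\<mu>) = (\<integral>\<^sup>+x. (SUP k. U k) x \<partial>\<mu>)"
    unfolding SUP_apply using \<open>incseq U\<close> by (intro nn_integral_monotone_convergence_SUP[symmetric]) auto
  finally show ?case .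
qed

lemma nn_integral_cells:
  assumes "f \<in> borel_measurable borel"
  shows "(\<Sum>w\<in>fin_words N n. \<integral>\<^sup>+x. f (foldr F w x) \<partial>\<mu>) = of_nat (N ^ n) * (\<integral>\<^sup>+x. f x \<partial>\<mu>)"
  using assms
proof (induction n arbitrary: f)
  case (Suc n)
  have "(\<Sum>w\<in>fin_words N (Suc n). \<integral>\<^sup>+x. f (foldr F w x) \<partial>\<mu>)
      = (\<Sum>i\<in>{1..N}. \<Sum>w\<in>fin_words N n. \<integral>\<^sup>+x. f (F i (foldr F w x)) \<partial>\<mu>)"
    by (simp add: sum_fin_words_Suc)
  also have "\<dots> = (\<Sum>i\<in>{1..N}. of_nat (N ^ n) * (\<integral>\<^sup>+x. f (F i x) \<partial>\<mu>))"
  proof (rule sum.cong[OF refl])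
    fix i assume "i \<in> {1..N}"
    then have "(\<lambda>x. f (F i x)) \<in> borel_measurable borel"
      using Suc.prems by (auto intro: measurable_compose[OF F_borel])
    then show "(\<Sum>w\<in>fin_words N n. \<integral>\<^sup>+x. f (F i (foldr F w x)) \<partial>\<mu>)
        = of_nat (N ^ n) * (\<integral>\<^sup>+x. f (F i x) \<partial>\<mu>)"
      by (rule Suc.IH)
  qed
  also have "\<dots> = of_nat (N ^ Suc n) * (\<integral>\<^sup>+x. f x \<partial>\<mu>)"
    using nn_integral_first_level[OF Suc.prems]
    by (simp add: sum_distrib_left[symmetric] mult_ac)
  finally show ?case .
qed simp

lemma nn_integral_cell_pairs:
  assumes [measurable]: "case_prod h \<in> borel_measurable (borel \<Otimes>\<^sub>M borel)"
  shows "(\<Sum>w\<in>fin_words N n. \<Sum>w'\<in>fin_words N n. \<integral>\<^sup>+x. \<integral>\<^sup>+y. h (foldr F w x) (foldr F w' y) \<partial>\<mu> \<partial>\<mu>)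
    = of_nat (N ^ n) ^ 2 * (\<integral>\<^sup>+x. \<integral>\<^sup>+y. h x y \<partial>\<mu> \<partial>\<mu>)"
proof -
  have meas: "(\<lambda>x. \<integral>\<^sup>+y. h x (g y) \<partial>\<mu>) \<in> borel_measurable borel"
    if [measurable]: "g \<in> borel \<rightarrow>\<^sub>M borel" for g
    by measurable
  have "(\<Sum>w'\<in>fin_words N n. \<integral>\<^sup>+x. \<integral>\<^sup>+y. h (foldr F w x) (foldr F w' y) \<partial>\<mu> \<partial>\<mu>)
      = of_nat (N ^ n) * (\<integral>\<^sup>+x. \<integral>\<^sup>+y. h (foldr F w x) y \<partial>\<mu> \<partial>\<mu>)" if w: "w \<in> fin_words N n" for w
  proof -
    have [measurable]: "foldr F w \<in> borel \<rightarrow>\<^sub>M borel"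
      by (rule cell_map_borel[OF w])
    have "(\<Sum>w'\<in>fin_words N n. \<integral>\<^sup>+x. \<integral>\<^sup>+y. h (foldr F w x) (foldr F w' y) \<partial>\<mu> \<partial>\<mu>)
        = (\<integral>\<^sup>+x. (\<Sum>w'\<in>fin_words N n. \<integral>\<^sup>+y. h (foldr F w x) (foldr F w' y) \<partial>\<mu>) \<partial>\<mu>)"
      by (rule nn_integral_sum[symmetric])
        (auto intro!: measurable_compose[OF _ meas] cell_map_borel)
    also have "\<dots> = (\<integral>\<^sup>+x. of_nat (N ^ n) * (\<integral>\<^sup>+y. h (foldr F w x) y \<partial>\<mu>) \<partial>\<mu>)"
      by (intro nn_integral_cong nn_integral_cells) measurable
    also have "\<dots> = of_nat (N ^ n) * (\<integral>\<^sup>+x. \<integral>\<^sup>+y. h (foldr F w x) y \<partial>\<mu> \<partial>\<mu>)"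
      by (rule nn_integral_cmult) measurable
    finally show ?thesis .
  qed
  then have "(\<Sum>w\<in>fin_words N n. \<Sum>w'\<in>fin_words N n. \<integral>\<^sup>+x. \<integral>\<^sup>+y. h (foldr F w x) (foldr F w' y) \<partial>\<mu> \<partial>\<mu>)
      = of_nat (N ^ n) * (\<Sum>w\<in>fin_words N n. \<integral>\<^sup>+x. \<integral>\<^sup>+y. h (foldr F w x) y \<partial>\<mu> \<partial>\<mu>)"
    by (simp add: sum_distrib_left)
  also have "\<dots> = of_nat (N ^ n) * (of_nat (N ^ n) * (\<integral>\<^sup>+x. \<integral>\<^sup>+y. h x y \<partial>\<mu> \<partial>\<mu>))"
    by (subst nn_integral_cells) measurable
  finally show ?thesis
    by (simp add: power2_eq_square mult.assoc)
qed

text \<open>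
  The integrand of the Besov double integral with both domains of integration absorbed, so that it can be
  transported by pairs of cell maps.
\<close>

definition near_integrand :: "real \<Rightarrow> ('a \<Rightarrow> real) \<Rightarrow> 'a \<Rightarrow> 'a \<Rightarrow> ennreal" where
  "near_integrand s u x y =
    (if dist x y < s \<and> x \<in> K \<and> y \<in> K then ennreal (\<bar>u x - u y\<bar>\<^sup>2) else 0)"

lemma near_integrand_borel [measurable]:
  assumes [measurable]: "u \<in> borel_measurable borel"
  shows "case_prod (near_integrand s u) \<in> borel_measurable (borel \<Otimes>\<^sub>M borel)"
  unfolding near_integrand_def case_prod_unfold by measurable

lemma besov_integral_eq:
  "(\<integral>\<^sup>+x\<in>K. (\<integral>\<^sup>+y\<in>ball x s \<inter> K. ennreal (\<bar>u x - u y\<bar>\<^sup>2) \<partial>\<mu>) \<partial>\<mu>)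
    = (\<integral>\<^sup>+x. \<integral>\<^sup>+y. near_integrand s u x y \<partial>\<mu> \<partial>\<mu>)"
proof (rule nn_integral_cong)
  fix x
  show "(\<integral>\<^sup>+y\<in>ball x s \<inter> K. ennreal (\<bar>u x - u y\<bar>\<^sup>2) \<partial>\<mu>) * indicator K x
      = (\<integral>\<^sup>+y. near_integrand s u x y \<partial>\<mu>)"
  proof (cases "x \<in> K")
    case True
    then show ?thesis
      by (auto simp: near_integrand_def indicator_def intro!: nn_integral_cong)
  qed (simp add: near_integrand_def)
qed

section \<open>Above the critical exponent\<close>

lemma square_integrable_cell:
  assumes [measurable]: "u \<in> borel_measurable borel" and fin: "(\<integral>\<^sup>+x. ennreal ((u x)\<^sup>2) \<partial>\<mu>) < \<infinity>"
    and w: "w \<in> fin_words N n"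
  shows "(\<lambda>x. u (foldr F w x)) \<in> borel_measurable \<mu>"
    and "integrable \<mu> (\<lambda>x. (u (foldr F w x))\<^sup>2)"
proof -
  have [measurable]: "foldr F w \<in> borel \<rightarrow>\<^sub>M borel"
    by (rule cell_map_borel[OF w])
  show [measurable]: "(\<lambda>x. u (foldr F w x)) \<in> borel_measurable \<mu>"
    by measurable
  have "(\<integral>\<^sup>+x. ennreal ((u (foldr F w x))\<^sup>2) \<partial>\<mu>)
      \<le> (\<Sum>w\<in>fin_words N n. \<integral>\<^sup>+x. ennreal ((u (foldr F w x))\<^sup>2) \<partial>\<mu>)"
    using w by (intro member_le_sum) auto
  also have "\<dots> = of_nat (N ^ n) * (\<integral>\<^sup>+x. ennreal ((u x)\<^sup>2) \<partial>\<mu>)"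
    by (rule nn_integral_cells) measurable
  also have "\<dots> < \<infinity>"
    using fin by (simp add: ennreal_mult_less_top of_nat_less_top power_less_top_ennreal)
  finally show "integrable \<mu> (\<lambda>x. (u (foldr F w x))\<^sup>2)"
    by (intro integrableI_bounded) auto
qed

abbreviation cell_mean :: "('a \<Rightarrow> real) \<Rightarrow> nat list \<Rightarrow> real" where
  "cell_mean u w \<equiv> expectation (\<lambda>x. u (foldr F w x))"

abbreviation cell_variance :: "('a \<Rightarrow> real) \<Rightarrow> nat list \<Rightarrow> real" where
  "cell_variance u w \<equiv> variance (\<lambda>x. u (foldr F w x))"

text \<open>
  The discrete counterpart of the double integral in the Besov seminorm. Point values of
  \<open>u\<close> are replaced by means over cells, which make sense for a function that is determined
  almost everywhere only.
\<close>

definition neighbour_energy :: "('a \<Rightarrow> real) \<Rightarrow> nat \<Rightarrow> real" where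
  "neighbour_energy u n = (\<Sum>w\<in>fin_words N n. \<Sum>w'\<in>{w'\<in>fin_words N n. meets w w'}.
     (cell_mean u w - cell_mean u w')\<^sup>2 + cell_variance u w + cell_variance u w')"

lemma neighbour_energy_nonneg: "0 \<le> neighbour_energy u n"
  unfolding neighbour_energy_def by (intro sum_nonneg add_nonneg_nonneg variance_positive) simp

lemma le_neighbour_energy:
  assumes "w \<in> fin_words N n" "w' \<in> fin_words N n" "meets w w'"
  shows "(cell_mean u w - cell_mean u w')\<^sup>2 + cell_variance u w + cell_variance u w'
    \<le> (\<Sum>w'\<in>{w'\<in>fin_words N n. meets w w'}.
        (cell_mean u w - cell_mean u w')\<^sup>2 + cell_variance u w + cell_variance u w')"
    and "(cell_mean u w - cell_mean u w')\<^sup>2 + cell_variance u w + cell_variance u w'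
      \<le> neighbour_energy u n"
proof -
  let ?f = "\<lambda>w w'. (cell_mean u w - cell_mean u w')\<^sup>2 + cell_variance u w + cell_variance u w'"
  let ?g = "\<lambda>w. \<Sum>w'\<in>{w'\<in>fin_words N n. meets w w'}. ?f w w'"
  have nonneg: "0 \<le> ?f w w'" for w w'
    by (intro add_nonneg_nonneg variance_positive) simp
  show 1: "?f w w' \<le> ?g w"
    using assms nonneg by (intro member_le_sum) auto
  have "?g w \<le> neighbour_energy u n"
    unfolding neighbour_energy_def using assms nonneg by (intro member_le_sum sum_nonneg) auto
  then show "?f w w' \<le> neighbour_energy u n"
    using 1 by linarith
qed

lemma neighbour_energy_le:
  assumes u [measurable]: "u \<in> borel_measurable borel" and fin: "(\<integral>\<^sup>+x. ennreal ((u x)\<^sup>2) \<partial>\<mu>) < \<infinity>"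
    and s: "2 * diameter K * \<rho> ^ n < s"
  shows "ennreal (neighbour_energy u n)
    \<le> of_nat (N ^ n) ^ 2 * (\<integral>\<^sup>+x. \<integral>\<^sup>+y. near_integrand s u x y \<partial>\<mu> \<partial>\<mu>)"
proof -
  let ?f = "\<lambda>w w'. (cell_mean u w - cell_mean u w')\<^sup>2 + cell_variance u w + cell_variance u w'"
  let ?J = "\<lambda>w w'. \<integral>\<^sup>+x. \<integral>\<^sup>+y. near_integrand s u (foldr F w x) (foldr F w' y) \<partial>\<mu> \<partial>\<mu>"
  have J: "ennreal (?f w w') \<le> ?J w w'"
    if w: "w \<in> fin_words N n" and w': "w' \<in> fin_words N n" and "meets w w'" for w w'
  proof -
    obtain z where z: "z \<in> foldr F w ` K" "z \<in> foldr F w' ` K"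
      using \<open>meets w w'\<close> by (auto simp: meets_def)
    have eq: "near_integrand s u (foldr F w x) (foldr F w' y)
        = ennreal ((u (foldr F w x) - u (foldr F w' y))\<^sup>2)" if "x \<in> K" "y \<in> K" for x y
    proof -
      have "dist (foldr F w x) z \<le> \<rho> ^ n * diameter K" "dist z (foldr F w' y) \<le> \<rho> ^ n * diameter K"
        using dist_in_cell_le[OF w _ z(1)] dist_in_cell_le[OF w' z(2)] that by auto
      moreover have "2 * (\<rho> ^ n * diameter K) < s"
        using s by (simp add: mult_ac)
      ultimately have "dist (foldr F w x) (foldr F w' y) < s"
        using dist_triangle[of "foldr F w x" "foldr F w' y" z] by linarith
      then show ?thesis
        using that cell_map_in_K w w' by (simp add: near_integrand_def)
    qed
    have "ennreal (?f w w')
        = (\<integral>\<^sup>+x. \<integral>\<^sup>+y. ennreal ((u (foldr F w x) - u (foldr F w' y))\<^sup>2) \<partial>\<mu> \<partial>\<mu>)"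
      using square_integrable_cell[OF u fin] w w'
      by (intro nn_integral_nn_integral_diff_square[symmetric]) auto
    also have "\<dots> \<le> ?J w w'"
    proof (rule nn_integral_mono_AE, use AE_in_K in eventually_elim)
      fix x assume x: "x \<in> K"
      show "(\<integral>\<^sup>+y. ennreal ((u (foldr F w x) - u (foldr F w' y))\<^sup>2) \<partial>\<mu>)
          \<le> (\<integral>\<^sup>+y. near_integrand s u (foldr F w x) (foldr F w' y) \<partial>\<mu>)"
        by (rule nn_integral_mono_AE, use AE_in_K in eventually_elim) (simp add: eq x)
    qed
    finally show ?thesis .
  qed
  have "ennreal (neighbour_energy u n)
      = (\<Sum>w\<in>fin_words N n. \<Sum>w'\<in>{w'\<in>fin_words N n. meets w w'}. ennreal (?f w w'))"
    unfolding neighbour_energy_def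
    by (simp add: sum_ennreal sum_nonneg variance_positive del: ennreal_plus)
  also have "\<dots> \<le> (\<Sum>w\<in>fin_words N n. \<Sum>w'\<in>{w'\<in>fin_words N n. meets w w'}. ?J w w')"
    by (intro sum_mono J) auto
  also have "\<dots> \<le> (\<Sum>w\<in>fin_words N n. \<Sum>w'\<in>fin_words N n. ?J w w')"
    by (intro sum_mono sum_mono2) auto
  also have "\<dots> = of_nat (N ^ n) ^ 2 * (\<integral>\<^sup>+x. \<integral>\<^sup>+y. near_integrand s u x y \<partial>\<mu> \<partial>\<mu>)"
    by (rule nn_integral_cell_pairs) measurable
  finally show ?thesis .
qed

text \<open>
  The exponent bookkeeping behind the threshold: \<open>N\<^bsup>2 n\<^esup>\<close> pairs of cells of measure \<open>N\<^bsup>-n\<^esup>\<close>, with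
  \<open>N = \<rho>\<^bsup>-\<alpha>\<^esup>\<close>, turn the scaling \<open>s\<^bsup>\<alpha> + 2 \<sigma>\<^esup>\<close> of the double integral into the scaling
  \<open>\<rho>\<^bsup>n (2 \<sigma> - \<alpha>)\<^esup>\<close> of the energies.
\<close>

lemma N_power_mult:
  "real (N ^ n) ^ 2 * (a * \<rho> ^ n) powr (\<alpha> + 2 * \<sigma>) = a powr (\<alpha> + 2 * \<sigma>) * (\<rho> powr (2 * \<sigma> - \<alpha>)) ^ n"
  if "0 < a" for a
proof -
  have "real (N ^ n) = (\<rho> ^ n) powr (- \<alpha>)"
    using N_eq rho_pos by (simp add: powr_realpow[symmetric] powr_powr mult.commute)
  then have "real (N ^ n) ^ 2 = (\<rho> ^ n) powr (- \<alpha>) * (\<rho> ^ n) powr (- \<alpha>)"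
    by (simp add: power2_eq_square)
  moreover have "(a * \<rho> ^ n) powr (\<alpha> + 2 * \<sigma>) = a powr (\<alpha> + 2 * \<sigma>) * (\<rho> ^ n) powr (\<alpha> + 2 * \<sigma>)"
    using that rho_pos by (simp add: powr_mult)
  ultimately have "real (N ^ n) ^ 2 * (a * \<rho> ^ n) powr (\<alpha> + 2 * \<sigma>)
      = a powr (\<alpha> + 2 * \<sigma>) * (\<rho> ^ n) powr (- \<alpha> + - \<alpha> + (\<alpha> + 2 * \<sigma>))"
    by (simp only: powr_add mult_ac)
  also have "- \<alpha> + - \<alpha> + (\<alpha> + 2 * \<sigma>) = 2 * \<sigma> - \<alpha>"
    by simp
  also have "(\<rho> ^ n) powr (2 * \<sigma> - \<alpha>) = (\<rho> powr (2 * \<sigma> - \<alpha>)) ^ n"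
    using rho_pos by (simp add: powr_realpow[symmetric] powr_powr mult.commute)
  finally show ?thesis .
qed

lemma besov_neighbour_energy:
  assumes "u \<in> besov_space \<mu> K \<alpha> \<sigma>"
  obtains C where "0 \<le> C"
    "\<forall>\<^sub>F n in sequentially. neighbour_energy u n \<le> C * (\<rho> powr (2 * \<sigma> - \<alpha>)) ^ n"
proof -
  have u: "u \<in> borel_measurable borel"
    using assms by (simp add: besov_space_def measurable_cong_sets[OF sets_mu refl])
  have fin: "(\<integral>\<^sup>+x. ennreal ((u x)\<^sup>2) \<partial>\<mu>) < \<infinity>"
  proof -
    have "(\<integral>\<^sup>+x. ennreal ((u x)\<^sup>2) \<partial>\<mu>) = (\<integral>\<^sup>+x\<in>K. ennreal (\<bar>u x\<bar>\<^sup>2) \<partial>\<mu>)"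
      by (rule nn_integral_cong_AE, use AE_in_K in eventually_elim) simp
    then show ?thesis
      using assms by (simp add: besov_space_def)
  qed
  define S where "S = enn2real (besov_seminorm_sq \<mu> K \<alpha> \<sigma> u)"
  have S: "besov_seminorm_sq \<mu> K \<alpha> \<sigma> u = ennreal S" "0 \<le> S"
    using assms by (simp_all add: besov_space_def S_def)
  define c where "c = 2 * diameter K + 1"
  have diam: "0 \<le> diameter K"
    using diameter_ge_0 compact_K compact_imp_bounded by blast
  have c: "0 < c"
    using diam by (simp add: c_def)
  have le: "neighbour_energy u n \<le> S * c powr (\<alpha> + 2 * \<sigma>) * (\<rho> powr (2 * \<sigma> - \<alpha>)) ^ n"
    if small: "\<rho> ^ n * c < 1" for n
  proof -
    let ?s = "c * \<rho> ^ n" and ?a = "\<alpha> + 2 * \<sigma>"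
    let ?J = "\<integral>\<^sup>+x. \<integral>\<^sup>+y. near_integrand ?s u x y \<partial>\<mu> \<partial>\<mu>"
    have s: "0 < ?s" "?s < 1"
      using c rho_pos small by (simp_all add: mult.commute)
    have "ennreal (?s powr (- \<alpha> - 2 * \<sigma>)) * ?J \<le> ennreal S"
      unfolding S(1)[symmetric] besov_seminorm_sq_def besov_integral_eq
      using s by (intro SUP_upper) auto
    then have "ennreal (?s powr ?a) * (ennreal (?s powr (- \<alpha> - 2 * \<sigma>)) * ?J)
        \<le> ennreal (?s powr ?a) * ennreal S"
      by (rule mult_left_mono) simp
    moreover have "ennreal (?s powr ?a) * ennreal (?s powr (- \<alpha> - 2 * \<sigma>)) = 1"
      using s c rho_pos by (simp add: ennreal_mult[symmetric] powr_add[symmetric])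
    ultimately have J: "?J \<le> ennreal (?s powr ?a * S)"
      using S(2) by (simp add: mult.assoc[symmetric] ennreal_mult)
    have "2 * diameter K * \<rho> ^ n < ?s"
      using rho_pos by (simp add: c_def algebra_simps)
    then have "ennreal (neighbour_energy u n) \<le> of_nat (N ^ n) ^ 2 * ?J"
      by (rule neighbour_energy_le[OF u fin])
    also have "\<dots> \<le> of_nat (N ^ n) ^ 2 * ennreal (?s powr ?a * S)"
      by (rule mult_left_mono[OF J]) simp
    also have "\<dots> = ennreal (real (N ^ n) ^ 2 * (?s powr ?a * S))"
      using S(2) by (simp only: ennreal_of_nat_eq_real_of_nat ennreal_power ennreal_mult of_nat_0_le_iff
        zero_le_power mult_nonneg_nonneg powr_ge_zero)
    finally have "neighbour_energy u n \<le> real (N ^ n) ^ 2 * (?s powr ?a * S)"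
      using S(2) by (subst (asm) ennreal_le_iff) auto
    also have "\<dots> = real (N ^ n) ^ 2 * ?s powr ?a * S"
      by simp
    finally show ?thesis
      unfolding N_power_mult[OF c] by (simp add: mult_ac)
  qed
  have "\<forall>\<^sub>F n in sequentially. \<rho> ^ n * c < 1"
    using rho_power_tendsto[of c] by (rule order_tendstoD) simp
  then have "\<forall>\<^sub>F n in sequentially.
      neighbour_energy u n \<le> S * c powr (\<alpha> + 2 * \<sigma>) * (\<rho> powr (2 * \<sigma> - \<alpha>)) ^ n"
    by eventually_elim (rule le)
  then show ?thesis
    using that[of "S * c powr (\<alpha> + 2 * \<sigma>)"] S(2) by simp
qed

text \<open>
  A vertex is given the mean over some cell containing it. The resulting function on the vertices
  has energy at most a multiple of the neighbour energy, so a growth rate for the resistances bounds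
  the spread of the cell means.
\<close>

lemma cell_mean_oscillation:
  assumes A: "0 \<le> A" "1 \<le> t" "\<And>n f x p. x \<in> vertices N F V0 n \<Longrightarrow> p \<in> V0 \<Longrightarrow>
      \<bar>f x - f p\<bar> \<le> A * t ^ n * sqrt (energy N F V0 n f)"
    and w: "w \<in> fin_words N n" "w' \<in> fin_words N n"
  shows "\<bar>cell_mean u w - cell_mean u w'\<bar>
    \<le> (2 + 4 * A * real (card V0)) * (t ^ n * sqrt (neighbour_energy u n))"
proof -
  define sel where "sel x = (SOME w. w \<in> fin_words N n \<and> x \<in> foldr F w ` V0)" for x
  have sel: "sel x \<in> fin_words N n \<and> x \<in> foldr F (sel x) ` V0" if "x \<in> vertices N F V0 n" for x
  proof -
    have "\<exists>w. w \<in> fin_words N n \<and> x \<in> foldr F w ` V0"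
      using that by (auto simp: vertices_eq)
    then show ?thesis
      unfolding sel_def by (rule someI_ex)
  qed
  define v where "v x = cell_mean u (sel x)" for x
  let ?f = "\<lambda>w w'. (cell_mean u w - cell_mean u w')\<^sup>2 + cell_variance u w + cell_variance u w'"
  let ?g = "\<lambda>w. \<Sum>w'\<in>{w'\<in>fin_words N n. meets w w'}. ?f w w'"
  let ?D = "neighbour_energy u n"
  have vertex: "foldr F w p \<in> vertices N F V0 n" if "w \<in> fin_words N n" "p \<in> V0" for w p
    using that by (auto simp: vertices_eq)
  have cell: "(cell_mean u w - v (foldr F w p))\<^sup>2 \<le> ?g w"
    "(cell_mean u w - v (foldr F w p))\<^sup>2 \<le> ?D"
    if w: "w \<in> fin_words N n" and p: "p \<in> V0" for w p
  proof -
    have s: "sel (foldr F w p) \<in> fin_words N n" "foldr F w p \<in> foldr F (sel (foldr F w p)) ` V0"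
      using sel[OF vertex[OF w p]] by auto
    have "meets w (sel (foldr F w p))"
      using s(2) V0_subset_K p unfolding meets_def by blast
    note le = le_neighbour_energy[OF w s(1) this, of u]
    have "(cell_mean u w - v (foldr F w p))\<^sup>2 \<le> ?f w (sel (foldr F w p))"
      using variance_positive unfolding v_def by (simp add: add_nonneg_nonneg add.assoc)
    then show "(cell_mean u w - v (foldr F w p))\<^sup>2 \<le> ?g w" "(cell_mean u w - v (foldr F w p))\<^sup>2 \<le> ?D"
      using le by linarith+
  qed
  have "edge_energy (\<lambda>x. v (foldr F w x)) \<le> real (card V0) ^ 2 * (4 * ?g w)"
    if w: "w \<in> fin_words N n" for w
  proof (rule edge_energy_le)
    fix p q assume pq: "p \<in> V0" "q \<in> V0"
    let ?a = "cell_mean u w - v (foldr F w p)" and ?b = "cell_mean u w - v (foldr F w q)"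
    have "(?b - ?a)\<^sup>2 \<le> 2 * ?a\<^sup>2 + 2 * ?b\<^sup>2"
      using sum_squares_ge_zero[of "?a + ?b" 0] by (simp add: power2_eq_square algebra_simps)
    then show "\<bar>v (foldr F w p) - v (foldr F w q)\<bar>\<^sup>2 \<le> 4 * ?g w"
      using cell(1)[OF w pq(1)] cell(1)[OF w pq(2)] by simp
  qed
  then have "energy N F V0 n v \<le> (\<Sum>w\<in>fin_words N n. real (card V0) ^ 2 * (4 * ?g w))"
    unfolding energy_eq by (rule sum_mono)
  also have "\<dots> = (2 * real (card V0)) ^ 2 * ?D"
    by (simp add: neighbour_energy_def sum_distrib_left power2_eq_square mult_ac)
  finally have "sqrt (energy N F V0 n v) \<le> sqrt ((2 * real (card V0)) ^ 2 * ?D)"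
    by (rule real_sqrt_le_mono)
  then have sqrt_E: "sqrt (energy N F V0 n v) \<le> 2 * real (card V0) * sqrt ?D"
    by (simp add: real_sqrt_mult)
  have tn: "1 \<le> t ^ n"
    using A(2) by (rule one_le_power)
  obtain p where p: "p \<in> V0"
    using V0_nonempty by blast
  have half: "\<bar>cell_mean u w - v p\<bar> \<le> (1 + 2 * A * real (card V0)) * (t ^ n * sqrt ?D)"
    if w: "w \<in> fin_words N n" for w
  proof -
    have "\<bar>cell_mean u w - v (foldr F w p)\<bar> \<le> sqrt ?D"
      using cell(2)[OF w p] by (intro real_le_rsqrt) simp
    also have "\<dots> \<le> t ^ n * sqrt ?D"
      using mult_right_mono[OF tn, of "sqrt ?D"] neighbour_energy_nonneg by simp
    finally have 1: "\<bar>cell_mean u w - v (foldr F w p)\<bar> \<le> t ^ n * sqrt ?D" .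
    have "\<bar>v (foldr F w p) - v p\<bar> \<le> A * t ^ n * sqrt (energy N F V0 n v)"
      by (rule A(3)[OF vertex[OF w p] p])
    also have "\<dots> \<le> A * t ^ n * (2 * real (card V0) * sqrt ?D)"
      using A tn by (intro mult_left_mono[OF sqrt_E]) auto
    finally show ?thesis
      using 1 by (simp add: algebra_simps)
  qed
  show ?thesis
    using half[OF w(1)] half[OF w(2)] by (simp add: algebra_simps)
qed

text \<open>
  The variance of \<open>u\<close> is at most the spread of the cell means plus the variances inside the cells. Both
  are \<open>O((\<beta> t\<^sup>2)\<^sup>n)\<close> for any \<open>t\<^sup>2\<close> above \<open>R\<^sup>#\<close>, and \<open>t\<close> can be chosen with \<open>\<beta> t\<^sup>2 < 1\<close>.
\<close>

lemma besov_function_constant: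
  assumes trace: "\<And>n. is_trace N F V0 n (Rn n)"
    and rates: "\<And>p q. p \<in> V0 \<Longrightarrow> q \<in> V0 \<Longrightarrow> p \<noteq> q \<Longrightarrow> has_growth_rate (\<lambda>n. Rn n p q) (R p q)"
    and \<sigma>: "R_sharp V0 R * \<rho> powr (2 * \<sigma> - \<alpha>) < 1"
    and besov: "u \<in> besov_space \<mu> K \<alpha> \<sigma>"
  shows "\<exists>c. AE x in \<mu>. u x = c"
proof -
  define \<beta> where "\<beta> = \<rho> powr (2 * \<sigma> - \<alpha>)"
  have \<beta>: "0 < \<beta>"
    using rho_pos by (simp add: \<beta>_def)
  have R1: "1 < R_sharp V0 R"
    using rates by (intro R_sharp_greater) (auto simp: has_growth_rate_def card_V0)
  define t where "t = sqrt ((R_sharp V0 R + 1 / \<beta>) / 2)"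
  have R\<beta>: "R_sharp V0 R < 1 / \<beta>"
    using \<sigma> \<beta> by (simp add: \<beta>_def field_simps)
  have t2: "t\<^sup>2 = (R_sharp V0 R + 1 / \<beta>) / 2"
    using R1 \<beta> by (simp add: t_def)
  have t: "1 < t" "R_sharp V0 R < t\<^sup>2" "t\<^sup>2 * \<beta> < 1"
  proof -
    show "R_sharp V0 R < t\<^sup>2"
      using R\<beta> unfolding t2 by simp
    show "1 < t"
      unfolding t_def using R1 R\<beta> by (intro real_less_rsqrt) auto
    have "t\<^sup>2 < 1 / \<beta>"
      using R\<beta> unfolding t2 by simp
    then show "t\<^sup>2 * \<beta> < 1"
      using \<beta> by (simp add: field_simps)
  qed
  have t0: "0 < t" "1 \<le> t"
    using t(1) by auto
  obtain C0 where C0: "0 \<le> C0" "\<And>n f p q. p \<in> V0 \<Longrightarrow> q \<in> V0 \<Longrightarrow>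
      \<bar>f p - f q\<bar> \<le> C0 * t ^ n * sqrt (energy N F V0 n f)"
    using boundary_difference_le[OF trace rates t0(1) t(2)] by blast
  obtain A where A: "0 \<le> A" "\<And>n f x p. x \<in> vertices N F V0 n \<Longrightarrow> p \<in> V0 \<Longrightarrow>
      \<bar>f x - f p\<bar> \<le> A * t ^ n * sqrt (energy N F V0 n f)"
    using oscillation_le_energy[OF t(1) C0] by blast
  obtain C where C: "0 \<le> C" "\<forall>\<^sub>F n in sequentially. neighbour_energy u n \<le> C * \<beta> ^ n"
    using besov_neighbour_energy[OF besov] unfolding \<beta>_def by blast
  have u [measurable]: "u \<in> borel_measurable borel"
    using besov by (simp add: besov_space_def measurable_cong_sets[OF sets_mu refl])
  have fin: "(\<integral>\<^sup>+x. ennreal ((u x)\<^sup>2) \<partial>\<mu>) < \<infinity>"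
  proof -
    have "(\<integral>\<^sup>+x. ennreal ((u x)\<^sup>2) \<partial>\<mu>) = (\<integral>\<^sup>+x\<in>K. ennreal (\<bar>u x\<bar>\<^sup>2) \<partial>\<mu>)"
      by (rule nn_integral_cong_AE, use AE_in_K in eventually_elim) simp
    then show ?thesis
      using besov by (simp add: besov_space_def)
  qed
  have u2: "u \<in> borel_measurable \<mu>" "integrable \<mu> (\<lambda>x. (u x)\<^sup>2)"
    using square_integrable_cell[OF u fin, of "[]" 0] by simp_all
  define B where "B = 1 + (2 + 4 * A * real (card V0))\<^sup>2"
  \<comment> \<open>The variance of \<open>u\<close> is split into the variances inside the cells and the spread of the means.\<close>
  have var_le: "variance u \<le> B * ((t\<^sup>2) ^ n * neighbour_energy u n)" for n
  proof -
    let ?D = "neighbour_energy u n"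
    obtain w0 where w0: "w0 \<in> fin_words N n"
      using card_fin_words[of N n] N_pos by fastforce
    define a where "a = cell_mean u w0"
    have tn: "1 \<le> (t\<^sup>2) ^ n"
      using t0 by (simp add: one_le_power)
    have cell: "(cell_mean u w - a)\<^sup>2 + cell_variance u w \<le> B * ((t\<^sup>2) ^ n * ?D)"
      if w: "w \<in> fin_words N n" for w
    proof -
      have "\<bar>cell_mean u w - a\<bar> \<le> (2 + 4 * A * real (card V0)) * (t ^ n * sqrt ?D)"
        unfolding a_def by (rule cell_mean_oscillation[OF A(1) t0(2) A(2) w w0])
      then have "\<bar>cell_mean u w - a\<bar>\<^sup>2 \<le> ((2 + 4 * A * real (card V0)) * (t ^ n * sqrt ?D))\<^sup>2"
        by (rule power_mono) simp
      also have "\<dots> = (2 + 4 * A * real (card V0))\<^sup>2 * ((t\<^sup>2) ^ n * ?D)"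
        using neighbour_energy_nonneg[of u n]
        by (simp add: power_mult_distrib power_mult[symmetric] mult.commute)
      finally have "(cell_mean u w - a)\<^sup>2 \<le> (2 + 4 * A * real (card V0))\<^sup>2 * ((t\<^sup>2) ^ n * ?D)"
        by simp
      moreover have "cell_variance u w \<le> ?D"
        using le_neighbour_energy(2)[OF w w meets_refl, of u] variance_positive[of "\<lambda>x. u (foldr F w x)"]
          zero_le_power2[of "cell_mean u w - cell_mean u w"] by linarith
      moreover have "?D \<le> (t\<^sup>2) ^ n * ?D"
        using mult_right_mono[OF tn, of ?D] neighbour_energy_nonneg[of u n] by simp
      ultimately show ?thesis
        unfolding B_def by (simp add: algebra_simps)
    qed
    have B_nonneg: "0 \<le> B * ((t\<^sup>2) ^ n * ?D)"
      using neighbour_energy_nonneg[of u n] by (simp add: B_def)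
    have "of_nat (N ^ n) * (\<integral>\<^sup>+x. ennreal ((u x - a)\<^sup>2) \<partial>\<mu>)
        = (\<Sum>w\<in>fin_words N n. \<integral>\<^sup>+x. ennreal ((u (foldr F w x) - a)\<^sup>2) \<partial>\<mu>)"
      by (rule nn_integral_cells[symmetric]) measurable
    also have "\<dots> = (\<Sum>w\<in>fin_words N n. ennreal ((cell_mean u w - a)\<^sup>2 + cell_variance u w))"
      using square_integrable_cell[OF u fin] by (intro sum.cong refl nn_integral_diff_square) auto
    also have "\<dots> \<le> (\<Sum>w\<in>fin_words N n. ennreal (B * ((t\<^sup>2) ^ n * ?D)))"
      by (intro sum_mono ennreal_leI cell)
    also have "\<dots> = of_nat (N ^ n) * ennreal (B * ((t\<^sup>2) ^ n * ?D))"
      by (simp add: card_fin_words)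
    also have "(\<integral>\<^sup>+x. ennreal ((u x - a)\<^sup>2) \<partial>\<mu>) = ennreal ((expectation u - a)\<^sup>2 + variance u)"
      by (rule nn_integral_diff_square[OF u2])
    finally have "ennreal (real (N ^ n) * ((expectation u - a)\<^sup>2 + variance u))
        \<le> ennreal (real (N ^ n) * (B * ((t\<^sup>2) ^ n * ?D)))"
      using B_nonneg variance_positive[of u]
      by (simp only: ennreal_of_nat_eq_real_of_nat ennreal_mult[symmetric] of_nat_0_le_iff
        zero_le_power2 add_nonneg_nonneg)
    then have "real (N ^ n) * ((expectation u - a)\<^sup>2 + variance u)
        \<le> real (N ^ n) * (B * ((t\<^sup>2) ^ n * ?D))"
      using B_nonneg by (subst (asm) ennreal_le_iff) auto
    then have "(expectation u - a)\<^sup>2 + variance u \<le> B * ((t\<^sup>2) ^ n * ?D)"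
      using N_pos by (subst (asm) mult_le_cancel_left_pos) auto
    then show ?thesis
      using zero_le_power2[of "expectation u - a"] by linarith
  qed
  have "\<forall>\<^sub>F n in sequentially. variance u \<le> B * C * (t\<^sup>2 * \<beta>) ^ n"
    using C(2)
  proof eventually_elim
    fix n assume D: "neighbour_energy u n \<le> C * \<beta> ^ n"
    have "variance u \<le> B * ((t\<^sup>2) ^ n * neighbour_energy u n)"
      by (rule var_le)
    also have "\<dots> \<le> B * ((t\<^sup>2) ^ n * (C * \<beta> ^ n))"
      using D by (intro mult_left_mono) (auto simp: B_def)
    finally show "variance u \<le> B * C * (t\<^sup>2 * \<beta>) ^ n"
      by (simp add: power_mult_distrib mult_ac)
  qed
  moreover have "(\<lambda>n. B * C * (t\<^sup>2 * \<beta>) ^ n) \<longlonglongrightarrow> B * C * 0"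
    using t(3) \<beta> by (intro tendsto_mult_left LIMSEQ_realpow_zero) auto
  ultimately have "variance u \<le> B * C * 0"
    by (intro tendsto_lowerbound[where F = sequentially]) auto
  then have "variance u = 0"
    using variance_positive[of u] by simp
  then show ?thesis
    using AE_eq_expectation[OF u2] by blast
qed

end

section \<open>Extensions with small energy\<close>

context pcf_homotheties
begin

definition invariant :: "'a rel \<Rightarrow> ('a \<Rightarrow> real) \<Rightarrow> bool" where
  "invariant r f \<longleftrightarrow> (\<forall>(x, y)\<in>r. f x = f y)"

text \<open>
  The level \<open>n\<close> relation contains a copy of \<open>r\<close> in every \<open>n\<close>-cell; this is what makes an
  extension that respects it admissible as boundary data in the cells.
\<close>

lemma word_image_induced_rel:
  "(p, q) \<in> r \<Longrightarrow> w \<in> fin_words N n \<Longrightarrow> (foldr F w p, foldr F w q) \<in> induced_rel N F V0 r n"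
proof (induction n arbitrary: w)
  case (Suc n)
  then obtain i v where w: "w = i # v" "i \<in> {1..N}" "v \<in> fin_words N n"
    by (auto simp: fin_words_Suc)
  then have "(foldr F v p, foldr F v q) \<in> induced_rel N F V0 r n"
    using Suc by blast
  then show ?case
    using w(1,2) by auto
qed simp

text \<open>
  A minimizer for the quotient trace. Its energy is compared with the energy of the boundary values by
  choosing a representative in each class.
\<close>

lemma quotient_extension:
  assumes r: "equiv V0 r" and trace: "is_quotient_trace N F V0 r n RQ" and b: "0 \<le> b"
    and small: "\<And>I J. I \<in> V0 // r \<Longrightarrow> J \<in> V0 // r \<Longrightarrow> I \<noteq> J \<Longrightarrow> enn2real (1 / RQ I J) \<le> b"
    and f: "invariant r f"
  obtains v where "\<And>p. p \<in> V0 \<Longrightarrow> v p = f p"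
    "\<And>w. w \<in> fin_words N n \<Longrightarrow> invariant r (\<lambda>x. v (foldr F w x))"
    "energy N F V0 n v \<le> real (card (V0 // r)) ^ 2 * b * edge_energy f"
proof -
  define u where "u I = f (SOME q. q \<in> I)" for I
  have u: "u (r `` {p}) = f p" if "p \<in> V0" for p
  proof -
    have "(SOME q. q \<in> r `` {p}) \<in> r `` {p}"
      using equiv_class_self[OF r that] by (rule someI)
    then show ?thesis
      using f by (auto simp: u_def invariant_def)
  qed
  let ?m = "pair_sum (V0 // r) (\<lambda>I J. enn2real (1 / RQ I J) * \<bar>u I - u J\<bar>\<^sup>2)"
  have "is_minimum {energy N F V0 n v | v. (\<forall>(x, y)\<in>induced_rel N F V0 r n. v x = v y) \<and>
      (\<forall>p\<in>V0. v p = u (r `` {p}))} ?m"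
    using trace unfolding is_quotient_trace_def by blast
  then obtain v where v: "?m = energy N F V0 n v" "\<forall>(x, y)\<in>induced_rel N F V0 r n. v x = v y"
      "\<forall>p\<in>V0. v p = u (r `` {p})"
    unfolding is_minimum_def by blast
  have "?m \<le> real (card (V0 // r)) ^ 2 * (b * edge_energy f)"
  proof (rule pair_sum_le)
    show "finite (V0 // r)"
      using finite_V0 finite_quotient r by (metis equiv_type)
    fix I J assume IJ: "I \<in> V0 // r" "J \<in> V0 // r" "I \<noteq> J"
    obtain p q where "p \<in> V0" "q \<in> V0" "I = r `` {p}" "J = r `` {q}"
      using IJ(1,2) by (auto elim!: quotientE)
    then have "\<bar>u I - u J\<bar>\<^sup>2 \<le> edge_energy f"
      using diff_le_edge_energy[of p q f] by (simp add: u)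
    then show "enn2real (1 / RQ I J) * \<bar>u I - u J\<bar>\<^sup>2 \<le> b * edge_energy f"
      using small[OF IJ] b by (intro mult_mono) auto
  qed (use b edge_energy_nonneg in auto)
  then have "energy N F V0 n v \<le> real (card (V0 // r)) ^ 2 * b * edge_energy f"
    using v(1) by (simp add: mult.assoc)
  moreover have "invariant r (\<lambda>x. v (foldr F w x))" if "w \<in> fin_words N n" for w
    using v(2) word_image_induced_rel[OF _ that] by (fastforce simp: invariant_def)
  ultimately show ?thesis
    using that[of v] v(3) u by auto
qed

text \<open>
  The decay is exponential with any rate slower than \<open>s\<close>, so at a sufficiently high level it beats both the
  constant in \<open>quotient_extension\<close> and the prescribed rate \<open>\<theta>\<close>.
\<close>

lemma decay_extension:
  assumes r: "equiv V0 r" and qtrace: "\<And>n. is_quotient_trace N F V0 r n (RQ n)"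
    and decay: "\<forall>\<^sub>F \<epsilon> in at_right 0. \<forall>I\<in>V0 // r. \<forall>J\<in>V0 // r. I \<noteq> J \<longrightarrow>
        (\<lambda>n. ennreal (s powr ((1 - \<epsilon>) * real n)) / RQ n I J) \<longlonglongrightarrow> 0"
    and s: "1 < s" and \<theta>: "1 / s < \<theta>"
  obtains m where "0 < m" "\<And>f. invariant r f \<Longrightarrow> \<exists>v. (\<forall>p\<in>V0. v p = f p) \<and>
      (\<forall>w\<in>fin_words N m. invariant r (\<lambda>x. v (foldr F w x))) \<and>
      energy N F V0 m v \<le> \<theta> ^ m * edge_energy f"
proof -
  have \<theta>0: "0 < \<theta>"
    using s \<theta> by (meson less_trans zero_less_divide_1_iff zero_less_one)
  have "((\<lambda>\<epsilon>. s powr (- (1 - \<epsilon>))) \<longlongrightarrow> s powr (- (1 - 0))) (at_right 0)"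
    using s by (intro tendsto_intros) auto
  moreover have "s powr (- (1 - 0)) < \<theta>"
    using s \<theta> by (simp add: powr_minus_divide)
  ultimately have "\<forall>\<^sub>F \<epsilon> in at_right 0. s powr (- (1 - \<epsilon>)) < \<theta>"
    by (rule order_tendstoD(2))
  then have "\<forall>\<^sub>F \<epsilon> in at_right 0. s powr (- (1 - \<epsilon>)) < \<theta> \<and>
      (\<forall>I\<in>V0 // r. \<forall>J\<in>V0 // r. I \<noteq> J \<longrightarrow>
        (\<lambda>n. ennreal (s powr ((1 - \<epsilon>) * real n)) / RQ n I J) \<longlonglongrightarrow> 0)"
    using decay by (rule eventually_conj)
  from eventually_happens'[OF trivial_limit_at_right_real this] obtain \<epsilon> where \<epsilon>: "s powr (- (1 - \<epsilon>)) < \<theta>"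
      "\<And>I J. I \<in> V0 // r \<Longrightarrow> J \<in> V0 // r \<Longrightarrow> I \<noteq> J \<Longrightarrow>
        (\<lambda>n. ennreal (s powr ((1 - \<epsilon>) * real n)) / RQ n I J) \<longlonglongrightarrow> 0"
    by blast
  define q where "q = s powr (- (1 - \<epsilon>))"
  have q: "0 < q" "q < \<theta>"
    using s \<epsilon>(1) by (auto simp: q_def)
  have sq: "s powr ((1 - \<epsilon>) * real n) = 1 / q ^ n" for n
  proof -
    have "q ^ n = s powr (- (1 - \<epsilon>) * real n)"
      using s by (simp add: q_def powr_powr[symmetric] powr_realpow)
    moreover have "s powr ((1 - \<epsilon>) * real n) * s powr (- (1 - \<epsilon>) * real n) = 1"
      using s by (simp add: powr_add[symmetric] algebra_simps)
    ultimately have "s powr ((1 - \<epsilon>) * real n) * q ^ n = 1"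
      by (simp only:)
    then show ?thesis
      using q(1) by (intro eq_divide_imp) simp_all
  qed
  have fin: "finite (V0 // r)"
    using finite_V0 finite_quotient r by (metis equiv_type)
  have ev: "\<forall>\<^sub>F n in sequentially. I \<noteq> J \<longrightarrow> enn2real (1 / RQ n I J) \<le> q ^ n"
    if "I \<in> V0 // r" "J \<in> V0 // r" for I J
  proof (cases "I = J")
    case False
    have "\<forall>\<^sub>F n in sequentially. ennreal (s powr ((1 - \<epsilon>) * real n)) / RQ n I J < 1"
      using \<epsilon>(2)[OF that False] by (rule order_tendstoD) simp
    then show ?thesis
    proof eventually_elim
      fix n assume "ennreal (s powr ((1 - \<epsilon>) * real n)) / RQ n I J < 1"
      then have "ennreal (1 / q ^ n) * inverse (RQ n I J) \<le> 1"
        by (simp add: sq divide_ennreal_def)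
      then have "ennreal (q ^ n) * (ennreal (1 / q ^ n) * inverse (RQ n I J)) \<le> ennreal (q ^ n) * 1"
        by (rule mult_left_mono) simp
      moreover have "ennreal (q ^ n) * ennreal (1 / q ^ n) = 1"
        using q by (simp add: ennreal_mult[symmetric])
      ultimately have "1 / RQ n I J \<le> ennreal (q ^ n)"
        by (simp add: mult.assoc[symmetric] divide_ennreal_def)
      then have "enn2real (1 / RQ n I J) \<le> q ^ n"
        using q by (intro enn2real_leI) auto
      then show "I \<noteq> J \<longrightarrow> enn2real (1 / RQ n I J) \<le> q ^ n" by simp
    qed
  qed simp
  have "\<forall>\<^sub>F n in sequentially. \<forall>I\<in>V0 // r. \<forall>J\<in>V0 // r. I \<noteq> J \<longrightarrow> enn2real (1 / RQ n I J) \<le> q ^ n"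
    using fin ev by (simp add: eventually_ball_finite_distrib)
  moreover have "\<forall>\<^sub>F n in sequentially. real (card (V0 // r)) ^ 2 * (q / \<theta>) ^ n < 1"
  proof -
    have "(\<lambda>n. real (card (V0 // r)) ^ 2 * (q / \<theta>) ^ n) \<longlonglongrightarrow> real (card (V0 // r)) ^ 2 * 0"
      using q \<theta>0 by (intro tendsto_mult_left LIMSEQ_realpow_zero) auto
    then show ?thesis
      by (rule order_tendstoD) simp
  qed
  moreover have "\<forall>\<^sub>F n::nat in sequentially. 0 < n"
    by (rule eventually_gt_at_top)
  ultimately have "\<forall>\<^sub>F n in sequentially.
      (\<forall>I\<in>V0 // r. \<forall>J\<in>V0 // r. I \<noteq> J \<longrightarrow> enn2real (1 / RQ n I J) \<le> q ^ n) \<and>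
      real (card (V0 // r)) ^ 2 * (q / \<theta>) ^ n < 1 \<and> 0 < n"
    by eventually_elim simp
  from eventually_happens'[OF sequentially_bot this] obtain m where m: "0 < m" "real (card (V0 // r)) ^ 2 * (q / \<theta>) ^ m < 1"
      "\<And>I J. I \<in> V0 // r \<Longrightarrow> J \<in> V0 // r \<Longrightarrow> I \<noteq> J \<Longrightarrow> enn2real (1 / RQ m I J) \<le> q ^ m"
    by blast
  have le: "real (card (V0 // r)) ^ 2 * q ^ m \<le> \<theta> ^ m"
    using m(2) \<theta>0 by (simp add: power_divide field_simps)
  show ?thesis
  proof (rule that[OF m(1)])
    fix f assume f: "invariant r f"
    have qm: "0 \<le> q ^ m"
      using q by simp
    obtain v where v: "\<And>p. p \<in> V0 \<Longrightarrow> v p = f p"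
        "\<And>w. w \<in> fin_words N m \<Longrightarrow> invariant r (\<lambda>x. v (foldr F w x))"
        "energy N F V0 m v \<le> real (card (V0 // r)) ^ 2 * q ^ m * edge_energy f"
      using quotient_extension[OF r qtrace qm m(3) f] by blast
    have "energy N F V0 m v \<le> \<theta> ^ m * edge_energy f"
      using v(3) mult_right_mono[OF le edge_energy_nonneg[of f]] by linarith
    then show "\<exists>v. (\<forall>p\<in>V0. v p = f p) \<and>
        (\<forall>w\<in>fin_words N m. invariant r (\<lambda>x. v (foldr F w x))) \<and>
        energy N F V0 m v \<le> \<theta> ^ m * edge_energy f"
      using v by blast
  qed
qed

end

section \<open>Iterated extension\<close>

lemma geometric_increments:
  fixes a :: "nat \<Rightarrow> real"
  assumes "\<And>k. \<bar>a (Suc k) - a k\<bar> \<le> C * s ^ k" and s: "0 \<le> s" "s < 1"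
  shows "convergent a" and "\<bar>lim a - a 0\<bar> \<le> C / (1 - s)"
proof -
  define d where "d k = a (Suc k) - a k" for k
  have geo: "summable (\<lambda>k. C * s ^ k)"
    using s by (intro summable_mult summable_geometric) simp
  have d: "norm (d k) \<le> C * s ^ k" for k
    using assms(1) by (simp add: d_def)
  have sum_d: "summable d"
    by (rule summable_comparison_test'[OF geo]) (rule d)
  have "(\<lambda>n. \<Sum>k<n. d k) \<longlonglongrightarrow> suminf d"
    using sum_d by (rule summable_LIMSEQ)
  then have "(\<lambda>n. a n - a 0) \<longlonglongrightarrow> suminf d"
    by (simp add: d_def sum_lessThan_telescope)
  then have lim: "a \<longlonglongrightarrow> suminf d + a 0"
    using tendsto_add[OF _ tendsto_const[of "a 0"]] by fastforce
  then show "convergent a"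
    by (rule convergentI)
  have "norm (suminf d) \<le> (\<Sum>k. C * s ^ k)"
    by (rule norm_suminf_le[OF d geo])
  also have "\<dots> = C / (1 - s)"
    using s by (simp add: suminf_mult suminf_geometric summable_geometric)
  finally show "\<bar>lim a - a 0\<bar> \<le> C / (1 - s)"
    using limI[OF lim] by simp
qed

text \<open>
  An extension operator \<open>ext\<close> from \<open>V\<^sub>0\<close> to \<open>V\<^sub>m\<close> that multiplies the energy by at most
  \<open>\<kappa> < 1\<close> and reproduces the class \<open>adm\<close> of admissible boundary data on every \<open>m\<close>-cell can
  be iterated inside the cells.
\<close>

locale energy_extension = pcf_homotheties +
  fixes adm :: "('a \<Rightarrow> real) \<Rightarrow> bool" and m :: nat and \<kappa> :: real
    and ext :: "('a \<Rightarrow> real) \<Rightarrow> 'a \<Rightarrow> real" and f0 :: "'a \<Rightarrow> real"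
  assumes m_pos: "0 < m" and kappa_pos: "0 < \<kappa>" and kappa_less: "\<kappa> < 1"
    and ext_V0: "adm f \<Longrightarrow> p \<in> V0 \<Longrightarrow> ext f p = f p"
    and ext_adm: "adm f \<Longrightarrow> w \<in> fin_words N m \<Longrightarrow> adm (\<lambda>x. ext f (foldr F w x))"
    and ext_energy: "adm f \<Longrightarrow> energy N F V0 m (ext f) \<le> \<kappa> * edge_energy f"
    and adm_f0: "adm f0"
begin

text \<open>
  The boundary values on the cell of a word of length \<open>k * m\<close>. The last \<open>m\<close> letters say where
  to restrict the extension that was constructed on the cell of the remaining letters.
\<close>

primrec cell_data :: "nat \<Rightarrow> nat list \<Rightarrow> 'a \<Rightarrow> real" where
  "cell_data 0 w = f0"
| "cell_data (Suc k) w =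
    (\<lambda>x. ext (cell_data k (take (k * m) w)) (foldr F (drop (k * m) w) x))"

lemma cell_data_append:
  "v \<in> fin_words N (k * m) \<Longrightarrow> cell_data (Suc k) (v @ w) = (\<lambda>x. ext (cell_data k v) (foldr F w x))"
  by (simp add: fin_words_def)

lemma fin_words_blockE:
  assumes "w \<in> fin_words N (Suc k * m)"
  obtains v v' where "w = v @ v'" "v \<in> fin_words N (k * m)" "v' \<in> fin_words N m"
proof -
  have "w \<in> fin_words N (k * m + m)"
    using assms by (simp add: add.commute)
  from take_drop_in_fin_words[OF this] that show ?thesis
    by (metis append_take_drop_id)
qed

lemma adm_cell_data: "w \<in> fin_words N (k * m) \<Longrightarrow> adm (cell_data k w)"
proof (induction k arbitrary: w)
  case (Suc k)
  from Suc.prems obtain v v' where "w = v @ v'" "v \<in> fin_words N (k * m)" "v' \<in> fin_words N m"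
    by (rule fin_words_blockE)
  then show ?case
    using Suc.IH ext_adm by (simp only: cell_data_append)
qed (simp add: adm_f0)

lemma cell_data_energy_step:
  assumes "v \<in> fin_words N (k * m)" "w \<in> fin_words N m"
  shows "edge_energy (cell_data (Suc k) (v @ w)) \<le> \<kappa> * edge_energy (cell_data k v)"
  unfolding cell_data_append[OF assms(1)]
  using edge_energy_cell_le[OF assms(2), of "ext (cell_data k v)"] ext_energy[OF adm_cell_data[OF assms(1)]]
  by linarith

lemma sum_cell_data_energy:
  "(\<Sum>w\<in>fin_words N (k * m). edge_energy (cell_data k w)) \<le> \<kappa> ^ k * edge_energy f0"
proof (induction k)
  case (Suc k)
  have "(\<Sum>w\<in>fin_words N (Suc k * m). edge_energy (cell_data (Suc k) w))
      = (\<Sum>w\<in>fin_words N (k * m + m). edge_energy (cell_data (Suc k) w))"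
    by (simp only: mult_Suc add.commute)
  also have "\<dots> = (\<Sum>v\<in>fin_words N (k * m). \<Sum>w\<in>fin_words N m. edge_energy (cell_data (Suc k) (v @ w)))"
    by (rule sum_fin_words_append)
  also have "\<dots> = (\<Sum>v\<in>fin_words N (k * m). energy N F V0 m (ext (cell_data k v)))"
    by (intro sum.cong refl) (simp only: cell_data_append energy_eq)
  also have "\<dots> \<le> (\<Sum>v\<in>fin_words N (k * m). \<kappa> * edge_energy (cell_data k v))"
    by (intro sum_mono ext_energy adm_cell_data)
  also have "\<dots> \<le> \<kappa> * (\<kappa> ^ k * edge_energy f0)"
    using Suc kappa_pos by (simp add: sum_distrib_left[symmetric])
  finally show ?case by simp
qed simp

lemma cell_data_energy_le:
  assumes "w \<in> fin_words N (k * m)"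
  shows "edge_energy (cell_data k w) \<le> \<kappa> ^ k * edge_energy f0"
proof -
  have "edge_energy (cell_data k w) \<le> (\<Sum>w\<in>fin_words N (k * m). edge_energy (cell_data k w))"
    using assms edge_energy_nonneg by (intro member_le_sum) auto
  then show ?thesis
    using sum_cell_data_energy[of k] by linarith
qed

lemma diff_le_sqrt_edge_energy: "p \<in> V0 \<Longrightarrow> q \<in> V0 \<Longrightarrow> \<bar>f p - f q\<bar> \<le> sqrt (edge_energy f)"
  using diff_le_edge_energy by (intro real_le_rsqrt) auto

text \<open>
  Two distinct cells share only images of boundary points, where \<open>ext\<close> leaves the previous
  values unchanged; so the data on different cells agree wherever the cells meet.
\<close>

lemma cell_data_consistent:
  assumes "w \<in> fin_words N (k * m)" "w' \<in> fin_words N (k * m)" "p \<in> V0" "q \<in> V0"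
    and "foldr F w p = foldr F w' q"
  shows "cell_data k w p = cell_data k w' q"
  using assms
proof (induction k arbitrary: w w' p q)
  case (Suc k)
  obtain v a where w: "w = v @ a" "v \<in> fin_words N (k * m)" "a \<in> fin_words N m"
    using Suc.prems(1) by (rule fin_words_blockE)
  obtain v' a' where w': "w' = v' @ a'" "v' \<in> fin_words N (k * m)" "a' \<in> fin_words N m"
    using Suc.prems(2) by (rule fin_words_blockE)
  let ?x = "foldr F a p" and ?x' = "foldr F a' q"
  have eq: "foldr F v ?x = foldr F v' ?x'"
    using Suc.prems(5) w(1) w'(1) by simp
  have xK: "?x \<in> K" "?x' \<in> K"
    using cell_map_in_K w(3) w'(3) Suc.prems(3,4) V0_in_K by blast+
  have "ext (cell_data k v) ?x = ext (cell_data k v') ?x'"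
  proof (cases "v = v'")
    case True
    then show ?thesis
      using eq cell_map_eq_iff[OF w(2)] by simp
  next
    case False
    obtain p' q' where pq: "p' \<in> V0" "q' \<in> V0" "foldr F v ?x = foldr F v p'" "foldr F v ?x = foldr F v' q'"
      using meeting_cells_vertexE[OF w(2) w'(2) _ _ False, of "foldr F v ?x"] eq xK by (metis imageI)
    have "?x = p'"
      using pq(3) cell_map_eq_iff[OF w(2)] by simp
    moreover have "?x' = q'"
      using pq(4) eq cell_map_eq_iff[OF w'(2)] by simp
    ultimately show ?thesis
      using Suc.IH[OF w(2) w'(2) pq(1,2)] pq ext_V0 adm_cell_data w(2) w'(2) by simp
  qed
  then show ?case
    using w w' by (simp only: cell_data_append)
qed simp

lemma cell_data_meets:
  assumes w: "w \<in> fin_words N (k * m)" "w' \<in> fin_words N (k * m)" "meets w w'"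
    and pq: "p \<in> V0" "q \<in> V0"
  shows "\<bar>cell_data k w p - cell_data k w' q\<bar>
    \<le> sqrt (edge_energy (cell_data k w)) + sqrt (edge_energy (cell_data k w'))"
proof (cases "w = w'")
  case True
  then show ?thesis
    using diff_le_sqrt_edge_energy[OF pq, of "cell_data k w"] edge_energy_nonneg[of "cell_data k w"]
    by simp
next
  case False
  obtain x where "x \<in> foldr F w ` K" "x \<in> foldr F w' ` K"
    using w(3) by (auto simp: meets_def)
  then obtain p' q' where p'q': "p' \<in> V0" "q' \<in> V0" "x = foldr F w p'" "x = foldr F w' q'"
    using meeting_cells_vertexE[OF w(1,2) _ _ False] by metis
  have "cell_data k w p' = cell_data k w' q'"
    using cell_data_consistent[OF w(1,2) p'q'(1,2)] p'q'(3,4) by simp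
  then show ?thesis
    using diff_le_sqrt_edge_energy[OF pq(1) p'q'(1), of "cell_data k w"]
      diff_le_sqrt_edge_energy[OF p'q'(2) pq(2), of "cell_data k w'"] by linarith
qed

text \<open>
  Along a coding of a point of \<open>K\<close> the cell data settle down geometrically; the limit is the value
  of the extended function at that point.
\<close>

definition data_along :: "(nat \<Rightarrow> nat) \<Rightarrow> nat \<Rightarrow> real" where
  "data_along \<eta> k = cell_data k (map \<eta> [0..<k * m]) (SOME p. p \<in> V0)"

definition extension :: "'a \<Rightarrow> real" where
  "extension x = (if x \<in> K then lim (data_along (SOME \<eta>. \<eta> \<in> inf_words N \<and> coding F K \<eta> = x)) else 0)"

lemma data_along_limit:
  obtains B where "0 \<le> B" "\<And>\<eta>. \<eta> \<in> inf_words N \<Longrightarrow> data_along \<eta> \<longlonglongrightarrow> lim (data_along \<eta>)"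
    "\<And>\<eta> j p. \<eta> \<in> inf_words N \<Longrightarrow> p \<in> V0 \<Longrightarrow>
      \<bar>lim (data_along \<eta>) - cell_data j (map \<eta> [0..<j * m]) p\<bar>
        \<le> B * sqrt (edge_energy (cell_data j (map \<eta> [0..<j * m])))"
proof -
  obtain L where L: "0 \<le> L" "\<And>(f :: 'a \<Rightarrow> real) M x y. (\<And>w p q. w \<in> fin_words N m \<Longrightarrow>
        p \<in> V0 \<Longrightarrow> q \<in> V0 \<Longrightarrow> \<bar>f (foldr F w p) - f (foldr F w q)\<bar> \<le> M) \<Longrightarrow>
      x \<in> vertices N F V0 m \<Longrightarrow> y \<in> vertices N F V0 m \<Longrightarrow> \<bar>f x - f y\<bar> \<le> L * M"
    using vertices_oscillation[of m] by metis
  have step: "\<bar>cell_data (Suc k) (v @ w) p - cell_data k v q\<bar> \<le> L * sqrt (edge_energy (cell_data k v))"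
    if v: "v \<in> fin_words N (k * m)" and w: "w \<in> fin_words N m" and pq: "p \<in> V0" "q \<in> V0" for k v w p q
  proof -
    let ?f = "ext (cell_data k v)"
    have adm: "adm (cell_data k v)"
      by (rule adm_cell_data[OF v])
    have "\<bar>?f (foldr F w p) - ?f q\<bar> \<le> L * sqrt (edge_energy (cell_data k v))"
    proof (rule L(2))
      show "foldr F w p \<in> vertices N F V0 m" "q \<in> vertices N F V0 m"
        using w pq V0_subset_vertices by (auto simp: vertices_eq)
      fix w' p' q' assume *: "w' \<in> fin_words N m" "p' \<in> V0" "q' \<in> V0"
      have "\<bar>?f (foldr F w' p') - ?f (foldr F w' q')\<bar> \<le> sqrt (edge_energy (\<lambda>x. ?f (foldr F w' x)))"
        using diff_le_sqrt_edge_energy[OF *(2,3), of "\<lambda>x. ?f (foldr F w' x)"] .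
      also have "\<dots> \<le> sqrt (edge_energy (cell_data k v))"
      proof (rule real_sqrt_le_mono)
        have "edge_energy (\<lambda>x. ?f (foldr F w' x)) \<le> \<kappa> * edge_energy (cell_data k v)"
          using edge_energy_cell_le[OF *(1), of ?f] ext_energy[OF adm] by linarith
        also have "\<dots> \<le> 1 * edge_energy (cell_data k v)"
          using kappa_less edge_energy_nonneg by (intro mult_right_mono) auto
        finally show "edge_energy (\<lambda>x. ?f (foldr F w' x)) \<le> edge_energy (cell_data k v)" by simp
      qed
      finally show "\<bar>?f (foldr F w' p') - ?f (foldr F w' q')\<bar> \<le> sqrt (edge_energy (cell_data k v))" .
    qed
    then show ?thesis
      using ext_V0[OF adm pq(2)] by (simp only: cell_data_append[OF v])
  qed
  define p0 where "p0 = (SOME p. p \<in> V0)"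
  have p0: "p0 \<in> V0"
    using V0_nonempty some_in_eq unfolding p0_def by blast
  define s where "s = sqrt \<kappa>"
  have s: "0 \<le> s" "s < 1"
    using kappa_pos kappa_less by (auto simp: s_def)
  have tail: "convergent (\<lambda>k. data_along \<eta> (j + k)) \<and>
      \<bar>lim (\<lambda>k. data_along \<eta> (j + k)) - data_along \<eta> j\<bar>
        \<le> L * sqrt (edge_energy (cell_data j (map \<eta> [0..<j * m]))) / (1 - s)"
    if \<eta>: "\<eta> \<in> inf_words N" for \<eta> j
  proof -
    let ?w = "\<lambda>k. map \<eta> [0..<k * m]"
    let ?e = "\<lambda>k. edge_energy (cell_data k (?w k))"
    have w: "?w k \<in> fin_words N (k * m)" for k
      using \<eta> by (rule map_prefix_in_fin_words)
    define b where "b k = map ((shift ^^ (k * m)) \<eta>) [0..<m]" for k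
    have b: "b k \<in> fin_words N m" for k
      unfolding b_def by (rule map_prefix_in_fin_words[OF shift_in_inf_words[OF \<eta>]])
    have w_Suc: "?w (Suc k) = ?w k @ b k" for k
      using map_prefix_add[of \<eta> "k * m" m] by (simp only: mult_Suc add.commute b_def)
    have e_Suc: "?e (Suc k) \<le> \<kappa> * ?e k" for k
      unfolding w_Suc by (rule cell_data_energy_step[OF w b])
    have e: "sqrt (?e (j + k)) \<le> s ^ k * sqrt (?e j)" for k
    proof (induction k)
      case (Suc k)
      have "sqrt (?e (Suc (j + k))) \<le> sqrt (\<kappa> * ?e (j + k))"
        using e_Suc by (rule real_sqrt_le_mono)
      also have "\<dots> = s * sqrt (?e (j + k))"
        by (simp add: real_sqrt_mult s_def)
      also have "\<dots> \<le> s * (s ^ k * sqrt (?e j))"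
        using Suc s by (intro mult_left_mono) auto
      finally show ?case by simp
    qed simp
    have "\<bar>data_along \<eta> (Suc k) - data_along \<eta> k\<bar> \<le> L * sqrt (?e k)" for k
      unfolding data_along_def w_Suc p0_def[symmetric] by (rule step[OF w b p0 p0])
    then have "\<bar>data_along \<eta> (j + Suc k) - data_along \<eta> (j + k)\<bar> \<le> L * sqrt (?e j) * s ^ k" for k
    proof -
      have "\<bar>data_along \<eta> (Suc (j + k)) - data_along \<eta> (j + k)\<bar> \<le> L * sqrt (?e (j + k))"
        by fact
      also have "\<dots> \<le> L * (s ^ k * sqrt (?e j))"
        by (rule mult_left_mono[OF e L(1)])
      finally show ?thesis
        by (simp add: mult_ac)
    qed
    from geometric_increments[of "\<lambda>k. data_along \<eta> (j + k)", OF this s] show ?thesis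
      by simp
  qed
  have lim: "data_along \<eta> \<longlonglongrightarrow> lim (data_along \<eta>)" if \<eta>: "\<eta> \<in> inf_words N" for \<eta>
    using tail[OF \<eta>, of 0] by (simp add: convergent_LIMSEQ_iff)
  have "\<bar>lim (data_along \<eta>) - cell_data j (map \<eta> [0..<j * m]) p\<bar>
      \<le> (L / (1 - s) + 1) * sqrt (edge_energy (cell_data j (map \<eta> [0..<j * m])))"
    if \<eta>: "\<eta> \<in> inf_words N" and p: "p \<in> V0" for \<eta> j p
  proof -
    have "(\<lambda>k. data_along \<eta> (j + k)) \<longlonglongrightarrow> lim (data_along \<eta>)"
      using LIMSEQ_ignore_initial_segment[OF lim[OF \<eta>], of j] by (simp add: add.commute)
    then have "lim (\<lambda>k. data_along \<eta> (j + k)) = lim (data_along \<eta>)"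
      by (rule limI)
    then have "\<bar>lim (data_along \<eta>) - data_along \<eta> j\<bar>
        \<le> L / (1 - s) * sqrt (edge_energy (cell_data j (map \<eta> [0..<j * m])))"
      using tail[OF \<eta>, of j] by simp
    moreover have "\<bar>data_along \<eta> j - cell_data j (map \<eta> [0..<j * m]) p\<bar>
        \<le> sqrt (edge_energy (cell_data j (map \<eta> [0..<j * m])))"
      unfolding data_along_def p0_def[symmetric] by (rule diff_le_sqrt_edge_energy[OF p0 p])
    ultimately show ?thesis
      by (simp add: distrib_right)
  qed
  moreover have "0 \<le> L / (1 - s) + 1"
    using L s by simp
  ultimately show ?thesis
    using that[of "L / (1 - s) + 1"] lim by blast
qed

lemma sqrt_cell_data_energy_tendsto: "(\<lambda>k. B * sqrt (\<kappa> ^ k * edge_energy f0)) \<longlonglongrightarrow> 0"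
proof -
  have "(\<lambda>k. B * sqrt (\<kappa> ^ k * edge_energy f0)) \<longlonglongrightarrow> B * sqrt (0 * edge_energy f0)"
    using kappa_pos kappa_less by (intro tendsto_intros LIMSEQ_realpow_zero) auto
  then show ?thesis by simp
qed

lemma zero_if_le_cell_data_energy:
  assumes "\<And>k. \<bar>x\<bar> \<le> B * sqrt (\<kappa> ^ k * edge_energy f0)" shows "x = 0"
proof -
  have "\<bar>x\<bar> \<le> 0"
    using assms by (intro LIMSEQ_le_const[OF sqrt_cell_data_energy_tendsto[of B]]) auto
  then show ?thesis by simp
qed

text \<open>
  Prefixes of two codings of the same point give cells that meet, and the data on such cells differ by at most
  the sum of the square roots of their energies, which tends to \<open>0\<close>.
\<close>

lemma extension_coding:
  assumes \<eta>: "\<eta> \<in> inf_words N"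
  shows "extension (coding F K \<eta>) = lim (data_along \<eta>)"
proof -
  define x where "x = coding F K \<eta>"
  define \<xi> where "\<xi> = (SOME \<xi>. \<xi> \<in> inf_words N \<and> coding F K \<xi> = x)"
  have "\<exists>\<xi>. \<xi> \<in> inf_words N \<and> coding F K \<xi> = x"
    using \<eta> x_def by blast
  then have \<xi>: "\<xi> \<in> inf_words N" "coding F K \<xi> = x"
    unfolding \<xi>_def by (metis (mono_tags, lifting) someI_ex)+
  obtain B where B: "0 \<le> B" "\<And>\<eta> j p. \<eta> \<in> inf_words N \<Longrightarrow> p \<in> V0 \<Longrightarrow>
      \<bar>lim (data_along \<eta>) - cell_data j (map \<eta> [0..<j * m]) p\<bar>
        \<le> B * sqrt (edge_energy (cell_data j (map \<eta> [0..<j * m])))"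
    using data_along_limit by metis
  obtain p where p: "p \<in> V0"
    using V0_nonempty by blast
  have "lim (data_along \<xi>) - lim (data_along \<eta>) = 0"
  proof (rule zero_if_le_cell_data_energy[of _ "2 * B + 2"])
    fix k
    let ?w = "map \<eta> [0..<k * m]" and ?w' = "map \<xi> [0..<k * m]"
    let ?s = "sqrt (\<kappa> ^ k * edge_energy f0)"
    have w: "?w \<in> fin_words N (k * m)" "?w' \<in> fin_words N (k * m)"
      using \<eta> \<xi>(1) map_prefix_in_fin_words by blast+
    have "x \<in> foldr F ?w ` K" "x \<in> foldr F ?w' ` K"
      using coding_in_cell[OF \<eta>] coding_in_cell[OF \<xi>(1)] unfolding \<xi>(2) x_def[symmetric] by blast+
    then have "meets ?w ?w'"
      unfolding meets_def by blast
    note mts = cell_data_meets[OF w this p p]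
    have s: "sqrt (edge_energy (cell_data k ?w)) \<le> ?s" "sqrt (edge_energy (cell_data k ?w')) \<le> ?s"
      using cell_data_energy_le w by auto
    have "B * sqrt (edge_energy (cell_data k ?w)) \<le> B * ?s" "B * sqrt (edge_energy (cell_data k ?w')) \<le> B * ?s"
      using s B(1) by (auto intro: mult_left_mono)
    then have "\<bar>lim (data_along \<xi>) - lim (data_along \<eta>)\<bar> \<le> 2 * (B * ?s) + 2 * ?s"
      using mts s B(2)[OF \<eta> p, of k] B(2)[OF \<xi>(1) p, of k] by linarith
    then show "\<bar>lim (data_along \<xi>) - lim (data_along \<eta>)\<bar> \<le> (2 * B + 2) * ?s"
      by (simp add: algebra_simps)
  qed
  then show ?thesis
    using coding_in_K[OF \<eta>] unfolding extension_def x_def[symmetric] \<xi>_def[symmetric] by simp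
qed

lemma extension_cell:
  obtains B where "0 \<le> B" "\<And>k w x p. w \<in> fin_words N (k * m) \<Longrightarrow> x \<in> K \<Longrightarrow> p \<in> V0 \<Longrightarrow>
      \<bar>extension (foldr F w x) - cell_data k w p\<bar> \<le> B * sqrt (edge_energy (cell_data k w))"
proof -
  obtain B where B: "0 \<le> B" "\<And>\<eta> j p. \<eta> \<in> inf_words N \<Longrightarrow> p \<in> V0 \<Longrightarrow>
      \<bar>lim (data_along \<eta>) - cell_data j (map \<eta> [0..<j * m]) p\<bar>
        \<le> B * sqrt (edge_energy (cell_data j (map \<eta> [0..<j * m])))"
    using data_along_limit by metis
  have "\<bar>extension (foldr F w x) - cell_data k w p\<bar> \<le> B * sqrt (edge_energy (cell_data k w))"
    if w: "w \<in> fin_words N (k * m)" and x: "x \<in> K" and p: "p \<in> V0" for k w x p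
  proof -
    obtain \<eta> where \<eta>: "\<eta> \<in> inf_words N" "coding F K \<eta> = x"
      using coding_surj[OF x] by blast
    have lw: "length w = k * m"
      using w by (simp add: fin_words_def)
    have "map (prepend w \<eta>) [0..<k * m] = w"
      using map_prepend_prefix[of w \<eta> 0] lw by simp
    moreover have "extension (foldr F w x) = lim (data_along (prepend w \<eta>))"
      using extension_coding[OF prepend_in_inf_words[OF w \<eta>(1)]] coding_prepend[OF w \<eta>(1)] \<eta>(2) by simp
    ultimately show ?thesis
      using B(2)[OF prepend_in_inf_words[OF w \<eta>(1)] p, of k] by simp
  qed
  then show ?thesis
    using that B(1) by blast
qed

text \<open>
  A boundary point has a coding whose shifts all stay post-critical. Along it the point is a vertex of every
  cell, and \<open>ext\<close> never changes the value there.
\<close>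

lemma extension_V0:
  assumes p: "p \<in> V0" shows "extension p = f0 p"
proof -
  obtain B where B: "0 \<le> B" "\<And>k w x p. w \<in> fin_words N (k * m) \<Longrightarrow> x \<in> K \<Longrightarrow> p \<in> V0 \<Longrightarrow>
      \<bar>extension (foldr F w x) - cell_data k w p\<bar> \<le> B * sqrt (edge_energy (cell_data k w))"
    using extension_cell by metis
  obtain \<eta> where \<eta>: "\<eta> \<in> inf_words N" "\<And>n. coding F K ((shift ^^ n) \<eta>) \<in> V0"
      "\<And>n. p = foldr F (map \<eta> [0..<n]) (coding F K ((shift ^^ n) \<eta>))"
    using V0_codingE[OF p] by metis
  define w where "w k = map \<eta> [0..<k * m]" for k
  define q where "q k = coding F K ((shift ^^ (k * m)) \<eta>)" for k
  have w: "w k \<in> fin_words N (k * m)" for k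
    unfolding w_def by (rule map_prefix_in_fin_words[OF \<eta>(1)])
  have q: "q k \<in> V0" "p = foldr F (w k) (q k)" for k
    using \<eta>(2,3) by (auto simp: q_def w_def)
  have data: "cell_data k (w k) (q k) = f0 p" for k
  proof (induction k)
    case 0
    show ?case using q(2)[of 0] by (simp add: w_def)
  next
    case (Suc k)
    define b where "b = map ((shift ^^ (k * m)) \<eta>) [0..<m]"
    have w_Suc: "w (Suc k) = w k @ b"
      using map_prefix_add[of \<eta> "k * m" m] by (simp only: w_def mult_Suc add.commute b_def)
    have "foldr F (w k) (foldr F b (q (Suc k))) = foldr F (w k) (q k)"
      using q(2)[of k] q(2)[of "Suc k"] w_Suc by simp
    then have "foldr F b (q (Suc k)) = q k"
      using cell_map_eq_iff[OF w] by simp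
    then have "cell_data (Suc k) (w (Suc k)) (q (Suc k)) = ext (cell_data k (w k)) (q k)"
      unfolding w_Suc cell_data_append[OF w] by simp
    also have "\<dots> = cell_data k (w k) (q k)"
      by (rule ext_V0[OF adm_cell_data[OF w] q(1)])
    finally show ?case using Suc by simp
  qed
  have "\<bar>extension p - f0 p\<bar> \<le> B * sqrt (edge_energy (cell_data k (w k)))" for k
    using B(2)[OF w V0_in_K[OF q(1)] q(1), of k k k] unfolding data q(2)[of k, symmetric] .
  moreover have "B * sqrt (edge_energy (cell_data k (w k))) \<le> B * sqrt (\<kappa> ^ k * edge_energy f0)" for k
    using B(1) cell_data_energy_le[OF w] by (intro mult_left_mono) auto
  ultimately have "extension p - f0 p = 0"
    by (intro zero_if_le_cell_data_energy[of _ B]) (meson order_trans)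
  then show ?thesis by simp
qed

lemma extension_meets:
  obtains B where "0 \<le> B" "\<And>k w w' x y. w \<in> fin_words N (k * m) \<Longrightarrow> w' \<in> fin_words N (k * m) \<Longrightarrow>
      meets w w' \<Longrightarrow> x \<in> K \<Longrightarrow> y \<in> K \<Longrightarrow>
      \<bar>extension (foldr F w x) - extension (foldr F w' y)\<bar>
        \<le> B * (sqrt (edge_energy (cell_data k w)) + sqrt (edge_energy (cell_data k w')))"
proof -
  obtain B where B: "0 \<le> B" "\<And>k w x p. w \<in> fin_words N (k * m) \<Longrightarrow> x \<in> K \<Longrightarrow> p \<in> V0 \<Longrightarrow>
      \<bar>extension (foldr F w x) - cell_data k w p\<bar> \<le> B * sqrt (edge_energy (cell_data k w))"
    using extension_cell by metis
  obtain p where p: "p \<in> V0"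
    using V0_nonempty by blast
  have "\<bar>extension (foldr F w x) - extension (foldr F w' y)\<bar>
      \<le> (B + 1) * (sqrt (edge_energy (cell_data k w)) + sqrt (edge_energy (cell_data k w')))"
    if "w \<in> fin_words N (k * m)" "w' \<in> fin_words N (k * m)" "meets w w'" "x \<in> K" "y \<in> K" for k w w' x y
    using cell_data_meets[OF that(1-3) p p] B(2)[OF that(1,4) p] B(2)[OF that(2,5) p]
    by (simp add: algebra_simps)
  then show ?thesis
    using that[of "B + 1"] B(1) by auto
qed

text \<open>
  Points at small distance lie in meeting cells, by \<open>separation\<close>.
\<close>

lemma continuous_on_extension: "continuous_on K extension"
proof -
  obtain B where B: "0 \<le> B" "\<And>k w w' x y. w \<in> fin_words N (k * m) \<Longrightarrow> w' \<in> fin_words N (k * m) \<Longrightarrow>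
      meets w w' \<Longrightarrow> x \<in> K \<Longrightarrow> y \<in> K \<Longrightarrow>
      \<bar>extension (foldr F w x) - extension (foldr F w' y)\<bar>
        \<le> B * (sqrt (edge_energy (cell_data k w)) + sqrt (edge_energy (cell_data k w')))"
    using extension_meets by metis
  obtain \<delta> where \<delta>: "0 < \<delta>" "\<And>n w w' x y. w \<in> fin_words N n \<Longrightarrow> w' \<in> fin_words N n \<Longrightarrow>
       x \<in> foldr F w ` K \<Longrightarrow> y \<in> foldr F w' ` K \<Longrightarrow> dist x y < \<delta> * \<rho> ^ n \<Longrightarrow> meets w w'"
    using separation by metis
  show ?thesis
    unfolding continuous_on_iff
  proof (intro ballI allI impI)
    fix x and e :: real assume x: "x \<in> K" and "0 < e"
    have "\<forall>\<^sub>F k in sequentially. 2 * B * sqrt (\<kappa> ^ k * edge_energy f0) < e"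
      using sqrt_cell_data_energy_tendsto \<open>0 < e\<close> by (rule order_tendstoD)
    then obtain k where k: "2 * B * sqrt (\<kappa> ^ k * edge_energy f0) < e"
      using eventually_happens[of _ sequentially] by auto
    have "dist (extension y) (extension x) < e" if y: "y \<in> K" "dist y x < \<delta> * \<rho> ^ (k * m)" for y
    proof -
      obtain w a where w: "w \<in> fin_words N (k * m)" "a \<in> K" "y = foldr F w a"
        using in_cellE[OF y(1)] by metis
      obtain w' a' where w': "w' \<in> fin_words N (k * m)" "a' \<in> K" "x = foldr F w' a'"
        using in_cellE[OF x] by metis
      have "meets w w'"
        using \<delta>(2)[OF w(1) w'(1)] w w' y(2) by blast
      then have "\<bar>extension y - extension x\<bar>
          \<le> B * (sqrt (edge_energy (cell_data k w)) + sqrt (edge_energy (cell_data k w')))"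
        using B(2)[OF w(1) w'(1)] w w' by blast
      also have "\<dots> \<le> B * (sqrt (\<kappa> ^ k * edge_energy f0) + sqrt (\<kappa> ^ k * edge_energy f0))"
        using B(1) cell_data_energy_le[OF w(1)] cell_data_energy_le[OF w'(1)]
        by (intro mult_left_mono add_mono) auto
      also have "\<dots> < e"
        using k by simp
      finally show ?thesis
        by (simp add: dist_real_def)
    qed
    moreover have "0 < \<delta> * \<rho> ^ (k * m)"
      using \<delta>(1) rho_pos by simp
    ultimately show "\<exists>d>0. \<forall>x'\<in>K. dist x' x < d \<longrightarrow> dist (extension x') (extension x) < e"
      by blast
  qed
qed

end

section \<open>Below the critical exponent\<close>

locale besov_extension =
  pcf_homotheties_measure N \<rho> c F K V0 \<mu> \<alpha> + energy_extension N \<rho> c F K V0 adm m \<kappa> ext f0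
  for N \<rho> and c :: "nat \<Rightarrow> 'a::euclidean_space" and F K V0 \<mu> \<alpha> adm m \<kappa> ext f0
begin

lemma extension_borel [measurable]: "extension \<in> borel_measurable borel"
proof -
  have "(\<lambda>x. indicator K x *\<^sub>R extension x) \<in> borel_measurable borel"
    by (rule borel_measurable_continuous_on_indicator[OF K_borel continuous_on_extension])
  moreover have "(\<lambda>x. indicator K x *\<^sub>R extension x) = extension"
    by (auto simp: extension_def indicator_def)
  ultimately show ?thesis by simp
qed

lemma sum_neighbours_le:
  assumes g: "\<And>w. w \<in> fin_words N n \<Longrightarrow> 0 \<le> g w"
  shows "(\<Sum>w\<in>fin_words N n. \<Sum>w'\<in>{w'\<in>fin_words N n. meets w w'}. g w + g w')
    \<le> 2 * real (card V0) ^ 2 * (\<Sum>w\<in>fin_words N n. g w)"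
proof -
  let ?W = "fin_words N n"
  have "(\<Sum>w\<in>?W. \<Sum>w'\<in>{w'\<in>?W. meets w w'}. g w') = (\<Sum>w'\<in>?W. \<Sum>w\<in>{w\<in>?W. meets w w'}. g w')"
    by (rule sum.swap_restrict) simp_all
  also have "\<dots> = (\<Sum>w\<in>?W. \<Sum>w'\<in>{w'\<in>?W. meets w w'}. g w)"
    by (simp add: meets_sym)
  finally have "(\<Sum>w\<in>?W. \<Sum>w'\<in>{w'\<in>?W. meets w w'}. g w + g w')
      = 2 * (\<Sum>w\<in>?W. \<Sum>w'\<in>{w'\<in>?W. meets w w'}. g w)"
    by (simp only: sum.distrib)
  also have "\<dots> = 2 * (\<Sum>w\<in>?W. real (card {w'\<in>?W. meets w w'}) * g w)"
    by simp
  also have "\<dots> \<le> 2 * (\<Sum>w\<in>?W. real (card V0) ^ 2 * g w)"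
  proof -
    have "real (card {w'\<in>?W. meets w w'}) \<le> real (card V0) ^ 2" if "w \<in> ?W" for w
      using card_neighbours_le[OF that] by (metis of_nat_le_iff of_nat_power)
    then show ?thesis
      using g by (intro mult_left_mono sum_mono mult_right_mono) auto
  qed
  finally show ?thesis
    by (simp only: sum_distrib_left[symmetric] mult.assoc)
qed

text \<open>
  If \<open>s\<close> does not exceed the separation of the cells of level \<open>k * m\<close>, only pairs of points in
  meeting cells contribute. (At level zero there is a single cell, and any \<open>s\<close> will do.)
\<close>

lemma extension_near_integral:
  obtains M where "0 \<le> M" "\<And>k s. (\<And>w w' x y. w \<in> fin_words N (k * m) \<Longrightarrow> w' \<in> fin_words N (k * m) \<Longrightarrow>
       x \<in> foldr F w ` K \<Longrightarrow> y \<in> foldr F w' ` K \<Longrightarrow> dist x y < s \<Longrightarrow> meets w w') \<Longrightarrow>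
    of_nat (N ^ (k * m)) ^ 2 * (\<integral>\<^sup>+x. \<integral>\<^sup>+y. near_integrand s extension x y \<partial>\<mu> \<partial>\<mu>) \<le> ennreal (M * \<kappa> ^ k)"
proof -
  obtain B where B: "0 \<le> B" "\<And>k w w' x y. w \<in> fin_words N (k * m) \<Longrightarrow> w' \<in> fin_words N (k * m) \<Longrightarrow>
      meets w w' \<Longrightarrow> x \<in> K \<Longrightarrow> y \<in> K \<Longrightarrow>
      \<bar>extension (foldr F w x) - extension (foldr F w' y)\<bar>
        \<le> B * (sqrt (edge_energy (cell_data k w)) + sqrt (edge_energy (cell_data k w')))"
    using extension_meets by metis
  define M where "M = 4 * B\<^sup>2 * real (card V0) ^ 2 * edge_energy f0"
  have "of_nat (N ^ (k * m)) ^ 2 * (\<integral>\<^sup>+x. \<integral>\<^sup>+y. near_integrand s extension x y \<partial>\<mu> \<partial>\<mu>) \<le> ennreal (M * \<kappa> ^ k)"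
    if sep: "\<And>w w' x y. w \<in> fin_words N (k * m) \<Longrightarrow> w' \<in> fin_words N (k * m) \<Longrightarrow>
       x \<in> foldr F w ` K \<Longrightarrow> y \<in> foldr F w' ` K \<Longrightarrow> dist x y < s \<Longrightarrow> meets w w'" for k s
  proof -
    let ?W = "fin_words N (k * m)"
    let ?e = "\<lambda>w. edge_energy (cell_data k w)"
    let ?b = "\<lambda>w w'. if meets w w' then ennreal (2 * B\<^sup>2 * (?e w + ?e w')) else 0"
    have bound: "near_integrand s extension (foldr F w x) (foldr F w' y) \<le> ?b w w'"
      if w: "w \<in> ?W" "w' \<in> ?W" and xy: "x \<in> K" "y \<in> K" for w w' x y
    proof (cases "dist (foldr F w x) (foldr F w' y) < s")
      case True
      then have mts: "meets w w'"
        using sep[OF w] xy by blast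
      let ?a = "sqrt (?e w)" and ?a' = "sqrt (?e w')"
      have "\<bar>extension (foldr F w x) - extension (foldr F w' y)\<bar>\<^sup>2 \<le> (B * (?a + ?a'))\<^sup>2"
        using B(2)[OF w mts xy] by (intro power_mono) auto
      also have "\<dots> \<le> B\<^sup>2 * (2 * (?a\<^sup>2 + ?a'\<^sup>2))"
      proof -
        have "(?a + ?a')\<^sup>2 \<le> 2 * (?a\<^sup>2 + ?a'\<^sup>2)"
          using zero_le_power2[of "?a - ?a'"] by (simp add: power2_sum power2_diff)
        then show ?thesis
          unfolding power_mult_distrib by (intro mult_left_mono) auto
      qed
      also have "\<dots> = 2 * B\<^sup>2 * (?e w + ?e w')"
        by (simp add: edge_energy_nonneg)
      finally show ?thesis
        using mts True xy by (auto simp: near_integrand_def intro!: ennreal_leI)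
    qed (simp add: near_integrand_def)
    have "of_nat (N ^ (k * m)) ^ 2 * (\<integral>\<^sup>+x. \<integral>\<^sup>+y. near_integrand s extension x y \<partial>\<mu> \<partial>\<mu>)
        = (\<Sum>w\<in>?W. \<Sum>w'\<in>?W. \<integral>\<^sup>+x. \<integral>\<^sup>+y. near_integrand s extension (foldr F w x) (foldr F w' y) \<partial>\<mu> \<partial>\<mu>)"
      by (rule nn_integral_cell_pairs[symmetric]) measurable
    also have "\<dots> \<le> (\<Sum>w\<in>?W. \<Sum>w'\<in>?W. ?b w w')"
    proof (intro sum_mono)
      fix w w' assume w: "w \<in> ?W" "w' \<in> ?W"
      have "(\<integral>\<^sup>+x. \<integral>\<^sup>+y. near_integrand s extension (foldr F w x) (foldr F w' y) \<partial>\<mu> \<partial>\<mu>)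
          \<le> (\<integral>\<^sup>+x. \<integral>\<^sup>+y. ?b w w' \<partial>\<mu> \<partial>\<mu>)"
      proof (rule nn_integral_mono_AE, use AE_in_K in eventually_elim)
        fix x assume x: "x \<in> K"
        show "(\<integral>\<^sup>+y. near_integrand s extension (foldr F w x) (foldr F w' y) \<partial>\<mu>) \<le> (\<integral>\<^sup>+y. ?b w w' \<partial>\<mu>)"
          by (rule nn_integral_mono_AE, use AE_in_K in eventually_elim) (rule bound[OF w x])
      qed
      then show "(\<integral>\<^sup>+x. \<integral>\<^sup>+y. near_integrand s extension (foldr F w x) (foldr F w' y) \<partial>\<mu> \<partial>\<mu>) \<le> ?b w w'"
        by (simp only: nn_integral_const emeasure_space_1 mult_1_right)
    qed
    also have "\<dots> = (\<Sum>w\<in>?W. \<Sum>w'\<in>{w'\<in>?W. meets w w'}. ennreal (2 * B\<^sup>2 * (?e w + ?e w')))"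
      by (rule sum.cong[OF refl], rule sum.inter_filter[symmetric]) simp
    also have "\<dots> = ennreal (\<Sum>w\<in>?W. \<Sum>w'\<in>{w'\<in>?W. meets w w'}. 2 * B\<^sup>2 * (?e w + ?e w'))"
      by (simp add: sum_ennreal sum_nonneg edge_energy_nonneg)
    also have "\<dots> \<le> ennreal (M * \<kappa> ^ k)"
    proof (rule ennreal_leI)
      have "(\<Sum>w\<in>?W. \<Sum>w'\<in>{w'\<in>?W. meets w w'}. 2 * B\<^sup>2 * (?e w + ?e w'))
          = 2 * B\<^sup>2 * (\<Sum>w\<in>?W. \<Sum>w'\<in>{w'\<in>?W. meets w w'}. ?e w + ?e w')"
        by (simp only: sum_distrib_left)
      also have "\<dots> \<le> 2 * B\<^sup>2 * (2 * real (card V0) ^ 2 * (\<kappa> ^ k * edge_energy f0))"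
      proof (intro mult_left_mono)
        have "(\<Sum>w\<in>?W. \<Sum>w'\<in>{w'\<in>?W. meets w w'}. ?e w + ?e w')
            \<le> 2 * real (card V0) ^ 2 * (\<Sum>w\<in>?W. ?e w)"
          by (rule sum_neighbours_le) (rule edge_energy_nonneg)
        also have "\<dots> \<le> 2 * real (card V0) ^ 2 * (\<kappa> ^ k * edge_energy f0)"
          by (intro mult_left_mono sum_cell_data_energy) simp
        finally show "(\<Sum>w\<in>?W. \<Sum>w'\<in>{w'\<in>?W. meets w w'}. ?e w + ?e w')
            \<le> 2 * real (card V0) ^ 2 * (\<kappa> ^ k * edge_energy f0)" .
      qed simp
      finally show "(\<Sum>w\<in>?W. \<Sum>w'\<in>{w'\<in>?W. meets w w'}. 2 * B\<^sup>2 * (?e w + ?e w')) \<le> M * \<kappa> ^ k"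
        by (simp add: M_def mult_ac)
    qed
    finally show ?thesis .
  qed
  moreover have "0 \<le> M"
    by (simp add: M_def edge_energy_nonneg)
  ultimately show ?thesis
    using that[of M] by blast
qed

text \<open>
  For a radius \<open>s\<close> comparable to the size of the cells of level \<open>k * m\<close>, the double integral is
  \<open>O(\<kappa>\<^sup>k N\<^bsup>-2 k m\<^esup>)\<close>; the hypothesis on \<open>\<kappa>\<close> says that this is \<open>O(s\<^bsup>\<alpha> + 2 \<sigma>\<^esup>)\<close>.
\<close>

lemma extension_in_besov_space:
  assumes \<sigma>: "0 < \<alpha> + 2 * \<sigma>" and \<kappa>: "\<kappa> \<le> (\<rho> powr (2 * \<sigma> - \<alpha>)) ^ m"
  shows "extension \<in> besov_space \<mu> K \<alpha> \<sigma>"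
proof -
  obtain \<delta> where \<delta>: "0 < \<delta>" "\<And>n w w' x y. w \<in> fin_words N n \<Longrightarrow> w' \<in> fin_words N n \<Longrightarrow>
       x \<in> foldr F w ` K \<Longrightarrow> y \<in> foldr F w' ` K \<Longrightarrow> dist x y < \<delta> * \<rho> ^ n \<Longrightarrow> meets w w'"
    using separation by metis
  obtain M where M: "0 \<le> M" "\<And>k s. (\<And>w w' x y. w \<in> fin_words N (k * m) \<Longrightarrow> w' \<in> fin_words N (k * m) \<Longrightarrow>
       x \<in> foldr F w ` K \<Longrightarrow> y \<in> foldr F w' ` K \<Longrightarrow> dist x y < s \<Longrightarrow> meets w w') \<Longrightarrow>
    of_nat (N ^ (k * m)) ^ 2 * (\<integral>\<^sup>+x. \<integral>\<^sup>+y. near_integrand s extension x y \<partial>\<mu> \<partial>\<mu>) \<le> ennreal (M * \<kappa> ^ k)"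
    using extension_near_integral by metis
  define \<gamma> where "\<gamma> = \<alpha> + 2 * \<sigma>"
  \<comment> \<open>So \<open>a * \<rho> ^ (k * m)\<close> is the distance that separates cells one block of \<open>m\<close> levels further down.\<close>
  define a where "a = \<delta> * \<rho> ^ m"
  have a: "0 < a"
    using \<delta>(1) rho_pos by (simp add: a_def)
  have "ennreal (s powr (- \<alpha> - 2 * \<sigma>)) * (\<integral>\<^sup>+x. \<integral>\<^sup>+y. near_integrand s extension x y \<partial>\<mu> \<partial>\<mu>)
      \<le> ennreal (M / a powr \<gamma>)" if s: "0 < s" "s < 1" for s
  proof -
    let ?J = "\<integral>\<^sup>+x. \<integral>\<^sup>+y. near_integrand s extension x y \<partial>\<mu> \<partial>\<mu>"
    \<comment> \<open>The level \<open>k * m\<close> at which cells have about the size \<open>s\<close>.\<close>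
    define k where "k = (LEAST k. a * \<rho> ^ (k * m) \<le> s)"
    have ex: "\<exists>k. a * \<rho> ^ (k * m) \<le> s"
    proof -
      have "(\<lambda>k. a * (\<rho> ^ m) ^ k) \<longlonglongrightarrow> a * 0"
        using rho_pos rho_less m_pos
        by (intro tendsto_mult_left LIMSEQ_realpow_zero) (auto simp: power_less_one_iff)
      then have "\<forall>\<^sub>F k in sequentially. a * (\<rho> ^ m) ^ k < s"
        using s by (intro order_tendstoD) auto
      then obtain k where "a * (\<rho> ^ m) ^ k < s"
        using eventually_happens[of _ sequentially] by auto
      then have "a * \<rho> ^ (k * m) \<le> s"
        by (simp add: power_mult[symmetric] mult.commute)
      then show ?thesis by blast
    qed
    have k: "a * \<rho> ^ (k * m) \<le> s"
      unfolding k_def using ex by (rule LeastI_ex)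
    have sep: "meets w w'"
      if w: "w \<in> fin_words N (k * m)" "w' \<in> fin_words N (k * m)"
        "x \<in> foldr F w ` K" "y \<in> foldr F w' ` K" "dist x y < s" for w w' x y
    proof (cases k)
      case 0
      then show ?thesis using w by simp
    next
      case (Suc j)
      have "\<not> a * \<rho> ^ (j * m) \<le> s"
        using Suc unfolding k_def by (intro not_less_Least) simp
      moreover have "a * \<rho> ^ (j * m) = \<delta> * \<rho> ^ (k * m)"
        unfolding Suc a_def by (simp add: power_add)
      ultimately show ?thesis
        using \<delta>(2)[OF w(1-4)] w(5) by simp
    qed
    let ?n = "k * m"
    have Nn: "0 < real (N ^ ?n) ^ 2"
      using N_pos by simp
    have J: "of_nat (N ^ ?n) ^ 2 * ?J \<le> ennreal (M * \<kappa> ^ k)"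
      by (rule M(2)) (rule sep)
    have "s powr (- \<alpha> - 2 * \<sigma>) \<le> (a * \<rho> ^ ?n) powr (- \<alpha> - 2 * \<sigma>)"
      using k a rho_pos \<sigma> by (intro powr_mono2') auto
    also have "\<dots> = 1 / (a * \<rho> ^ ?n) powr \<gamma>"
      by (simp add: \<gamma>_def powr_minus_divide[symmetric])
    also have "\<dots> = real (N ^ ?n) ^ 2 / (a powr \<gamma> * (\<rho> powr (2 * \<sigma> - \<alpha>)) ^ ?n)"
      using N_power_mult[OF a, of ?n \<sigma>] Nn a rho_pos unfolding \<gamma>_def[symmetric]
      by (simp add: field_simps)
    finally have s_le: "s powr (- \<alpha> - 2 * \<sigma>)
        \<le> real (N ^ ?n) ^ 2 / (a powr \<gamma> * (\<rho> powr (2 * \<sigma> - \<alpha>)) ^ ?n)" .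
    let ?c = "1 / (a powr \<gamma> * (\<rho> powr (2 * \<sigma> - \<alpha>)) ^ ?n)"
    have c: "0 \<le> ?c"
      by simp
    have "ennreal (s powr (- \<alpha> - 2 * \<sigma>)) * ?J \<le> ennreal (real (N ^ ?n) ^ 2 * ?c) * ?J"
      using s_le by (intro mult_right_mono ennreal_leI) auto
    also have "\<dots> = ennreal ?c * (of_nat (N ^ ?n) ^ 2 * ?J)"
      using c by (simp only: ennreal_of_nat_eq_real_of_nat ennreal_power ennreal_mult of_nat_0_le_iff
        zero_le_power mult_ac)
    also have "\<dots> \<le> ennreal ?c * ennreal (M * \<kappa> ^ k)"
      by (rule mult_left_mono[OF J]) simp
    also have "\<dots> = ennreal (?c * (M * \<kappa> ^ k))"
      using M(1) kappa_pos c by (intro ennreal_mult[symmetric]) auto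
    also have "\<dots> \<le> ennreal (M / a powr \<gamma>)"
    proof (rule ennreal_leI)
      have "\<kappa> ^ k \<le> ((\<rho> powr (2 * \<sigma> - \<alpha>)) ^ m) ^ k"
        using \<kappa> kappa_pos by (intro power_mono) auto
      also have "\<dots> = (\<rho> powr (2 * \<sigma> - \<alpha>)) ^ ?n"
        by (simp add: power_mult[symmetric] mult.commute)
      finally have "?c * (M * \<kappa> ^ k) \<le> ?c * (M * (\<rho> powr (2 * \<sigma> - \<alpha>)) ^ ?n)"
        using M(1) c by (intro mult_left_mono) auto
      also have "\<dots> = M / a powr \<gamma>"
        using rho_pos by simp
      finally show "?c * (M * \<kappa> ^ k) \<le> M / a powr \<gamma>" .
    qed
    finally show ?thesis .
  qed
  then have "besov_seminorm_sq \<mu> K \<alpha> \<sigma> extension \<le> ennreal (M / a powr \<gamma>)"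
    unfolding besov_seminorm_sq_def besov_integral_eq by (intro SUP_least) auto
  then have "besov_seminorm_sq \<mu> K \<alpha> \<sigma> extension < \<infinity>"
    using le_less_trans[OF _ ennreal_less_top] by simp
  moreover have "(\<integral>\<^sup>+x\<in>K. ennreal (\<bar>extension x\<bar>\<^sup>2) \<partial>\<mu>) < \<infinity>"
  proof -
    have "compact (extension ` K)"
      by (rule compact_continuous_image[OF continuous_on_extension compact_K])
    then obtain b where b: "\<And>x. x \<in> K \<Longrightarrow> \<bar>extension x\<bar> \<le> b"
      using compact_imp_bounded bounded_iff by (metis imageI real_norm_def)
    have "(\<integral>\<^sup>+x\<in>K. ennreal (\<bar>extension x\<bar>\<^sup>2) \<partial>\<mu>) \<le> (\<integral>\<^sup>+x. ennreal (b\<^sup>2) \<partial>\<mu>)"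
    proof (rule nn_integral_mono)
      fix x
      show "ennreal (\<bar>extension x\<bar>\<^sup>2) * indicator K x \<le> ennreal (b\<^sup>2)"
        using power_mono[OF b, of x 2] by (auto simp: indicator_def intro!: ennreal_leI)
    qed
    also have "\<dots> < \<infinity>"
      using emeasure_space_1 by simp
    finally show ?thesis .
  qed
  moreover have "extension \<in> borel_measurable \<mu>"
    by measurable
  ultimately show ?thesis
    by (simp add: besov_space_def)
qed

lemma AE_cell:
  assumes P: "AE x in \<mu>. P x" and w: "w \<in> fin_words N n"
  shows "AE x in \<mu>. P (foldr F w x)"
proof -
  obtain A where A: "{x \<in> space \<mu>. \<not> P x} \<subseteq> A" "emeasure \<mu> A = 0" "A \<in> sets \<mu>"
    using P by (rule AE_E)
  have [measurable]: "A \<in> sets borel"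
    using A(3) by simp
  have "(\<Sum>w\<in>fin_words N n. \<integral>\<^sup>+x. indicator A (foldr F w x) \<partial>\<mu>)
      = of_nat (N ^ n) * (\<integral>\<^sup>+x. indicator A x \<partial>\<mu>)"
    by (rule nn_integral_cells) measurable
  also have "\<dots> = 0"
    using A(2,3) by simp
  finally have "(\<integral>\<^sup>+x. indicator A (foldr F w x) \<partial>\<mu>) = (0::ennreal)"
    using w by (subst (asm) sum_eq_0_iff) auto
  moreover have [measurable]: "foldr F w \<in> borel \<rightarrow>\<^sub>M borel"
    by (rule cell_map_borel[OF w])
  have "(\<lambda>x. indicator A (foldr F w x) :: ennreal) \<in> borel_measurable \<mu>"
    by measurable
  ultimately have "AE x in \<mu>. indicator A (foldr F w x) = (0::ennreal)"
    by (simp add: nn_integral_0_iff_AE)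
  then show ?thesis
    by eventually_elim (use A(1) in \<open>auto simp: indicator_def split: if_splits\<close>)
qed

text \<open>
  Every cell has positive measure, so a function that is almost everywhere equal to \<open>c'\<close> takes this value
  in every small cell, in particular near each boundary point.
\<close>

lemma extension_not_constant:
  assumes pq: "p \<in> V0" "q \<in> V0" "f0 p \<noteq> f0 q"
  shows "\<not> (\<exists>c. AE x in \<mu>. x \<in> K \<longrightarrow> extension x = c)"
proof
  assume "\<exists>c. AE x in \<mu>. x \<in> K \<longrightarrow> extension x = c"
  then obtain c' where c': "AE x in \<mu>. x \<in> K \<longrightarrow> extension x = c'"
    by blast
  obtain B where B: "0 \<le> B" "\<And>k w x p. w \<in> fin_words N (k * m) \<Longrightarrow> x \<in> K \<Longrightarrow> p \<in> V0 \<Longrightarrow>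
      \<bar>extension (foldr F w x) - cell_data k w p\<bar> \<le> B * sqrt (edge_energy (cell_data k w))"
    using extension_cell by metis
  have "f0 p = c'" if p: "p \<in> V0" for p
  proof -
    have "extension p - c' = 0"
    proof (rule zero_if_le_cell_data_energy[of _ "2 * B"])
      fix k
      obtain w a where w: "w \<in> fin_words N (k * m)" "a \<in> V0" "p = foldr F w a"
        using V0_in_cellE[OF p] by metis
      have "AE x in \<mu>. x \<in> K \<and> extension (foldr F w x) = c'"
        using AE_cell[OF c' w(1)] AE_in_K by eventually_elim (use cell_map_in_K[OF w(1)] in blast)
      moreover have "ae_filter \<mu> \<noteq> bot"
        by (rule ae_filter_bot)
      ultimately obtain x where x: "x \<in> K" "extension (foldr F w x) = c'"
        using eventually_happens' by blast
      have "\<bar>extension p - c'\<bar> \<le> 2 * (B * sqrt (edge_energy (cell_data k w)))"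
        using B(2)[OF w(1) x(1) w(2)] B(2)[OF w(1) V0_in_K[OF w(2)] w(2)] x(2) w(3) by simp
      also have "\<dots> \<le> 2 * (B * sqrt (\<kappa> ^ k * edge_energy f0))"
        using B(1) cell_data_energy_le[OF w(1)] by (intro mult_left_mono) auto
      finally show "\<bar>extension p - c'\<bar> \<le> 2 * B * sqrt (\<kappa> ^ k * edge_energy f0)"
        by simp
    qed
    then show ?thesis
      using extension_V0[OF p] by simp
  qed
  then show False
    using pq by simp
qed

end

section \<open>The critical exponent\<close>

theorem theorem4p3:
  fixes N :: nat and \<rho> \<alpha> :: real and b :: "nat \<Rightarrow> 'a::euclidean_space"
    and F :: "nat \<Rightarrow> 'a \<Rightarrow> 'a" and K V0 :: "'a set" and \<mu> :: "'a measure"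
    and Rn :: "nat \<Rightarrow> 'a \<Rightarrow> 'a \<Rightarrow> real" and R :: "'a \<Rightarrow> 'a \<Rightarrow> real"
    and r :: "'a rel" and RQ :: "nat \<Rightarrow> 'a set \<Rightarrow> 'a set \<Rightarrow> ennreal"
  assumes rho: "0 < \<rho>" "\<rho> < 1"
    and F: "\<And>i x. i \<in> {1..N} \<Longrightarrow> F i x = \<rho> *\<^sub>R (x - b i) + b i"
    and K: "attractor N F K" "connected K"
    and pcf: "pcf N F K"
    and V0: "V0 = boundary N F K" "2 \<le> card V0"
    and \<alpha>: "\<alpha> = ln (real N) / \<bar>ln \<rho>\<bar>"
    and \<mu>: "self_similar_measure N F K \<mu>"
    and trace: "\<And>n. is_trace N F V0 n (Rn n)"
    and rates: "\<And>p q. p \<in> V0 \<Longrightarrow> q \<in> V0 \<Longrightarrow> p \<noteq> q \<Longrightarrow> has_growth_rate (\<lambda>n. Rn n p q) (R p q)"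
    and compat: "compatible N F V0 r"
    and qtrace: "\<And>n. is_quotient_trace N F V0 r n (RQ n)"
    and decay: "\<forall>\<^sub>F \<epsilon> in at_right 0. \<forall>I\<in>V0 // r. \<forall>J\<in>V0 // r. I \<noteq> J \<longrightarrow>
        (\<lambda>n. ennreal (R_sharp V0 R powr ((1 - \<epsilon>) * real n)) / RQ n I J) \<longlonglongrightarrow> 0"
  shows "critical_exponent \<mu> K \<alpha> = ereal (1 / 2 * (ln (R_sharp V0 R) / (- ln \<rho>) + \<alpha>))"
proof -
  interpret pcf_homotheties N \<rho> "\<lambda>i. (1 - \<rho>) *\<^sub>R b i" F K V0
  proof
    show "F i x = \<rho> *\<^sub>R x + (1 - \<rho>) *\<^sub>R b i" if "i \<in> {1..N}" for i x
      using F[OF that] by (simp add: algebra_simps)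
  qed (use rho K pcf V0 in auto)
  have ln_rho: "ln \<rho> < 0"
    using rho by simp
  have \<alpha>_nonneg: "0 \<le> \<alpha>"
    unfolding \<alpha> using N_pos by (intro divide_nonneg_nonneg ln_ge_zero) auto
  interpret pcf_homotheties_measure N \<rho> "\<lambda>i. (1 - \<rho>) *\<^sub>R b i" F K V0 \<mu> \<alpha>
  proof
    have "\<alpha> * ln \<rho> = - ln (real N)"
      unfolding \<alpha> using ln_rho by simp
    then show "real N = \<rho> powr (- \<alpha>)"
      using N_pos rho by (simp add: powr_def)
  qed (rule \<mu>)
  define s where "s = R_sharp V0 R"
  have s: "1 < s"
    unfolding s_def using rates by (intro R_sharp_greater) (auto simp: has_growth_rate_def card_V0)
  define \<sigma>0 where "\<sigma>0 = 1 / 2 * (ln s / (- ln \<rho>) + \<alpha>)"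
  \<comment> \<open>The value \<open>\<sigma>0\<close> is where \<open>s * \<rho> powr (2 * \<sigma> - \<alpha>)\<close> passes through \<open>1\<close>.\<close>
  have threshold: "s * \<rho> powr (2 * \<sigma> - \<alpha>) = \<rho> powr (2 * (\<sigma> - \<sigma>0))" for \<sigma>
  proof -
    have "\<rho> powr (2 * \<sigma>0 - \<alpha>) = 1 / s"
    proof -
      have "(2 * \<sigma>0 - \<alpha>) * ln \<rho> = - ln s"
        unfolding \<sigma>0_def using ln_rho by (simp add: field_simps)
      then show ?thesis
        using rho s by (simp add: powr_def exp_minus inverse_eq_divide)
    qed
    moreover have "\<rho> powr (2 * \<sigma> - \<alpha>) = \<rho> powr (2 * (\<sigma> - \<sigma>0)) * \<rho> powr (2 * \<sigma>0 - \<alpha>)"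
      by (simp add: powr_add[symmetric] algebra_simps)
    ultimately show ?thesis
      using s by simp
  qed
  have \<alpha>_less: "\<alpha> / 2 < \<sigma>0"
    unfolding \<sigma>0_def using s ln_rho by (simp add: divide_neg_pos divide_pos_neg)
  let ?S = "{\<sigma>. 0 < \<sigma> \<and> (\<exists>u\<in>besov_space \<mu> K \<alpha> \<sigma>. \<not> (\<exists>c. AE x in \<mu>. x \<in> K \<longrightarrow> u x = c))}"
  have upper: "\<sigma> \<le> \<sigma>0" if \<sigma>: "\<sigma> \<in> ?S" for \<sigma>
  proof (rule ccontr)
    assume "\<not> \<sigma> \<le> \<sigma>0"
    then have "\<rho> powr (2 * (\<sigma> - \<sigma>0)) < 1"
      using rho powr_less_mono'[of \<rho> 0 "2 * (\<sigma> - \<sigma>0)"] by simp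
    then have less: "R_sharp V0 R * \<rho> powr (2 * \<sigma> - \<alpha>) < 1"
      using threshold[of \<sigma>] by (simp add: s_def)
    obtain u where u: "u \<in> besov_space \<mu> K \<alpha> \<sigma>" "\<not> (\<exists>c. AE x in \<mu>. x \<in> K \<longrightarrow> u x = c)"
      using \<sigma> by blast
    obtain c where "AE x in \<mu>. u x = c"
      using besov_function_constant[OF trace rates less u(1)] by blast
    then have "AE x in \<mu>. x \<in> K \<longrightarrow> u x = c"
      by eventually_elim simp
    then show False
      using u(2) by blast
  qed
  have lower: "\<sigma> \<in> ?S" if \<sigma>: "\<alpha> / 2 < \<sigma>" "\<sigma> < \<sigma>0" for \<sigma>
  proof -
    define \<theta> where "\<theta> = \<rho> powr (2 * \<sigma> - \<alpha>)"
    have \<theta>: "0 < \<theta>" "\<theta> < 1" "1 / s < \<theta>"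
    proof -
      show "0 < \<theta>" "\<theta> < 1"
        unfolding \<theta>_def using rho \<sigma>(1) powr_less_mono'[of \<rho> 0 "2 * \<sigma> - \<alpha>"] by auto
      have "\<rho> powr 0 < \<rho> powr (2 * (\<sigma> - \<sigma>0))"
        using rho \<sigma>(2) by (intro powr_less_mono') auto
      then show "1 / s < \<theta>"
        using threshold[of \<sigma>] s rho unfolding \<theta>_def by (simp add: field_simps)
    qed
    have r: "equiv V0 r" and classes: "2 \<le> card (V0 // r)"
      using compat by (auto simp: compatible_def)
    obtain m where m: "0 < m" "\<And>f. invariant r f \<Longrightarrow> \<exists>v. (\<forall>p\<in>V0. v p = f p) \<and>
        (\<forall>w\<in>fin_words N m. invariant r (\<lambda>x. v (foldr F w x))) \<and>
        energy N F V0 m v \<le> \<theta> ^ m * edge_energy f"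
      using decay_extension[OF r qtrace decay[folded s_def] s \<theta>(3)] by blast
    then obtain ext where ext: "\<And>f p. invariant r f \<Longrightarrow> p \<in> V0 \<Longrightarrow> ext f p = f p"
        "\<And>f w. invariant r f \<Longrightarrow> w \<in> fin_words N m \<Longrightarrow> invariant r (\<lambda>x. ext f (foldr F w x))"
        "\<And>f. invariant r f \<Longrightarrow> energy N F V0 m (ext f) \<le> \<theta> ^ m * edge_energy f"
      by metis
    have "finite (V0 // r)"
      using finite_V0 finite_quotient r by (metis equiv_type)
    then obtain I J where IJ: "I \<in> V0 // r" "J \<in> V0 // r" "I \<noteq> J"
      using classes card_le_Suc0_iff_eq[of "V0 // r"] by fastforce
    obtain p q where pq: "p \<in> V0" "q \<in> V0" "I = r `` {p}" "J = r `` {q}"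
      using IJ(1,2) by (auto elim!: quotientE)
    define f0 :: "'a \<Rightarrow> real" where "f0 = indicator I"
    have "p \<in> I"
      unfolding pq(3) by (rule equiv_class_self[OF r pq(1)])
    moreover have "q \<notin> I"
    proof
      assume "q \<in> I"
      then have "(p, q) \<in> r"
        by (simp add: pq(3))
      then show False
        using equiv_class_eq[OF r] pq(3,4) IJ(3) by blast
    qed
    ultimately have f0_pq: "f0 p \<noteq> f0 q"
      by (simp add: f0_def)
    have f0: "invariant r f0"
      unfolding invariant_def
    proof safe
      fix x y assume xy: "(x, y) \<in> r"
      have "(p, x) \<in> r \<longleftrightarrow> (p, y) \<in> r"
        using equivE[OF r] xy by (meson symD transD)
      then show "f0 x = f0 y"
        by (simp add: f0_def pq(3) indicator_def)
    qed
    interpret besov_extension N \<rho> "\<lambda>i. (1 - \<rho>) *\<^sub>R b i" F K V0 \<mu> \<alpha> "invariant r" m "\<theta> ^ m" ext f0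
    proof
      show "\<theta> ^ m < 1"
        using \<theta> m(1) by (simp add: power_less_one_iff)
    qed (use m(1) \<theta> ext f0 in auto)
    have "extension \<in> besov_space \<mu> K \<alpha> \<sigma>"
      using \<alpha>_nonneg \<sigma>(1) by (intro extension_in_besov_space) (auto simp: \<theta>_def)
    moreover have "\<not> (\<exists>c. AE x in \<mu>. x \<in> K \<longrightarrow> extension x = c)"
      by (rule extension_not_constant[OF pq(1,2) f0_pq])
    ultimately show ?thesis
      using \<alpha>_nonneg \<sigma>(1) by auto
  qed
  have "critical_exponent \<mu> K \<alpha> = ereal \<sigma>0"
    unfolding critical_exponent_def
  proof (rule antisym)
    show "(SUP \<sigma>\<in>?S. ereal \<sigma>) \<le> ereal \<sigma>0"
      by (rule SUP_least) (simp add: upper)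
    show "ereal \<sigma>0 \<le> (SUP \<sigma>\<in>?S. ereal \<sigma>)"
      unfolding le_SUP_iff
    proof (intro allI impI)
      fix y assume "y < ereal \<sigma>0"
      then obtain z where z: "y < ereal z" "z < \<sigma>0"
        using ereal_dense2 by force
      define \<sigma> where "\<sigma> = max z ((\<alpha> / 2 + \<sigma>0) / 2)"
      have mid: "\<alpha> / 2 < (\<alpha> / 2 + \<sigma>0) / 2" "(\<alpha> / 2 + \<sigma>0) / 2 < \<sigma>0"
        using \<alpha>_less by (simp_all add: field_simps)
      have "\<sigma> \<in> ?S"
        using mid z(2) unfolding \<sigma>_def by (intro lower) (simp_all only: less_max_iff_disj max_less_iff_conj simp_thms)
      moreover have "y < ereal \<sigma>"
        using z(1) by (rule less_le_trans) (simp add: \<sigma>_def)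
      ultimately show "\<exists>\<sigma>\<in>?S. y < ereal \<sigma>"
        by blast
    qed
  qed
  then show ?thesis
    by (simp add: \<sigma>0_def s_def)
qed

end
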